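(* Let $\mathfrak g$ be a complex simple Lie algebra of type $A_l$ or $C_l$, and let $I\subset\Pi$. Then the parabolic subalgebra $\mathfrak p_I$ has exactly $2^{\,l-\sharp I}$ abelian ideals.
   Context: $\mathfrak h$ is a Cartan subalgebra of $\mathfrak g$, $\Delta$ the root system, $\Delta^+$ a system of positive roots, $\Pi=\{\alpha_1,\dots,\alpha_l\}$ the simple roots, $\mathfrak g_\alpha$ the root spaces. For $I\subset\Pi$, $\Delta_I=\mathbb ZI\cap\Delta$ and $\mathfrak p_I=\mathfrak h\oplus\bigoplus_{\alpha\in\Delta_I\cup\Delta^+}\mathfrak g_\alpha$. $\sharp I$ is the cardinality of $I$. An abelian ideal of $\mathfrak p_I$ here means an abelian ideal of the form $\bigoplus_{\alpha\in\Phi}\mathfrak g_\alpha$ with $\Phi\subset\Delta^+\setminus\Delta_I$ (equivalently, an abelian ad-nilpotent ideal of $\mathfrak p_I$). *)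

theory Defs
  imports Complex_Main
begin

text \<open>
  The whole type is the underlying complex vector space of the Lie algebra; subalgebras,
  ideals and root spaces are subsets of it.
\<close>

locale lie_algebra = vector_space scale
  for scale :: "complex \<Rightarrow> 'a::ab_group_add \<Rightarrow> 'a" +
  fixes br :: "'a \<Rightarrow> 'a \<Rightarrow> 'a"
  assumes br_add_left: "br (x + y) z = br x z + br y z"
    and br_add_right: "br x (y + z) = br x y + br x z"
    and br_scale_left: "br (scale c x) y = scale c (br x y)"
    and br_scale_right: "br x (scale c y) = scale c (br x y)"
    and br_self: "br x x = 0"
    and jacobi: "br x (br y z) + br y (br z x) + br z (br x y) = 0"
begin

definition abelian :: "'a set \<Rightarrow> bool" where
  "abelian S \<longleftrightarrow> (\<forall>x\<in>S. \<forall>y\<in>S. br x y = 0)"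

definition subalgebra :: "'a set \<Rightarrow> bool" where
  "subalgebra S \<longleftrightarrow> subspace S \<and> (\<forall>x\<in>S. \<forall>y\<in>S. br x y \<in> S)"

definition ideal_of :: "'a set \<Rightarrow> 'a set \<Rightarrow> bool" where
  "ideal_of J p \<longleftrightarrow> subspace J \<and> J \<subseteq> p \<and> (\<forall>x\<in>p. \<forall>y\<in>J. br x y \<in> J)"

text \<open>Over the complex numbers, \<open>ad x\<close> is semisimple iff its eigenvectors span.\<close>

definition ad_semisimple :: "'a \<Rightarrow> bool" where
  "ad_semisimple x \<longleftrightarrow> span {y. \<exists>c. br x y = scale c y} = UNIV"

text \<open>
  The usual definition for (complex, finite-dimensional) semisimple Lie algebras: a maximal
  abelian subalgebra all of whose elements are ad-semisimple.
\<close>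

definition cartan_subalgebra :: "'a set \<Rightarrow> bool" where
  "cartan_subalgebra h \<longleftrightarrow>
     subalgebra h \<and> abelian h \<and>
     (\<forall>k. subalgebra k \<and> abelian k \<and> h \<subseteq> k \<longrightarrow> k = h) \<and>
     (\<forall>x\<in>h. ad_semisimple x)"

text \<open>
  Elements of the dual space of \<open>h\<close> are encoded as functions on the whole type that vanish
  outside \<open>h\<close>; this makes the encoding unique and stable under linear combinations.
\<close>

definition dual :: "'a set \<Rightarrow> ('a \<Rightarrow> complex) set" where
  "dual h = {\<alpha>. (\<forall>x\<in>h. \<forall>y\<in>h. \<alpha> (x + y) = \<alpha> x + \<alpha> y) \<and>
                 (\<forall>c. \<forall>x\<in>h. \<alpha> (scale c x) = c * \<alpha> x) \<and>
                 (\<forall>x. x \<notin> h \<longrightarrow> \<alpha> x = 0)}"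

definition root_space :: "'a set \<Rightarrow> ('a \<Rightarrow> complex) \<Rightarrow> 'a set" where
  "root_space h \<alpha> = {x. \<forall>t\<in>h. br t x = scale (\<alpha> t) x}"

definition roots :: "'a set \<Rightarrow> ('a \<Rightarrow> complex) set" where
  "roots h = {\<alpha> \<in> dual h. \<alpha> \<noteq> (\<lambda>_. 0) \<and> root_space h \<alpha> \<noteq> {0}}"

definition int_comb :: "(('a \<Rightarrow> complex) \<Rightarrow> int) \<Rightarrow> ('a \<Rightarrow> complex) set \<Rightarrow> 'a \<Rightarrow> complex" where
  "int_comb k S = (\<lambda>x. \<Sum>\<beta>\<in>S. of_int (k \<beta>) * \<beta> x)"

text \<open>
  The simple roots of a system of positive roots, i.e. a base of the root system: linearly
  independent roots such that the coefficients of every root are integers all of the same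
  sign. Systems of positive roots and bases determine each other, so the base is the primary
  object here and \<open>pos_roots h \<Pi>\<close> is the associated system of positive roots.
\<close>

definition simple_system :: "'a set \<Rightarrow> ('a \<Rightarrow> complex) set \<Rightarrow> bool" where
  "simple_system h \<Pi> \<longleftrightarrow>
     finite \<Pi> \<and> \<Pi> \<subseteq> roots h \<and>
     (\<forall>c. (\<forall>x\<in>h. (\<Sum>\<alpha>\<in>\<Pi>. c \<alpha> * \<alpha> x) = 0) \<longrightarrow> (\<forall>\<alpha>\<in>\<Pi>. c \<alpha> = 0)) \<and>
     (\<forall>\<beta>\<in>roots h. \<exists>k. \<beta> = int_comb k \<Pi> \<and>
        ((\<forall>\<alpha>\<in>\<Pi>. k \<alpha> \<ge> 0) \<or> (\<forall>\<alpha>\<in>\<Pi>. k \<alpha> \<le> 0)))"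

definition pos_roots :: "'a set \<Rightarrow> ('a \<Rightarrow> complex) set \<Rightarrow> ('a \<Rightarrow> complex) set" where
  "pos_roots h \<Pi> = {\<beta> \<in> roots h. \<exists>k. \<beta> = int_comb k \<Pi> \<and> (\<forall>\<alpha>\<in>\<Pi>. k \<alpha> \<ge> 0)}"

text \<open>
  The coroot of \<open>\<alpha>\<close>, the unique element \<open>t\<close> of \<open>[g\<^sub>\<alpha>, g\<^sub>-\<^sub>\<alpha>]\<close> with \<open>\<alpha> t = 2\<close>; hence
  \<open>\<beta> (coroot h \<alpha>)\<close> is the Cartan integer \<open>2 (\<beta>, \<alpha>) / (\<alpha>, \<alpha>)\<close>. Since root spaces are
  one-dimensional, \<open>[g\<^sub>\<alpha>, g\<^sub>-\<^sub>\<alpha>]\<close> consists of brackets, without taking the span.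
\<close>

definition coroot :: "'a set \<Rightarrow> ('a \<Rightarrow> complex) \<Rightarrow> 'a" where
  "coroot h \<alpha> = (THE t. (\<exists>x\<in>root_space h \<alpha>. \<exists>y\<in>root_space h (\<lambda>s. - \<alpha> s). t = br x y) \<and> \<alpha> t = 2)"

definition has_cartan_matrix ::
  "'a set \<Rightarrow> ('a \<Rightarrow> complex) set \<Rightarrow> nat \<Rightarrow> (nat \<Rightarrow> nat \<Rightarrow> int) \<Rightarrow> bool" where
  "has_cartan_matrix h \<Pi> l A \<longleftrightarrow>
     (\<exists>a. bij_betw a {1..l} \<Pi> \<and>
          (\<forall>i\<in>{1..l}. \<forall>j\<in>{1..l}. a i (coroot h (a j)) = of_int (A i j)))"

definition root_subsystem :: "'a set \<Rightarrow> ('a \<Rightarrow> complex) set \<Rightarrow> ('a \<Rightarrow> complex) set" where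
  "root_subsystem h I = {\<beta> \<in> roots h. \<exists>k. \<beta> = int_comb k I}"

text \<open>Sums of distinct root spaces and \<open>h\<close> are automatically direct, so a direct sum is
  written as the span of the union.\<close>

definition root_sum :: "'a set \<Rightarrow> ('a \<Rightarrow> complex) set \<Rightarrow> 'a set" where
  "root_sum h \<Phi> = span (\<Union>\<alpha>\<in>\<Phi>. root_space h \<alpha>)"

definition parabolic :: "'a set \<Rightarrow> ('a \<Rightarrow> complex) set \<Rightarrow> ('a \<Rightarrow> complex) set \<Rightarrow> 'a set" where
  "parabolic h \<Pi> I = span (h \<union> (\<Union>\<alpha>\<in>root_subsystem h I \<union> pos_roots h \<Pi>. root_space h \<alpha>))"

definition abelian_ideals ::
  "'a set \<Rightarrow> ('a \<Rightarrow> complex) set \<Rightarrow> ('a \<Rightarrow> complex) set \<Rightarrow> 'a set set" where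
  "abelian_ideals h \<Pi> I =
     {J. (\<exists>\<Phi>. \<Phi> \<subseteq> pos_roots h \<Pi> - root_subsystem h I \<and> J = root_sum h \<Phi>) \<and>
         ideal_of J (parabolic h \<Pi> I) \<and> abelian J}"

end

locale simple_lie_algebra = lie_algebra scale br
  for scale :: "complex \<Rightarrow> 'a::ab_group_add \<Rightarrow> 'a" and br :: "'a \<Rightarrow> 'a \<Rightarrow> 'a" +
  assumes finite_dim: "\<exists>B. finite B \<and> span B = UNIV"
    and nonabelian: "\<not> abelian UNIV"
    and no_ideals: "ideal_of J UNIV \<Longrightarrow> J = {0} \<or> J = UNIV"

text \<open>
  Entry \<open>(i, j)\<close> is the value of the \<open>i\<close>-th simple root on the \<open>j\<close>-th simple coroot, with
  indices in \<open>{1..l}\<close>; in type C the last simple root is the long one.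
\<close>

definition cartan_matrix_A :: "nat \<Rightarrow> nat \<Rightarrow> int" where
  "cartan_matrix_A i j = (if i = j then 2 else if i = j + 1 \<or> j = i + 1 then -1 else 0)"

definition cartan_matrix_C :: "nat \<Rightarrow> nat \<Rightarrow> nat \<Rightarrow> int" where
  "cartan_matrix_C l i j = (if i = l \<and> l = j + 1 then -2 else cartan_matrix_A i j)"

end

theory Submission
  imports Defs "HOL-Library.Function_Algebras"
begin

text \<open>
  A direct sum of positive root spaces is determined by the set \<open>\<Phi>\<close> of its roots, and each root is
  determined by its integer coordinates with respect to the simple roots. The proof turns the
  question about ideals into one about sets of coordinate vectors, and then into one about Young
  diagrams.

  For the Lie algebra, a Cartan subalgebra \<open>h\<close> is given as a maximal abelian subalgebra with
  semisimple adjoint action, so \<open>g\<close> is spanned by the weight spaces of \<open>h\<close>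
  (\<open>weight_decomposition\<close>). Simplicity and the finiteness of the set of weights take over the role
  of the Killing form. The computation \<open>sl2_ladder\<close> shows that \<open>[x, y]\<close> vanishes
  when \<open>x\<close> and \<open>y\<close> are opposite root vectors with \<open>\<alpha> [x, y] = 0\<close>: such an element acts as zero on
  every root string, hence is central. The roots \<open>\<alpha>\<close> with \<open>[g\<^sub>\<alpha>, g\<^sub>-\<^sub>\<alpha>] = 0\<close> therefore are exactly
  those without an \<open>sl\<^sub>2\<close>-triple, and their root spaces span an ideal (\<open>degenerate_span_ideal\<close>),
  which has to be zero. With an \<open>sl\<^sub>2\<close>-triple for every root come one-dimensional root spaces, the
  description of coroots, reflections, and \<open>[g\<^sub>\<alpha>, g\<^sub>\<beta>] \<noteq> 0\<close> whenever \<open>\<alpha> + \<beta>\<close> is a root.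

  The positive roots are identified by an induction on the height that uses reflections in simple
  roots only (\<open>positive_system_subset\<close>). Its one ingredient besides closure under reflections is
  that every positive root pairs positively with some simple coroot; this follows from a vector \<open>w \<ge> 0\<close>
  such that the product of the Cartan matrix with \<open>w\<close> is positive. The result is the
  familiar list: the intervals \<open>\<alpha>\<^sub>i + \<dots> + \<alpha>\<^sub>j\<^sub>-\<^sub>1\<close> in type A, that is \<open>e\<^sub>i - e\<^sub>j\<close>, and in type C the roots
  \<open>e\<^sub>i - e\<^sub>j\<close> and \<open>e\<^sub>i + e\<^sub>j\<close>.

  An abelian ideal of \<open>p\<^sub>I\<close> now corresponds to a set of coordinate vectors with the same closure
  properties (\<open>bij_coeff_ideals\<close>). The simple roots outside \<open>I\<close> cut the indices of the \<open>e\<^sub>i\<close> into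
  blocks, membership of \<open>e\<^sub>i \<plusminus> e\<^sub>j\<close> depends on the blocks of \<open>i\<close> and \<open>j\<close> only, and what remains is a
  diagram on \<open>m = l - \<sharp>I\<close>: in type A a Young diagram whose first row and first column have lengths
  that add up to at most \<open>m + 1\<close>, in type C a shifted Young diagram inside the staircase of size \<open>m\<close>. Both
  families double in size when \<open>m\<close> grows by one, because the diagrams that are new for \<open>m + 1\<close> arise
  from those for \<open>m\<close> by adding a first row of the largest possible length
  (\<open>corner_diagrams_Suc\<close>, \<open>shifted_diagrams_Suc\<close>).
\<close>

section \<open>Weight spaces\<close>

context vector_space
begin

lemma span_UN_subspaces:
  assumes sub: "\<And>i. i \<in> A \<Longrightarrow> subspace (V i)" and x: "x \<in> span (\<Union>i\<in>A. V i)"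
  obtains F v where "finite F" "F \<subseteq> A" "\<And>i. i \<in> F \<Longrightarrow> v i \<in> V i" "x = (\<Sum>i\<in>F. v i)"
proof -
  have "\<exists>F v. finite F \<and> F \<subseteq> A \<and> (\<forall>i\<in>A. v i \<in> V i) \<and> (\<forall>i. i \<notin> F \<longrightarrow> v i = 0) \<and> x = (\<Sum>i\<in>F. v i)"
    using x
  proof (induction rule: span_induct_alt)
    case base
    show ?case by (rule exI[of _ "{}"], rule exI[of _ "\<lambda>_. 0"]) (auto intro: subspace_0 sub)
  next
    case (step c a y)
    from step(1) obtain i where i: "i \<in> A" "a \<in> V i" by blast
    from step(2) obtain F v where F: "finite F" "F \<subseteq> A" "\<forall>i\<in>A. v i \<in> V i"
      "\<forall>i. i \<notin> F \<longrightarrow> v i = 0" "y = (\<Sum>i\<in>F. v i)" by blast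
    let ?v = "\<lambda>j. v j + (if j = i then c *s a else 0)"
    have "(\<Sum>j\<in>insert i F. ?v j) = (\<Sum>j\<in>insert i F. v j) + c *s a"
      using F(1) by (simp add: sum.distrib)
    also have "(\<Sum>j\<in>insert i F. v j) = y"
      using F by (cases "i \<in> F") (auto simp: insert_absorb)
    finally have "c *s a + y = (\<Sum>j\<in>insert i F. ?v j)" by simp
    moreover have "\<forall>j\<in>A. ?v j \<in> V j"
      using F i sub by (auto intro!: subspace_add subspace_scale)
    ultimately show ?case
      using F(1,2,4) i(1) by (intro exI[of _ "insert i F"] exI[of _ ?v]) auto
  qed
  then show ?thesis using that by blast
qed

end

context lie_algebra
begin

lemma br_zero [simp]: "br 0 x = 0" "br x 0 = 0"
  using br_scale_left[of 0 0 x] br_scale_right[of x 0 0] by simp_all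

lemma br_swap: "br y x = - br x y"
proof -
  have "br (x + y) (x + y) = 0" by (rule br_self)
  then have "br x y + br y x = 0" by (simp only: br_add_left br_add_right) (simp add: br_self add.commute)
  then show ?thesis by (metis add.commute neg_eq_iff_add_eq_0)
qed

lemma br_minus [simp]: "br (- x) y = - br x y" "br x (- y) = - br x y"
  using br_scale_left[of "-1" x y] br_scale_right[of x "-1" y] by simp_all

lemma br_diff_right: "br x (y - z) = br x y - br x z"
  using br_add_right[of x y "- z"] by simp

lemma br_sum_right: "br x (\<Sum>i\<in>F. v i) = (\<Sum>i\<in>F. br x (v i))"
  by (induction F rule: infinite_finite_induct) (simp_all add: br_add_right)

lemma br_derivation: "br x (br y z) = br (br x y) z + br y (br x z)"
proof -
  have "br x (br y z) + br y (br z x) + br z (br x y) = 0" by (rule jacobi)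
  moreover have "br y (br z x) = - br y (br x z)" using br_swap[of z x] by simp
  moreover have "br z (br x y) = - br (br x y) z" by (rule br_swap)
  ultimately show ?thesis by (simp add: algebra_simps)
qed

lemma subspace_root_space: "subspace (root_space T \<alpha>)"
  by (rule subspaceI) (auto simp: root_space_def br_add_right br_scale_right scale_right_distrib
      mult.commute)

lemmas root_space_zero [simp] = subspace_0[OF subspace_root_space]

lemma br_root_space:
  assumes "x \<in> root_space T \<alpha>" "y \<in> root_space T \<beta>"
  shows "br x y \<in> root_space T (\<lambda>t. \<alpha> t + \<beta> t)"
  using assms unfolding root_space_def
  by (auto simp: br_derivation[of _ x y] br_scale_left br_scale_right scale_left_distrib)

text \<open>
  Simultaneous eigenspaces for distinct systems of eigenvalues are independent. Subtracting the
  eigenvalue of the newest summand from each operator removes that summand, and every other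
  summand survives for at least one operator. The weights are indexed so that the lemma covers
  eigenspaces of one operator, indexed by the eigenvalue, as well as root spaces.
\<close>

lemma root_spaces_independent:
  assumes "finite F" and "\<And>i j. i \<in> F \<Longrightarrow> j \<in> F \<Longrightarrow> i \<noteq> j \<Longrightarrow> \<exists>t\<in>T. w i t \<noteq> w j t"
    and "\<And>i. i \<in> F \<Longrightarrow> v i \<in> root_space T (w i)" and "(\<Sum>i\<in>F. v i) = 0"
  shows "\<forall>i\<in>F. v i = 0"
  using assms
proof (induction arbitrary: v rule: finite_induct)
  case (insert i0 F)
  have v0: "v i0 = - (\<Sum>i\<in>F. v i)"
    using insert by (simp add: eq_neg_iff_add_eq_0)
  have "\<forall>i\<in>F. v i = 0"
  proof
    fix i assume i: "i \<in> F"
    with insert.hyps insert.prems(1)[of i i0] obtain t where t: "t \<in> T" "w i t \<noteq> w i0 t" by auto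
    let ?u = "\<lambda>i. scale (w i t - w i0 t) (v i)"
    have "(\<Sum>i\<in>F. ?u i) = (\<Sum>i\<in>F. br t (v i)) - scale (w i0 t) (\<Sum>i\<in>F. v i)"
      using insert.prems(2) t(1)
      by (simp add: scale_left_diff_distrib sum_subtractf scale_sum_right root_space_def)
    also have "\<dots> = br t (- v i0) + scale (w i0 t) (v i0)"
      using v0 by (simp add: br_sum_right)
    also have "\<dots> = 0" using insert.prems(2)[of i0] t(1) by (simp add: root_space_def)
    finally have s: "(\<Sum>i\<in>F. ?u i) = 0" .
    have "\<forall>i\<in>F. ?u i = 0"
      by (rule insert.IH) (use insert.prems s in \<open>auto intro: subspace_scale[OF subspace_root_space]\<close>)
    with i t(2) show "v i = 0" by auto
  qed
  with v0 show ?case by simp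
qed simp

text \<open>
  When \<open>t\<close> is added to a family \<open>T\<close> that commutes with it, the components of a joint eigenvector
  of \<open>T\<close> with respect to \<open>t\<close> are again joint eigenvectors of \<open>T\<close>, by uniqueness of the
  decomposition into eigenvectors of \<open>t\<close>.
\<close>

lemma joint_diagonalization:
  assumes "finite T" and "\<And>s t. s \<in> T \<Longrightarrow> t \<in> T \<Longrightarrow> br s t = 0"
    and "\<And>t. t \<in> T \<Longrightarrow> ad_semisimple t"
  shows "span (\<Union>\<alpha>. root_space T \<alpha>) = UNIV"
  using assms
proof (induction rule: finite_induct)
  case empty
  show ?case by (simp add: root_space_def)
next
  case (insert t T)
  have IH: "span (\<Union>\<alpha>. root_space T \<alpha>) = UNIV" using insert by auto
  have "root_space T \<alpha> \<subseteq> span (\<Union>\<alpha>. root_space (insert t T) \<alpha>)" for \<alpha>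
  proof
    fix v assume v: "v \<in> root_space T \<alpha>"
    have eig: "{y. \<exists>c. br t y = scale c y} = (\<Union>c\<in>UNIV. root_space {t} (\<lambda>_. c))"
      by (auto simp: root_space_def)
    have "v \<in> span (\<Union>c\<in>UNIV. root_space {t} (\<lambda>_. c))"
      using insert.prems(2)[of t] unfolding ad_semisimple_def eig by simp
    then obtain C u where C: "finite C" "\<And>c. c \<in> C \<Longrightarrow> u c \<in> root_space {t} (\<lambda>_. c)"
      "v = (\<Sum>c\<in>C. u c)"
      using span_UN_subspaces[where V = "\<lambda>c. root_space {t} (\<lambda>_. c)" and A = UNIV and x = v]
        subspace_root_space by blast
    have "u c \<in> root_space T \<alpha>" if c: "c \<in> C" for c
    proof -
      have "br s (u c) - scale (\<alpha> s) (u c) = 0" if s: "s \<in> T" for s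
      proof -
        have st: "s \<in> root_space {t} (\<lambda>_. 0)"
          using insert.prems(1)[of t s] s by (auto simp: root_space_def)
        have "\<forall>c\<in>C. br s (u c) - scale (\<alpha> s) (u c) = 0"
        proof (rule root_spaces_independent[of _ "{t}" "\<lambda>c _. c"])
          fix c assume "c \<in> C"
          from br_root_space[OF st C(2)[OF this]] C(2)[OF this]
          show "br s (u c) - scale (\<alpha> s) (u c) \<in> root_space {t} (\<lambda>_. c)"
            by (auto intro: subspace_diff subspace_scale subspace_root_space)
        next
          have "(\<Sum>c\<in>C. br s (u c) - scale (\<alpha> s) (u c)) = br s v - scale (\<alpha> s) v"
            by (simp add: C(3) br_sum_right sum_subtractf scale_sum_right)
          also have "\<dots> = 0" using v s by (simp add: root_space_def)
          finally show "(\<Sum>c\<in>C. br s (u c) - scale (\<alpha> s) (u c)) = 0" .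
        qed (use C in auto)
        with c show ?thesis by blast
      qed
      then show ?thesis by (simp add: root_space_def)
    qed
    then have "u c \<in> root_space (insert t T) (\<alpha>(t := c))" if "c \<in> C" for c
      using C(2)[OF that] that insert.hyps by (auto simp: root_space_def)
    then have "u c \<in> span (\<Union>\<alpha>. root_space (insert t T) \<alpha>)" if "c \<in> C" for c
      using that by (blast intro: span_base)
    then show "v \<in> span (\<Union>\<alpha>. root_space (insert t T) \<alpha>)" unfolding C(3) by (rule span_sum)
  qed
  then have "span (\<Union>\<alpha>. root_space T \<alpha>) \<subseteq> span (\<Union>\<alpha>. root_space (insert t T) \<alpha>)"
    by (intro span_minimal UN_least) auto
  with IH show ?case by auto
qed

lemma dual_comb:
  assumes "\<alpha> \<in> dual h" "\<beta> \<in> dual h"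
  shows "(\<lambda>s. c * \<alpha> s + d * \<beta> s) \<in> dual h"
  using assms by (auto simp: dual_def algebra_simps)

lemma dual_scale: "\<alpha> \<in> dual h \<Longrightarrow> (\<lambda>s. c * \<alpha> s) \<in> dual h"
  using dual_comb[of \<alpha> h \<alpha> c 0] by simp

lemma dual_add: "\<alpha> \<in> dual h \<Longrightarrow> \<beta> \<in> dual h \<Longrightarrow> (\<lambda>s. \<alpha> s + \<beta> s) \<in> dual h"
  using dual_comb[of \<alpha> h \<beta> 1 1] by simp

lemma dual_uminus: "\<alpha> \<in> dual h \<Longrightarrow> (\<lambda>s. - \<alpha> s) \<in> dual h"
  using dual_scale[of \<alpha> h "-1"] by simp

lemma dual_add_scale: "\<alpha> \<in> dual h \<Longrightarrow> \<beta> \<in> dual h \<Longrightarrow> (\<lambda>s. \<alpha> s + c * \<beta> s) \<in> dual h"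
  using dual_comb[of \<alpha> h \<beta> 1 c] by simp

lemma dual_diff_scale: "\<alpha> \<in> dual h \<Longrightarrow> \<beta> \<in> dual h \<Longrightarrow> (\<lambda>s. \<alpha> s - c * \<beta> s) \<in> dual h"
  using dual_comb[of \<alpha> h \<beta> 1 "- c"] by simp

lemma dual_eq_iff: "\<alpha> \<in> dual h \<Longrightarrow> \<beta> \<in> dual h \<Longrightarrow> \<alpha> = \<beta> \<longleftrightarrow> (\<forall>t\<in>h. \<alpha> t = \<beta> t)"
  by (auto simp: dual_def fun_eq_iff)

lemma zero_in_dual [simp]: "(\<lambda>_. 0) \<in> dual h"
  by (simp add: dual_def)

end

locale cartan_pair = simple_lie_algebra scale br
  for scale :: "complex \<Rightarrow> 'a::ab_group_add \<Rightarrow> 'a" and br :: "'a \<Rightarrow> 'a \<Rightarrow> 'a" +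
  fixes h :: "'a set"
  assumes cartan: "cartan_subalgebra h"
begin

abbreviation g :: "('a \<Rightarrow> complex) \<Rightarrow> 'a set" where "g \<equiv> root_space h"

lemma h_subspace: "subspace h"
  using cartan by (simp add: cartan_subalgebra_def subalgebra_def)

lemma h_abelian: "s \<in> h \<Longrightarrow> t \<in> h \<Longrightarrow> br s t = 0"
  using cartan by (simp add: cartan_subalgebra_def abelian_def)

text \<open>
  Maximality of \<open>h\<close> makes it its own centralizer: an element \<open>x\<close> that commutes with \<open>h\<close> spans
  together with \<open>h\<close> an abelian subalgebra.
\<close>

lemma g_zero: "g (\<lambda>_. 0) = h"
proof
  show "h \<subseteq> g (\<lambda>_. 0)" using h_abelian by (auto simp: root_space_def)
  show "g (\<lambda>_. 0) \<subseteq> h"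
  proof
    fix x assume "x \<in> g (\<lambda>_. 0)"
    then have x: "br t x = 0" "br x t = 0" if "t \<in> h" for t
      using that br_swap[of t x] by (auto simp: root_space_def)
    let ?k = "span (insert x h)"
    have dec: "\<exists>c s. s \<in> h \<and> y = scale c x + s" if "y \<in> ?k" for y
    proof -
      from that obtain c where "y - scale c x \<in> span h" by (auto simp: span_breakdown_eq)
      moreover have "span h = h" using h_subspace by (simp add: span_eq_iff)
      ultimately show ?thesis
        by (intro exI[of _ c] exI[of _ "y - scale c x"]) simp
    qed
    have ab: "br y z = 0" if "y \<in> ?k" "z \<in> ?k" for y z
    proof -
      obtain c s d t where "s \<in> h" "y = scale c x + s" "t \<in> h" "z = scale d x + t"
        using dec \<open>y \<in> ?k\<close> \<open>z \<in> ?k\<close> by metis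
      then show ?thesis
        by (simp add: br_add_left br_add_right br_scale_left br_scale_right x br_self h_abelian)
    qed
    then have "subalgebra ?k \<and> abelian ?k"
      by (simp add: subalgebra_def abelian_def span_zero)
    moreover have "h \<subseteq> ?k" by (auto intro: span_base)
    ultimately have "?k = h" using cartan by (auto simp: cartan_subalgebra_def)
    then show "x \<in> h" using span_base[of x "insert x h"] by simp
  qed
qed

lemma finite_spanning_set_h: obtains T where "finite T" "T \<subseteq> h" "span T = h"
proof -
  obtain B where B: "finite B" "span B = UNIV" using finite_dim by blast
  obtain T where T: "T \<subseteq> h" "independent T" "h \<subseteq> span T"
    using maximal_independent_subset[of h] by blast
  have "finite T" using independent_span_bound[OF B(1) T(2)] B(2) by simp
  moreover have "span T = h" using T h_subspace by (simp add: span_minimal subset_antisym)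
  ultimately show ?thesis using that T by blast
qed

text \<open>
  It suffices to diagonalize a finite spanning set of \<open>h\<close>, since a joint eigenvector of such a set
  is an eigenvector of all of \<open>h\<close>, with eigenvalues that depend linearly on the element.
\<close>

lemma weight_decomposition: "span (\<Union>\<alpha>\<in>dual h. g \<alpha>) = UNIV"
proof -
  obtain T where T: "finite T" "T \<subseteq> h" "span T = h" by (rule finite_spanning_set_h)
  have "span (\<Union>\<alpha>. root_space T \<alpha>) = UNIV"
  proof (rule joint_diagonalization)
    show "br s t = 0" if "s \<in> T" "t \<in> T" for s t using that T(2) h_abelian by blast
    show "ad_semisimple t" if "t \<in> T" for t
      using that T(2) cartan unfolding cartan_subalgebra_def by blast
  qed (rule T(1))
  moreover have "root_space T \<alpha> \<subseteq> (\<Union>\<alpha>\<in>dual h. g \<alpha>)" for \<alpha>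
  proof
    fix v assume v: "v \<in> root_space T \<alpha>"
    show "v \<in> (\<Union>\<alpha>\<in>dual h. g \<alpha>)"
    proof (cases "v = 0")
      case True
      then show ?thesis by (intro UN_I[of "\<lambda>_. 0"]) auto
    next
      case False
      have ex: "\<exists>c. br s v = scale c v" if "s \<in> h" for s
      proof -
        from that T(3) have "s \<in> span T" by simp
        then show ?thesis
        proof (induction rule: span_induct_alt)
          case base
          show ?case by (rule exI[of _ 0]) simp
        next
          case (step c a y)
          then obtain d where "br y v = scale d v" by blast
          moreover have "br a v = scale (\<alpha> a) v" using v step(1) by (simp add: root_space_def)
          ultimately have "br (scale c a + y) v = scale (c * \<alpha> a + d) v"
            by (simp add: br_add_left br_scale_left scale_left_distrib)
          then show ?case by blast
        qed
      qed
      define \<mu> where "\<mu> s = (if s \<in> h then SOME c. br s v = scale c v else 0)" for s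
      have \<mu>: "br s v = scale (\<mu> s) v" if "s \<in> h" for s
        using someI_ex[OF ex[OF that]] that by (simp add: \<mu>_def)
      have "\<mu> \<in> dual h"
        unfolding dual_def
      proof (intro CollectI conjI ballI allI impI)
        fix x y assume xy: "x \<in> h" "y \<in> h"
        then have "x + y \<in> h" using h_subspace by (simp add: subspace_add)
        from \<mu>[OF this] have "scale (\<mu> (x + y)) v = scale (\<mu> x + \<mu> y) v"
          by (simp add: br_add_left \<mu> xy scale_left_distrib)
        with False show "\<mu> (x + y) = \<mu> x + \<mu> y" by simp
      next
        fix c x assume x: "x \<in> h"
        then have "scale c x \<in> h" using h_subspace by (simp add: subspace_scale)
        from \<mu>[OF this] have "scale (\<mu> (scale c x)) v = scale (c * \<mu> x) v"
          by (metis br_scale_left \<mu> x scale_scale)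
        with False show "\<mu> (scale c x) = c * \<mu> x" by (metis scale_cancel_right)
      qed (simp add: \<mu>_def)
      moreover have "v \<in> g \<mu>" using \<mu> by (simp add: root_space_def)
      ultimately show ?thesis by blast
    qed
  qed
  ultimately show ?thesis
    using span_mono[of "\<Union>\<alpha>. root_space T \<alpha>" "\<Union>\<alpha>\<in>dual h. g \<alpha>"] by blast
qed

definition weights :: "('a \<Rightarrow> complex) set" where
  "weights = {\<alpha> \<in> dual h. g \<alpha> \<noteq> {0}}"

lemma roots_weights: "roots h = weights - {\<lambda>_. 0}"
  by (auto simp: roots_def weights_def)

lemma weights_independent:
  assumes "finite F" "F \<subseteq> dual h" "\<And>\<alpha>. \<alpha> \<in> F \<Longrightarrow> v \<alpha> \<in> g \<alpha>" "(\<Sum>\<alpha>\<in>F. v \<alpha>) = 0" "\<alpha> \<in> F"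
  shows "v \<alpha> = 0"
proof -
  have "\<forall>\<alpha>\<in>F. v \<alpha> = 0"
    by (rule root_spaces_independent[of _ h "\<lambda>\<alpha>. \<alpha>"])
      (use assms dual_eq_iff[of _ h] in \<open>auto simp: subset_iff\<close>)
  with assms(5) show ?thesis by blast
qed

lemma span_root_spacesE:
  assumes "x \<in> span (\<Union>\<alpha>\<in>A. g \<alpha>)"
  obtains F v where "finite F" "F \<subseteq> A" "\<And>\<alpha>. \<alpha> \<in> F \<Longrightarrow> v \<alpha> \<in> g \<alpha>" "x = (\<Sum>\<alpha>\<in>F. v \<alpha>)"
  using span_UN_subspaces[where V = g and A = A and x = x] assms subspace_root_space by blast

lemma root_vector_in_span:
  assumes "A \<subseteq> dual h" "\<beta> \<in> dual h" "x \<in> g \<beta>" "x \<noteq> 0" "x \<in> span (\<Union>\<alpha>\<in>A. g \<alpha>)"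
  shows "\<beta> \<in> A"
proof (rule ccontr)
  assume nb: "\<beta> \<notin> A"
  from assms(5) obtain F v where F: "finite F" "F \<subseteq> A" "\<And>i. i \<in> F \<Longrightarrow> v i \<in> g i"
    "x = (\<Sum>i\<in>F. v i)"
    using span_root_spacesE by metis
  have "(\<Sum>i\<in>insert \<beta> F. (v(\<beta> := - x)) i) = - x + (\<Sum>i\<in>F. (v(\<beta> := - x)) i)"
    using F(1,2) nb by (subst sum.insert) auto
  also have "(\<Sum>i\<in>F. (v(\<beta> := - x)) i) = x"
    unfolding F(4) by (rule sum.cong) (use F(2) nb in auto)
  finally have s: "(\<Sum>i\<in>insert \<beta> F. (v(\<beta> := - x)) i) = 0" by simp
  have "(v(\<beta> := - x)) \<beta> = 0"
    by (rule weights_independent[OF _ _ _ s])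
      (use F assms in \<open>auto intro: subspace_neg[OF subspace_root_space]\<close>)
  with assms(4) show False by simp
qed

text \<open>
  Finitely many weight spaces contain a finite spanning set; a further weight would contradict
  independence.
\<close>

lemma finite_weights: "finite weights"
proof -
  obtain B where B: "finite B" "span B = UNIV" using finite_dim by blast
  have "\<exists>F. finite F \<and> F \<subseteq> dual h \<and> b \<in> span (\<Union>\<alpha>\<in>F. g \<alpha>)" for b
  proof -
    have "b \<in> span (\<Union>\<alpha>\<in>dual h. g \<alpha>)" using weight_decomposition by simp
    then obtain F v where "finite F" "F \<subseteq> dual h" "\<And>i. i \<in> F \<Longrightarrow> v i \<in> g i" "b = (\<Sum>i\<in>F. v i)"
      using span_root_spacesE by metis
    moreover from this have "b \<in> span (\<Union>\<alpha>\<in>F. g \<alpha>)"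
      by (simp only:) (rule span_sum, blast intro: span_base)
    ultimately show ?thesis by blast
  qed
  then obtain F where F: "finite (F b)" "F b \<subseteq> dual h" "b \<in> span (\<Union>\<alpha>\<in>F b. g \<alpha>)" for b
    by metis
  let ?A = "\<Union>b\<in>B. F b"
  have "B \<subseteq> span (\<Union>\<alpha>\<in>?A. g \<alpha>)"
    using F(3) span_mono[of "\<Union>\<alpha>\<in>F _. g \<alpha>" "\<Union>\<alpha>\<in>?A. g \<alpha>"] by blast
  then have U: "span (\<Union>\<alpha>\<in>?A. g \<alpha>) = UNIV" using B(2) span_minimal[OF _ subspace_span] by blast
  have "weights \<subseteq> ?A"
  proof
    fix \<beta> assume b: "\<beta> \<in> weights"
    then obtain x where "x \<in> g \<beta>" "x \<noteq> 0" using root_space_zero[of h \<beta>] by (auto simp: weights_def)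
    moreover have "?A \<subseteq> dual h" using F(2) by blast
    ultimately show "\<beta> \<in> ?A" using root_vector_in_span[of ?A \<beta> x] b U by (auto simp: weights_def)
  qed
  then show ?thesis using B(1) F(1) finite_subset by blast
qed

end

section \<open>Strings of weights\<close>

context cartan_pair
begin

lemma weight_vectorE:
  assumes "\<mu> \<in> weights" obtains v where "v \<in> g \<mu>" "v \<noteq> 0"
  using assms root_space_zero[of h \<mu>] unfolding weights_def by blast

lemma weightsI: "\<mu> \<in> dual h \<Longrightarrow> v \<in> g \<mu> \<Longrightarrow> v \<noteq> 0 \<Longrightarrow> \<mu> \<in> weights"
  by (auto simp: weights_def)

lemma ad_power_root_space:
  assumes "x \<in> g \<alpha>" "v \<in> g \<mu>"
  shows "(br x ^^ k) v \<in> g (\<lambda>s. \<mu> s + of_nat k * \<alpha> s)"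
proof (induction k)
  case (Suc k)
  from br_root_space[OF assms(1) Suc] show ?case
    by (simp add: algebra_simps)
qed (simp add: assms)

lemma ad_power_root_space_neg:
  assumes "y \<in> g (\<lambda>s. - \<alpha> s)" "v \<in> g \<mu>"
  shows "(br y ^^ k) v \<in> g (\<lambda>s. \<mu> s - of_nat k * \<alpha> s)"
  using ad_power_root_space[OF assms, of k] by simp

text \<open>
  The finiteness of the set of weights is used in this form only: to see that root vectors act
  nilpotently, and that a translation cannot map weights to weights.
\<close>

lemma no_infinite_translates:
  assumes d: "\<delta> \<noteq> (\<lambda>_. 0)"
  shows "\<exists>k::nat. (\<lambda>s. \<mu> s + of_nat k * \<delta> s) \<notin> weights"
proof (rule ccontr)
  let ?f = "\<lambda>k::nat. (\<lambda>s. \<mu> s + of_nat k * \<delta> s)"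
  assume "\<nexists>k. ?f k \<notin> weights"
  then have "range ?f \<subseteq> weights" by blast
  then have "finite (range ?f)" using finite_weights finite_subset by blast
  moreover have "inj ?f"
  proof (rule injI)
    fix i j assume e: "?f i = ?f j"
    obtain s where "\<delta> s \<noteq> 0" using d by (auto simp: fun_eq_iff)
    with fun_cong[OF e, of s] show "i = j" by simp
  qed
  ultimately show False using finite_imageD infinite_UNIV_nat by blast
qed

lemma ad_nilpotent:
  assumes "\<alpha> \<in> dual h" "\<alpha> \<noteq> (\<lambda>_. 0)" "x \<in> g \<alpha>" "\<mu> \<in> dual h" "v \<in> g \<mu>"
  shows "\<exists>n. (br x ^^ n) v = 0"
  using no_infinite_translates[OF assms(2), of \<mu>] ad_power_root_space[OF assms(3,5)]
    dual_add_scale[OF assms(4,1)] weightsI by blast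

lemma ad_last_nonzero:
  assumes "\<alpha> \<in> dual h" "\<alpha> \<noteq> (\<lambda>_. 0)" "x \<in> g \<alpha>" "\<mu> \<in> dual h" "v \<in> g \<mu>" "v \<noteq> 0"
  obtains n where "\<And>j. j \<le> n \<Longrightarrow> (br x ^^ j) v \<noteq> 0" "br x ((br x ^^ n) v) = 0"
proof -
  let ?P = "\<lambda>n. (br x ^^ n) v = 0"
  define m where "m = (LEAST n. ?P n)"
  have m: "?P m" unfolding m_def using ad_nilpotent[OF assms(1-5)] by (rule LeastI_ex)
  then obtain n where n: "m = Suc n" using assms(6) by (cases m) auto
  show ?thesis
  proof (rule that[of n])
    fix j assume "j \<le> n"
    then have "j < (LEAST n. ?P n)" using n m_def by simp
    then show "(br x ^^ j) v \<noteq> 0" by (rule not_less_Least)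
  next
    show "br x ((br x ^^ n) v) = 0" using m n by simp
  qed
qed

lemma root_in_dual: "\<alpha> \<in> roots h \<Longrightarrow> \<alpha> \<in> dual h"
  and root_nonzero: "\<alpha> \<in> roots h \<Longrightarrow> \<alpha> \<noteq> (\<lambda>_. 0)"
  and root_weight: "\<alpha> \<in> roots h \<Longrightarrow> \<alpha> \<in> weights"
  by (auto simp: roots_def weights_def)

lemma rootsI: "\<alpha> \<in> dual h \<Longrightarrow> \<alpha> \<noteq> (\<lambda>_. 0) \<Longrightarrow> v \<in> g \<alpha> \<Longrightarrow> v \<noteq> 0 \<Longrightarrow> \<alpha> \<in> roots h"
  by (auto simp: roots_def)

lemma bracket_opposite_in_h: "x \<in> g \<alpha> \<Longrightarrow> y \<in> g (\<lambda>s. - \<alpha> s) \<Longrightarrow> br x y \<in> h"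
  using br_root_space[of x h \<alpha> y "\<lambda>s. - \<alpha> s"] g_zero by simp

lemma opposite_nonzero: "\<alpha> \<noteq> (\<lambda>_. 0) \<Longrightarrow> (\<lambda>s::'a. - \<alpha> s :: complex) \<noteq> (\<lambda>_. 0)"
  by (auto simp: fun_eq_iff)

text \<open>
  The usual \<open>sl\<^sub>2\<close> computation on a vector \<open>w\<close> killed by \<open>x\<close>. The value of \<open>\<alpha>\<close> on \<open>[x, y]\<close>
  is arbitrary here: for the value 2 this is \<open>sl\<^sub>2\<close>-theory proper, while the case \<open>\<alpha> [x, y] = 0\<close>, in which \<open>x\<close>, \<open>y\<close> and \<open>[x, y]\<close> span a nilpotent
  algebra, serves to show that \<open>[x, y] = 0\<close> then.
\<close>

lemma sl2_ladder:
  assumes x: "x \<in> g \<alpha>" and y: "y \<in> g (\<lambda>s. - \<alpha> s)" and w: "w \<in> g \<mu>" "br x w = 0"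
  defines "z \<equiv> br x y"
  shows "br x ((br y ^^ Suc j) w)
    = scale (of_nat (Suc j) * (\<mu> z - of_nat j * \<alpha> z / 2)) ((br y ^^ j) w)"
proof (induction j)
  have z: "z \<in> h" unfolding z_def by (rule bracket_opposite_in_h[OF x y])
  {
    case 0
    have "br x (br y w) = br z w" using br_derivation[of x y w] w by (simp add: z_def)
    also have "\<dots> = scale (\<mu> z) w" using w(1) z by (simp add: root_space_def)
    finally show ?case by simp
  next
    case (Suc j)
    let ?u = "(br y ^^ Suc j) w"
    have "br x (br y ?u) = br z ?u + br y (br x ?u)"
      using br_derivation[of x y ?u] by (simp add: z_def)
    also have "br z ?u = scale (\<mu> z - of_nat (Suc j) * \<alpha> z) ?u"
      using ad_power_root_space_neg[OF y w(1), of "Suc j"] z unfolding root_space_def by blast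
    also have "br y (br x ?u) = scale (of_nat (Suc j) * (\<mu> z - of_nat j * \<alpha> z / 2)) ?u"
      unfolding Suc by (simp add: br_scale_right)
    also have "scale (\<mu> z - of_nat (Suc j) * \<alpha> z) ?u + \<dots>
      = scale (of_nat (Suc (Suc j)) * (\<mu> z - of_nat (Suc j) * \<alpha> z / 2)) ?u"
      unfolding scale_left_distrib[symmetric] by (rule arg_cong2[where f = scale])
        (simp_all add: field_simps)
    finally show ?case by simp
  }
qed

text \<open>
  The string of \<open>w\<close> under \<open>y\<close> ends after some last nonzero vector, and there the coefficient of
  \<open>sl2_ladder\<close> has to vanish.
\<close>

lemma highest_weight:
  assumes a: "\<alpha> \<in> roots h" and x: "x \<in> g \<alpha>" and y: "y \<in> g (\<lambda>s. - \<alpha> s)"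
    and m: "\<mu> \<in> dual h" and w: "w \<in> g \<mu>" "w \<noteq> 0" "br x w = 0"
  obtains N where "2 * \<mu> (br x y) = of_nat N * \<alpha> (br x y)" "\<And>j. j \<le> N \<Longrightarrow> (br y ^^ j) w \<noteq> 0"
proof -
  obtain N where N: "\<And>j. j \<le> N \<Longrightarrow> (br y ^^ j) w \<noteq> 0" "br y ((br y ^^ N) w) = 0"
    using ad_last_nonzero[OF dual_uminus[OF root_in_dual[OF a]]
        opposite_nonzero[OF root_nonzero[OF a]] y m w(1,2)] by blast
  have "scale (of_nat (Suc N) * (\<mu> (br x y) - of_nat N * \<alpha> (br x y) / 2)) ((br y ^^ N) w) = 0"
    using sl2_ladder[OF x y w(1,3), of N] N(2) by simp
  moreover have "of_nat (Suc N) \<noteq> (0::complex)" by (simp only: of_nat_eq_0_iff)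
  ultimately have "\<mu> (br x y) - of_nat N * \<alpha> (br x y) / 2 = 0"
    using N(1)[of N] by (metis mult_eq_0_iff order_refl scale_eq_0_iff)
  then have "2 * \<mu> (br x y) = of_nat N * \<alpha> (br x y)" by (simp add: field_simps)
  with N(1) that show ?thesis by blast
qed

lemma raise_to_top:
  assumes a: "\<alpha> \<in> roots h" and x: "x \<in> g \<alpha>" and m: "\<mu> \<in> dual h" and v: "v \<in> g \<mu>" "v \<noteq> 0"
  obtains k w where "w \<in> g (\<lambda>s. \<mu> s + of_nat k * \<alpha> s)" "w \<noteq> 0" "br x w = 0"
proof -
  obtain k where k: "\<And>j. j \<le> k \<Longrightarrow> (br x ^^ j) v \<noteq> 0" "br x ((br x ^^ k) v) = 0"
    using ad_last_nonzero[OF root_in_dual[OF a] root_nonzero[OF a] x m v] by blast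
  from that[OF ad_power_root_space[OF x v(1)] k(1)[OF order_refl] k(2)] show ?thesis .
qed

lemma center_trivial:
  assumes "\<And>v. br z v = 0" shows "z = 0"
proof -
  let ?Z = "{z. \<forall>v. br z v = 0}"
  have "subspace ?Z" by (rule subspaceI) (auto simp: br_add_left br_scale_left)
  moreover have "br x y \<in> ?Z" if "y \<in> ?Z" for x y
  proof -
    have "br x y = 0" using that br_swap[of y x] by simp
    then show ?thesis by simp
  qed
  ultimately have "ideal_of ?Z UNIV" unfolding ideal_of_def by blast
  then have "?Z = {0} \<or> ?Z = UNIV" by (rule no_ideals)
  moreover have "?Z \<noteq> UNIV" using nonabelian by (auto simp: abelian_def)
  moreover have "z \<in> ?Z" using assms by blast
  ultimately show ?thesis by blast
qed

lemma vanishing_on_weights: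
  assumes z: "z \<in> h" "\<And>\<beta>. \<beta> \<in> weights \<Longrightarrow> \<beta> z = 0"
  shows "z = 0"
proof (rule center_trivial)
  fix v
  have "v \<in> span (\<Union>\<alpha>\<in>dual h. g \<alpha>)" using weight_decomposition by simp
  then show "br z v = 0"
  proof (induction rule: span_induct_alt)
    case (step c a y)
    then obtain \<alpha> where al: "\<alpha> \<in> dual h" "a \<in> g \<alpha>" by blast
    have "br z a = 0"
    proof (cases "a = 0")
      case False
      with al have "\<alpha> z = 0" by (intro z(2) weightsI)
      with al z(1) show ?thesis by (simp add: root_space_def)
    qed simp
    with step(2) show ?case by (simp add: br_add_right br_scale_right)
  qed simp
qed

text \<open>
  If \<open>\<alpha> z = 0\<close> for \<open>z = [x, y]\<close>, then \<open>z\<close> takes the same value on all weights of an \<open>\<alpha>\<close>-string, and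
  \<open>highest_weight\<close> makes this value zero. Hence \<open>z\<close> is central.
\<close>

lemma opposite_bracket_nondegenerate:
  assumes a: "\<alpha> \<in> roots h" and x: "x \<in> g \<alpha>" and y: "y \<in> g (\<lambda>s. - \<alpha> s)"
    and z: "\<alpha> (br x y) = 0"
  shows "br x y = 0"
proof (rule vanishing_on_weights)
  show "br x y \<in> h" by (rule bracket_opposite_in_h[OF x y])
next
  fix \<beta> assume b: "\<beta> \<in> weights"
  then have bd: "\<beta> \<in> dual h" by (simp add: weights_def)
  from b obtain v where v: "v \<in> g \<beta>" "v \<noteq> 0" by (rule weight_vectorE)
  obtain k w where w: "w \<in> g (\<lambda>s. \<beta> s + of_nat k * \<alpha> s)" "w \<noteq> 0" "br x w = 0"
    by (rule raise_to_top[OF a x bd v])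
  obtain N where "2 * (\<beta> (br x y) + of_nat k * \<alpha> (br x y)) = of_nat N * \<alpha> (br x y)"
    using highest_weight[OF a x y dual_add_scale[OF bd root_in_dual[OF a]] w] by blast
  with z show "\<beta> (br x y) = 0" by simp
qed

definition sl2_triple :: "('a \<Rightarrow> complex) \<Rightarrow> 'a \<Rightarrow> 'a \<Rightarrow> bool" where
  "sl2_triple \<alpha> x y \<longleftrightarrow> \<alpha> \<in> roots h \<and> x \<in> g \<alpha> \<and> y \<in> g (\<lambda>s. - \<alpha> s) \<and> \<alpha> (br x y) = 2"

lemma sl2_tripleD:
  assumes "sl2_triple \<alpha> x y"
  shows "\<alpha> \<in> roots h" "x \<in> g \<alpha>" "y \<in> g (\<lambda>s. - \<alpha> s)" "\<alpha> (br x y) = 2" "br x y \<in> h"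
    "\<alpha> \<in> dual h" "\<alpha> \<noteq> (\<lambda>_. 0)"
  using assms bracket_opposite_in_h root_in_dual root_nonzero by (auto simp: sl2_triple_def)

lemma dual_at_zero: "\<alpha> \<in> dual h \<Longrightarrow> \<alpha> 0 = 0"
  using subspace_0[OF h_subspace] scale_zero_left[of 0] unfolding dual_def
  by (metis (mono_tags, lifting) mem_Collect_eq mult_zero_left)

lemma dual_at_scale: "\<alpha> \<in> dual h \<Longrightarrow> t \<in> h \<Longrightarrow> \<alpha> (scale c t) = c * \<alpha> t"
  by (simp add: dual_def)

lemma dual_at_add: "\<alpha> \<in> dual h \<Longrightarrow> s \<in> h \<Longrightarrow> t \<in> h \<Longrightarrow> \<alpha> (s + t) = \<alpha> s + \<alpha> t"
  by (simp add: dual_def)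

lemma dual_at_uminus: "\<alpha> \<in> dual h \<Longrightarrow> t \<in> h \<Longrightarrow> \<alpha> (- t) = - \<alpha> t"
  using dual_at_scale[of \<alpha> t "-1"] by simp

lemma sl2_triple_opposite:
  assumes "sl2_triple \<alpha> x y" shows "sl2_triple (\<lambda>s. - \<alpha> s) y x"
proof -
  note t = sl2_tripleD[OF assms]
  have "y \<noteq> 0" using t(4) dual_at_zero[OF t(6)] by auto
  then have "(\<lambda>s. - \<alpha> s) \<in> roots h"
    using rootsI[OF dual_uminus[OF t(6)] opposite_nonzero[OF t(7)] t(3)] by simp
  moreover have "\<alpha> (br y x) = -2"
    using br_swap[of y x] dual_at_uminus[OF t(6,5)] t(4) by simp
  ultimately show ?thesis using t(2,3) by (simp add: sl2_triple_def)
qed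

text \<open>
  After subtraction of a multiple of \<open>y\<close>, a vector \<open>u\<close> of \<open>g\<^sub>-\<^sub>\<alpha>\<close> satisfies \<open>[x, u] = 0\<close>. It would then be
  a highest weight vector of weight \<open>-2\<close>, which is impossible.
\<close>

lemma sl2_opposite_one_dim:
  assumes tr: "sl2_triple \<alpha> x y" and u: "u \<in> g (\<lambda>s. - \<alpha> s)"
  shows "\<exists>c. u = scale c y"
proof -
  note t = sl2_tripleD[OF tr]
  let ?c = "\<alpha> (br x u) / 2"
  let ?u = "u - scale ?c y"
  have u': "?u \<in> g (\<lambda>s. - \<alpha> s)"
    using u t(3) by (intro subspace_diff subspace_scale subspace_root_space)
  have xu: "br x u \<in> h" by (rule bracket_opposite_in_h[OF t(2) u])
  have "\<alpha> (br x ?u) = \<alpha> (br x u + scale (- ?c) (br x y))"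
    by (simp add: br_diff_right br_scale_right)
  also have "\<dots> = \<alpha> (br x u) + - ?c * \<alpha> (br x y)"
    using dual_at_add[OF t(6) xu subspace_scale[OF h_subspace t(5), of "- ?c"]]
      dual_at_scale[OF t(6,5), of "- ?c"] by simp
  also have "\<dots> = 0" by (simp add: t(4))
  finally have 0: "br x ?u = 0"
    by (rule opposite_bracket_nondegenerate[OF t(1,2) u'])
  have "?u = 0"
  proof (rule ccontr)
    assume "?u \<noteq> 0"
    then obtain N where "2 * - \<alpha> (br x y) = of_nat N * \<alpha> (br x y)"
      using highest_weight[OF t(1-3) dual_uminus[OF t(6)] u' _ 0] by blast
    then have "of_nat (N + 2) = (0::complex)" by (simp add: t(4))
    then show False by (simp only: of_nat_eq_0_iff)
  qed
  then show ?thesis by auto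
qed

lemma sl2_one_dim:
  assumes "sl2_triple \<alpha> x y" and "u \<in> g \<alpha>"
  shows "\<exists>c. u = scale c x"
  using sl2_opposite_one_dim[OF sl2_triple_opposite[OF assms(1)]] assms(2) by simp

text \<open>
  The string of length \<open>N + 1\<close> below a vector \<open>w\<close> that lies \<open>k\<close> steps above the weight \<open>\<mu>\<close>; the
  coefficients are those of the irreducible \<open>sl\<^sub>2\<close>-module of dimension \<open>N + 1\<close>.
\<close>

definition sl2_string :: "('a \<Rightarrow> complex) \<Rightarrow> 'a \<Rightarrow> 'a \<Rightarrow> ('a \<Rightarrow> complex) \<Rightarrow> nat \<Rightarrow> nat \<Rightarrow> 'a \<Rightarrow> bool" where
  "sl2_string \<alpha> x y \<mu> k N w \<longleftrightarrow>
     w \<in> g (\<lambda>s. \<mu> s + of_nat k * \<alpha> s) \<and> \<mu> (br x y) + 2 * of_nat k = of_nat N \<and>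
     (\<forall>j\<le>N. (br y ^^ j) w \<noteq> 0) \<and>
     (\<forall>j. br x ((br y ^^ Suc j) w) = scale (of_nat (Suc j) * (of_nat N - of_nat j)) ((br y ^^ j) w))"

lemma sl2_stringD:
  assumes "sl2_string \<alpha> x y \<mu> k N w"
  shows "w \<in> g (\<lambda>s. \<mu> s + of_nat k * \<alpha> s)" "\<mu> (br x y) + 2 * of_nat k = of_nat N"
    "j \<le> N \<Longrightarrow> (br y ^^ j) w \<noteq> 0"
    "br x ((br y ^^ Suc j) w) = scale (of_nat (Suc j) * (of_nat N - of_nat j)) ((br y ^^ j) w)"
  using assms unfolding sl2_string_def by blast+

lemma sl2_highest_weight:
  assumes tr: "sl2_triple \<alpha> x y" and m: "\<mu> \<in> dual h" "v \<in> g \<mu>" "v \<noteq> 0"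
  obtains k w N where "sl2_string \<alpha> x y \<mu> k N w"
proof -
  note t = sl2_tripleD[OF tr]
  obtain k w where w: "w \<in> g (\<lambda>s. \<mu> s + of_nat k * \<alpha> s)" "w \<noteq> 0" "br x w = 0"
    by (rule raise_to_top[OF t(1,2) m])
  obtain N where N: "2 * (\<mu> (br x y) + of_nat k * \<alpha> (br x y)) = of_nat N * \<alpha> (br x y)"
      "\<And>j. j \<le> N \<Longrightarrow> (br y ^^ j) w \<noteq> 0"
    using highest_weight[OF t(1-3) dual_add_scale[OF m(1) t(6)] w] by blast
  have "2 * (\<mu> (br x y) + 2 * of_nat k) = 2 * of_nat N" using N(1) by (simp add: t(4))
  then have N': "\<mu> (br x y) + 2 * of_nat k = of_nat N"
    by (metis mult_cancel_left zero_neq_numeral)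
  have "br x ((br y ^^ Suc j) w)
      = scale (of_nat (Suc j) * (of_nat N - of_nat j)) ((br y ^^ j) w)" for j
    unfolding sl2_ladder[OF t(2,3) w(1,3)] using N'
    by (intro arg_cong2[where f = scale]) (simp_all add: t(4) algebra_simps)
  with w(1) N(2) N' have "sl2_string \<alpha> x y \<mu> k N w" unfolding sl2_string_def by blast
  then show ?thesis by (rule that)
qed

lemma sl2_weight_integral:
  assumes tr: "sl2_triple \<alpha> x y" and m: "\<mu> \<in> weights"
  obtains m :: int where "\<mu> (br x y) = of_int m"
proof -
  obtain v where v: "v \<in> g \<mu>" "v \<noteq> 0" using m by (rule weight_vectorE)
  have md: "\<mu> \<in> dual h" using m by (simp add: weights_def)
  obtain k w N where "sl2_string \<alpha> x y \<mu> k N w" by (rule sl2_highest_weight[OF tr md v])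
  from sl2_stringD(2)[OF this]
  have "\<mu> (br x y) = of_int (int N - 2 * int k)" by (simp add: algebra_simps)
  with that show ?thesis by blast
qed

text \<open>
  The reflected weight lies \<open>n + k\<close> steps below the top of the string, and the string has length
  \<open>n + 2 k + 1\<close>.
\<close>

lemma sl2_reflection_nonneg:
  assumes tr: "sl2_triple \<alpha> x y" and m: "\<mu> \<in> weights" and n: "\<mu> (br x y) = of_nat n"
  shows "(\<lambda>s. \<mu> s - \<mu> (br x y) * \<alpha> s) \<in> weights"
proof -
  obtain v where v: "v \<in> g \<mu>" "v \<noteq> 0" using m by (rule weight_vectorE)
  have md: "\<mu> \<in> dual h" using m by (simp add: weights_def)
  note t = sl2_tripleD[OF tr]
  obtain k w N where "sl2_string \<alpha> x y \<mu> k N w" by (rule sl2_highest_weight[OF tr md v])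
  note w = sl2_stringD[OF this]
  have "of_nat (n + 2 * k) = (of_nat N :: complex)" using w(2) n by simp
  then have "n + 2 * k = N" by (simp only: of_nat_eq_iff)
  then have "(br y ^^ (n + k)) w \<noteq> 0" by (intro w(3)) simp
  moreover have "(br y ^^ (n + k)) w \<in> g (\<lambda>s. \<mu> s - \<mu> (br x y) * \<alpha> s)"
    using ad_power_root_space_neg[OF t(3) w(1), of "n + k"] by (simp add: n algebra_simps)
  ultimately show ?thesis using dual_diff_scale[OF md t(6)] weightsI by blast
qed

lemma sl2_reflection:
  assumes tr: "sl2_triple \<alpha> x y" and m: "\<mu> \<in> weights"
  shows "(\<lambda>s. \<mu> s - \<mu> (br x y) * \<alpha> s) \<in> weights"
proof -
  obtain n :: int where n: "\<mu> (br x y) = of_int n" by (rule sl2_weight_integral[OF tr m])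
  show ?thesis
  proof (cases "n \<ge> 0")
    case True
    then have "\<mu> (br x y) = of_nat (nat n)" using n by simp
    from sl2_reflection_nonneg[OF tr m this] show ?thesis .
  next
    case False
    note t = sl2_tripleD[OF tr]
    have "\<mu> \<in> dual h" using m by (simp add: weights_def)
    then have e: "\<mu> (br y x) = - \<mu> (br x y)"
      using br_swap[of y x] dual_at_uminus[OF _ t(5)] by simp
    then have "\<mu> (br y x) = of_nat (nat (- n))" using n False by simp
    from sl2_reflection_nonneg[OF sl2_triple_opposite[OF tr] m this] e show ?thesis by simp
  qed
qed

text \<open>
  A string that starts at a weight \<open>k' \<alpha>\<close> with \<open>k' \<ge> 2\<close> passes through \<open>g\<^sub>\<alpha>\<close>, where it meets a
  multiple of \<open>x\<close>. But \<open>x\<close> commutes with itself, whereas raising inside the string is injective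
  below the top.
\<close>

lemma sl2_no_multiple:
  assumes tr: "sl2_triple \<alpha> x y" and k: "k \<ge> 2"
  shows "(\<lambda>s. of_nat k * \<alpha> s) \<notin> weights"
proof
  assume m: "(\<lambda>s. of_nat k * \<alpha> s) \<in> weights"
  obtain v where v: "v \<in> g (\<lambda>s. of_nat k * \<alpha> s)" "v \<noteq> 0" using m by (rule weight_vectorE)
  note t = sl2_tripleD[OF tr]
  obtain i w N where "sl2_string \<alpha> x y (\<lambda>s. of_nat k * \<alpha> s) i N w"
    by (rule sl2_highest_weight[OF tr dual_scale[OF t(6)] v])
  note w = sl2_stringD[OF this]
  have "of_nat (2 * (k + i)) = (of_nat N :: complex)" using w(2) by (simp add: t(4) algebra_simps)
  then have N: "N = 2 * (k + i)" by (simp only: of_nat_eq_iff)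
  obtain j where j: "k + i = Suc (Suc j)" using k by (metis Suc_le_D add_Suc numeral_2_eq_2 add_leD2 Suc_le_mono)
  have e: "of_nat k + of_nat i = (2 + of_nat j :: complex)"
    using arg_cong[OF j, of "of_nat :: nat \<Rightarrow> complex"] by simp
  \<comment> \<open>the string starts at \<open>(k + i) \<alpha>\<close>, so it reaches \<open>\<alpha>\<close> after \<open>k + i - 1 = Suc j\<close> steps\<close>
  have "(br y ^^ Suc j) w \<in> g (\<lambda>s. (of_nat k * \<alpha> s + of_nat i * \<alpha> s) - of_nat (Suc j) * \<alpha> s)"
    by (rule ad_power_root_space_neg[OF t(3) w(1)])
  also have "(\<lambda>s. (of_nat k * \<alpha> s + of_nat i * \<alpha> s) - of_nat (Suc j) * \<alpha> s) = \<alpha>"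
    using e by (simp add: distrib_right[symmetric] left_diff_distrib[symmetric])
  finally obtain c where "(br y ^^ Suc j) w = scale c x" using sl2_one_dim[OF tr] by blast
  then have "br x ((br y ^^ Suc j) w) = 0" by (simp add: br_scale_right br_self)
  then have "scale (of_nat (Suc j) * (of_nat N - of_nat j)) ((br y ^^ j) w) = 0"
    using w(4) by simp
  moreover have "(br y ^^ j) w \<noteq> 0" by (rule w(3)) (use N j in simp)
  moreover have "of_nat (Suc j) \<noteq> (0::complex)" by (simp only: of_nat_eq_0_iff)
  moreover have "of_nat N - of_nat j \<noteq> (0::complex)"
    using N j by (simp only: right_minus_eq of_nat_eq_iff) simp
  ultimately show False by simp
qed

end

section \<open>Every root has an sl2-triple\<close>

context cartan_pair
begin

definition degenerate_roots :: "('a \<Rightarrow> complex) set" where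
  "degenerate_roots = {\<alpha> \<in> roots h. \<forall>x\<in>g \<alpha>. \<forall>y\<in>g (\<lambda>s. - \<alpha> s). br x y = 0}"

lemma sl2_triple_scaling:
  assumes "\<alpha> \<in> roots h" "x \<in> g \<alpha>" "y \<in> g (\<lambda>s. - \<alpha> s)" "\<alpha> (br x y) \<noteq> 0"
  shows "sl2_triple \<alpha> x (scale (2 / \<alpha> (br x y)) y)"
  using assms dual_at_scale[OF root_in_dual[OF assms(1)] bracket_opposite_in_h[OF assms(2,3)]]
  by (auto simp: sl2_triple_def br_scale_right intro!: subspace_scale[OF subspace_root_space])

lemma sl2_triple_or_degenerate:
  assumes "\<alpha> \<in> roots h" "\<alpha> \<notin> degenerate_roots" obtains x y where "sl2_triple \<alpha> x y"
proof -
  obtain x y where xy: "x \<in> g \<alpha>" "y \<in> g (\<lambda>s. - \<alpha> s)" "br x y \<noteq> 0"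
    using assms by (auto simp: degenerate_roots_def)
  then have "\<alpha> (br x y) \<noteq> 0"
    using opposite_bracket_nondegenerate[OF assms(1) xy(1,2)] by blast
  from that[OF sl2_triple_scaling[OF assms(1) xy(1,2) this]] show ?thesis .
qed

lemma degenerate_not_triple: "sl2_triple \<alpha> x y \<Longrightarrow> \<alpha> \<notin> degenerate_roots"
proof
  assume t: "sl2_triple \<alpha> x y" and "\<alpha> \<in> degenerate_roots"
  then have "br x y = 0" using sl2_tripleD(2,3)[OF t] by (auto simp: degenerate_roots_def)
  then show False using sl2_tripleD(4)[OF t] dual_at_zero[OF sl2_tripleD(6)[OF t]] by simp
qed

lemma sl2_no_int_multiple:
  assumes tr: "sl2_triple \<alpha> x y" and c: "abs c \<ge> (2::int)"
  shows "(\<lambda>s. of_int c * \<alpha> s) \<notin> weights"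
proof (cases "c \<ge> 0")
  case True
  with c have "nat c \<ge> 2" "of_int c = (of_nat (nat c) :: complex)" by auto
  with sl2_no_multiple[OF tr] show ?thesis by metis
next
  case False
  then have "(\<lambda>s. of_int c * \<alpha> s) = (\<lambda>s. of_nat (nat (- c)) * - \<alpha> s)" by simp
  moreover have "nat (- c) \<ge> 2" using c False by simp
  ultimately show ?thesis using sl2_no_multiple[OF sl2_triple_opposite[OF tr]] by metis
qed

lemma odd_dvd_4: "odd (p::int) \<Longrightarrow> p * q = 4 \<Longrightarrow> p = 1 \<or> p = - 1"
proof -
  assume a: "odd p" "p * q = 4"
  have "p dvd 4" using a(2) by (metis dvd_triv_left)
  then have "\<bar>p\<bar> \<le> 4" using dvd_imp_le_int[of 4 p] by simp
  then have "p = - 3 \<or> p = - 1 \<or> p = 1 \<or> p = 3" using a(1) by presburger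
  then show ?thesis using a(2) by presburger
qed

lemma degenerate_not_multiple:
  assumes bad: "\<alpha> \<in> degenerate_roots" and c: "\<alpha> = (\<lambda>s. of_int c * \<gamma> s)" and tr: "sl2_triple \<gamma> x y"
  shows False
proof -
  have aw: "\<alpha> \<in> weights" "\<alpha> \<noteq> (\<lambda>_. 0)"
    using bad root_weight root_nonzero by (auto simp: degenerate_roots_def)
  consider "abs c \<ge> 2" | "c = 1" | "c = - 1" | "c = 0" by linarith
  then show False
  proof cases
    case 1 then show False using sl2_no_int_multiple[OF tr] aw c by blast
  next
    case 2 then show False using degenerate_not_triple[OF tr] bad c by simp
  next
    case 3 then show False using degenerate_not_triple[OF sl2_triple_opposite[OF tr]] bad c by simp
  next
    case 4 then show False using aw c by simp
  qed
qed

text \<open>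
  Suppose that \<open>\<alpha>\<close> is degenerate and \<open>\<gamma> = \<alpha> + \<beta>\<close> has an \<open>sl\<^sub>2\<close>-triple with \<open>g\<^sub>\<gamma> = [g\<^sub>\<beta>, g\<^sub>\<alpha>]\<close>. The Jacobi
  identity moves the coroot of \<open>\<gamma>\<close> into \<open>[g\<^sub>\<beta>, g\<^sub>-\<^sub>\<beta>]\<close>, so \<open>\<beta>\<close> has an \<open>sl\<^sub>2\<close>-triple with proportional
  coroot. The product of the two reflections is then a translation in the direction of
  \<open>\<delta> = 2 (\<gamma> - 2 / p \<beta>)\<close>, where \<open>p\<close> is the value of \<open>\<beta>\<close> on the coroot of \<open>\<gamma>\<close>. There are only finitely
  many weights, so \<open>\<delta> = 0\<close>, and \<open>\<alpha>\<close>, \<open>\<beta>\<close>, \<open>\<gamma>\<close> are proportional. For even \<open>p\<close> this makes \<open>\<alpha>\<close> an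
  integer multiple of \<open>\<gamma>\<close>, for odd \<open>p\<close> integrality forces \<open>\<gamma> = \<plusminus> 2 \<beta>\<close>; neither is possible.
\<close>

lemma degenerate_sum_no_triple:
  assumes bad: "\<alpha> \<in> degenerate_roots" and a: "a \<in> g \<alpha>" and b: "\<beta> \<in> dual h" "b \<in> g \<beta>" "br b a \<noteq> 0"
    and tr: "sl2_triple (\<lambda>s. \<beta> s + \<alpha> s) x y"
  shows False
proof -
  define \<gamma> where "\<gamma> = (\<lambda>s. \<beta> s + \<alpha> s)"
  have tr: "sl2_triple \<gamma> x y" using tr by (simp add: \<gamma>_def)
  note t = sl2_tripleD[OF tr]
  define z where "z = br x y"
  have z: "z \<in> h" "\<gamma> z = 2" using t by (simp_all add: z_def)
  have ad: "\<alpha> \<in> dual h" using bad root_in_dual by (simp add: degenerate_roots_def)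
  have "br b a \<in> g \<gamma>" using br_root_space[OF b(2) a] by (simp add: \<gamma>_def)
  then obtain c where c: "br b a = scale c x" using sl2_one_dim[OF tr] by blast
  with b(3) have c0: "c \<noteq> 0" by auto
  have "br b y \<in> g (\<lambda>s. - \<alpha> s)" using br_root_space[OF b(2) t(3)] by (simp add: \<gamma>_def)
  then have "br a (br b y) = 0" using bad a by (simp add: degenerate_roots_def)
  then have by': "br b (br a y) = scale c z"
    using br_derivation[of b a y] c by (simp add: br_scale_left z_def)
  have ay: "br a y \<in> g (\<lambda>s. - \<beta> s)" using br_root_space[OF a t(3)] by (simp add: \<gamma>_def)
  have z0: "z \<noteq> 0" using z(2) dual_at_zero[OF t(6)] by auto
  have \<beta>0: "\<beta> \<noteq> (\<lambda>_. 0)"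
  proof
    assume "\<beta> = (\<lambda>_. 0)"
    then have "\<gamma> = \<alpha>" by (simp add: \<gamma>_def)
    with bad degenerate_not_triple[OF tr] show False by simp
  qed
  have br: "\<beta> \<in> roots h" using rootsI[OF b(1) \<beta>0 b(2)] b(3) br_zero(1)[of a] by blast
  have "\<beta> (br b (br a y)) \<noteq> 0"
    using opposite_bracket_nondegenerate[OF br b(2) ay] by' c0 z0 by auto
  then have \<beta>z: "\<beta> z \<noteq> 0" and tb: "sl2_triple \<beta> b (scale (2 / (c * \<beta> z)) (br a y))"
    using sl2_triple_scaling[OF br b(2) ay] by' dual_at_scale[OF b(1) z(1)] by auto
  obtain p :: int where p: "\<beta> z = of_int p"
    using sl2_weight_integral[OF tr root_weight[OF br]] z_def by metis
  with \<beta>z have p0: "p \<noteq> 0" by auto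
  have zb: "br b (scale (2 / (c * \<beta> z)) (br a y)) = scale (2 / of_int p) z"
    using by' c0 p by (simp add: br_scale_right)
  define \<delta> where "\<delta> = (\<lambda>s. 2 * (\<gamma> s - 2 / of_int p * \<beta> s))"
  \<comment> \<open>first reflect in \<open>\<beta>\<close>, whose coroot is \<open>2 / p z\<close>, then in \<open>\<gamma>\<close>\<close>
  have translate: "(\<lambda>s. \<mu> s + \<delta> s) \<in> weights" if m: "\<mu> \<in> weights" "\<mu> z = 2" for \<mu>
  proof -
    have md: "\<mu> \<in> dual h" using m by (simp add: weights_def)
    let ?m = "\<lambda>s. \<mu> s - 2 / of_int p * \<mu> z * \<beta> s"
    have m': "?m \<in> weights"
      using sl2_reflection[OF tb m(1)] zb dual_at_scale[OF md z(1)] by simp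
    have "?m z = - 2" using m(2) p p0 by simp
    then have "(\<lambda>s. ?m s - (- 2) * \<gamma> s) \<in> weights"
      using sl2_reflection[OF tr m'] z_def by simp
    also have "(\<lambda>s. ?m s - (- 2) * \<gamma> s) = (\<lambda>s. \<mu> s + \<delta> s)"
      by (simp add: \<delta>_def m(2) algebra_simps)
    finally show ?thesis .
  qed
  have \<delta>z: "\<delta> z = 0" using z(2) p p0 by (simp add: \<delta>_def)
  have "(\<lambda>s. \<gamma> s + of_nat k * \<delta> s) \<in> weights" for k
  proof (induction k)
    case 0 show ?case using root_weight[OF t(1)] by simp
  next
    case (Suc k)
    from translate[OF this] show ?case using z(2) \<delta>z by (simp add: algebra_simps)
  qed
  then have "\<delta> = (\<lambda>_. 0)" using no_infinite_translates by blast
  then have "\<gamma> s - 2 / of_int p * \<beta> s = 0" for s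
    using fun_cong[of \<delta> _ s] unfolding \<delta>_def by (metis mult_eq_0_iff zero_neq_numeral)
  then have p\<gamma>: "of_int p * \<gamma> s = 2 * \<beta> s" for s using p0 by (simp add: field_simps)
  show False
  proof (cases "even p")
    case True
    then obtain q where "p = 2 * q" by blast
    then have "\<beta> s = of_int q * \<gamma> s" for s using p\<gamma>[of s] by simp
    then have "\<alpha> = (\<lambda>s. of_int (1 - q) * \<gamma> s)" by (simp add: \<gamma>_def fun_eq_iff algebra_simps)
    then show False by (rule degenerate_not_multiple[OF bad _ tr])
  next
    case False
    obtain q :: int where "\<gamma> (scale (2 / of_int p) z) = of_int q"
      using sl2_weight_integral[OF tb root_weight[OF t(1)]] zb by metis
    then have "of_int (p * q) = (of_int 4 :: complex)"
      using dual_at_scale[OF t(6) z(1)] z(2) p0 by (simp add: field_simps)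
    then have "p * q = 4" by (simp only: of_int_eq_iff)
    with False have "p = 1 \<or> p = - 1" by (rule odd_dvd_4)
    then have "\<gamma> = (\<lambda>s. of_int (2 * p) * \<beta> s)" using p\<gamma>
      by (auto simp: fun_eq_iff) (metis minus_minus)
    moreover have "abs (2 * p) \<ge> 2" using p0 by linarith
    ultimately show False using sl2_no_int_multiple[OF tb] root_weight[OF t(1)] by metis
  qed
qed

lemma degenerate_span_ideal: "ideal_of (span (\<Union>\<alpha>\<in>degenerate_roots. g \<alpha>)) UNIV"
proof -
  let ?n = "span (\<Union>\<alpha>\<in>degenerate_roots. g \<alpha>)"
  have root_vectors: "br b a \<in> ?n" if a: "\<alpha> \<in> degenerate_roots" "a \<in> g \<alpha>" and b: "\<beta> \<in> dual h" "b \<in> g \<beta>"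
    for a b \<alpha> \<beta>
  proof (cases "br b a = 0")
    case False
    let ?\<gamma> = "\<lambda>s. \<beta> s + \<alpha> s"
    have ad: "\<alpha> \<in> dual h" using a root_in_dual by (simp add: degenerate_roots_def)
    have ba: "br b a \<in> g ?\<gamma>" by (rule br_root_space[OF b(2) a(2)])
    have "?\<gamma> \<noteq> (\<lambda>_. 0)"
    proof
      assume "?\<gamma> = (\<lambda>_. 0)"
      then have "\<beta> = (\<lambda>s. - \<alpha> s)" by (auto simp: fun_eq_iff eq_neg_iff_add_eq_0)
      with a b have "br a b = 0" by (auto simp: degenerate_roots_def)
      with False br_swap[of b a] show False by simp
    qed
    then have "?\<gamma> \<in> roots h" using rootsI[OF dual_add[OF b(1) ad] _ ba] False by blast
    moreover have "?\<gamma> \<in> degenerate_roots" if "?\<gamma> \<in> roots h"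
      using sl2_triple_or_degenerate[OF that] degenerate_sum_no_triple[OF a b False] by blast
    ultimately show ?thesis using ba by (blast intro: span_base)
  qed (simp add: span_zero)
  have "br v a \<in> ?n" if a: "a \<in> ?n" for v a
    using a
  proof (induction rule: span_induct_alt)
    case base show ?case by (simp add: span_zero)
  next
    case (step c a y)
    then obtain \<alpha> where al: "\<alpha> \<in> degenerate_roots" "a \<in> g \<alpha>" by blast
    have "v \<in> span (\<Union>\<alpha>\<in>dual h. g \<alpha>)" using weight_decomposition by simp
    then have "br v a \<in> ?n"
    proof (induction rule: span_induct_alt)
      case base show ?case by (simp add: span_zero)
    next
      case (step d b w)
      then obtain \<beta> where "\<beta> \<in> dual h" "b \<in> g \<beta>" by blast
      from root_vectors[OF al this] step(2) show ?case
        by (simp add: br_add_left br_scale_left span_add span_scale)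
    qed
    with step(2) show ?case by (simp add: br_add_right br_scale_right span_add span_scale)
  qed
  then show ?thesis by (simp add: ideal_of_def)
qed

text \<open>
  The ideal spanned by the degenerate root spaces is zero or everything. In the second case it
  contains \<open>h\<close>, which meets sums of root spaces in zero only, so \<open>h = 0\<close> and there are no roots at
  all.
\<close>

lemma no_degenerate_roots: "degenerate_roots = {}"
proof -
  let ?n = "span (\<Union>\<alpha>\<in>degenerate_roots. g \<alpha>)"
  have sub: "degenerate_roots \<subseteq> dual h" using root_in_dual by (auto simp: degenerate_roots_def)
  consider "?n = {0}" | "?n = UNIV" using no_ideals[OF degenerate_span_ideal] by blast
  then show ?thesis
  proof cases
    case 1
    have "\<alpha> \<notin> degenerate_roots" for \<alpha>
    proof
      assume al: "\<alpha> \<in> degenerate_roots"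
      then obtain v where "v \<in> g \<alpha>" "v \<noteq> 0"
        using weight_vectorE[of \<alpha>] root_weight by (auto simp: degenerate_roots_def)
      with al 1 show False using span_base[of v "\<Union>\<alpha>\<in>degenerate_roots. g \<alpha>"] by auto
    qed
    then show ?thesis by blast
  next
    case 2
    have "t = 0" if "t \<in> h" for t
    proof (rule ccontr)
      assume "t \<noteq> 0"
      then have "(\<lambda>_. 0) \<in> degenerate_roots"
        using root_vector_in_span[OF sub, of "\<lambda>_. 0" t] that 2 g_zero by simp
      then show False using root_nonzero by (auto simp: degenerate_roots_def)
    qed
    then have "\<alpha> = (\<lambda>_. 0)" if "\<alpha> \<in> dual h" for \<alpha>
      using that dual_eq_iff[OF that, of "\<lambda>_. 0"] dual_at_zero by auto
    then show ?thesis using root_in_dual root_nonzero unfolding degenerate_roots_def by blast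
  qed
qed

lemma root_sl2_triple: assumes "\<alpha> \<in> roots h" obtains x y where "sl2_triple \<alpha> x y"
  using sl2_triple_or_degenerate[OF assms] no_degenerate_roots by blast

text \<open>
  One-dimensionality of \<open>g\<^sub>\<alpha>\<close> and \<open>g\<^sub>-\<^sub>\<alpha>\<close> makes the normalized bracket unique.
\<close>

lemma coroot_sl2_triple:
  assumes tr: "sl2_triple \<alpha> x y" shows "coroot h \<alpha> = br x y"
  unfolding coroot_def
proof (rule the_equality)
  note t = sl2_tripleD[OF tr]
  show "(\<exists>u\<in>g \<alpha>. \<exists>v\<in>g (\<lambda>s. - \<alpha> s). br x y = br u v) \<and> \<alpha> (br x y) = 2" using t by blast
  fix w assume w: "(\<exists>u\<in>g \<alpha>. \<exists>v\<in>g (\<lambda>s. - \<alpha> s). w = br u v) \<and> \<alpha> w = 2"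
  then obtain u v where uv: "u \<in> g \<alpha>" "v \<in> g (\<lambda>s. - \<alpha> s)" "w = br u v" by blast
  obtain c d where "u = scale c x" "v = scale d y"
    using sl2_one_dim[OF tr uv(1)] sl2_opposite_one_dim[OF tr uv(2)] by blast
  then have e: "w = scale (c * d) (br x y)" using uv(3) by (simp add: br_scale_left br_scale_right)
  then have "c * d = 1" using w dual_at_scale[OF t(6,5)] t(4) by simp
  with e show "w = br x y" by simp
qed

lemma root_opposite: "\<alpha> \<in> roots h \<Longrightarrow> (\<lambda>s. - \<alpha> s) \<in> roots h"
  using root_sl2_triple sl2_triple_opposite sl2_tripleD(1) by metis

lemma root_at_coroot: "\<alpha> \<in> roots h \<Longrightarrow> \<alpha> (coroot h \<alpha>) = 2"
  using root_sl2_triple coroot_sl2_triple sl2_tripleD(4) by metis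

lemma root_no_int_multiple:
  assumes "\<alpha> \<in> roots h" "(\<lambda>s. of_int c * \<alpha> s) \<in> roots h" shows "c = 1 \<or> c = - 1"
proof -
  obtain x y where "sl2_triple \<alpha> x y" using assms(1) by (rule root_sl2_triple)
  then have "\<not> abs c \<ge> 2" using sl2_no_int_multiple root_weight[OF assms(2)] by blast
  moreover have "c \<noteq> 0" using root_nonzero[OF assms(2)] by auto
  ultimately show ?thesis by linarith
qed

lemma root_reflection:
  assumes a: "\<alpha> \<in> roots h" and b: "\<beta> \<in> roots h"
  shows "(\<lambda>s. \<beta> s - \<beta> (coroot h \<alpha>) * \<alpha> s) \<in> roots h"
proof -
  obtain x y where tr: "sl2_triple \<alpha> x y" using a by (rule root_sl2_triple)
  have "(\<lambda>s. \<beta> s - \<beta> (coroot h \<alpha>) * \<alpha> s) \<in> weights"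
    using sl2_reflection[OF tr root_weight[OF b]] coroot_sl2_triple[OF tr] by simp
  moreover have "(\<lambda>s. \<beta> s - \<beta> (coroot h \<alpha>) * \<alpha> s) \<noteq> (\<lambda>_. 0)"
  proof
    assume e: "(\<lambda>s. \<beta> s - \<beta> (coroot h \<alpha>) * \<alpha> s) = (\<lambda>_. 0)"
    from fun_cong[OF e, of "coroot h \<alpha>"] have "\<beta> (coroot h \<alpha>) = 0"
      using root_at_coroot[OF a] by simp
    with e root_nonzero[OF b] show False by simp
  qed
  ultimately show ?thesis by (simp add: roots_weights)
qed

lemma root_space_one_dim:
  assumes "\<alpha> \<in> roots h" "u \<in> g \<alpha>" "v \<in> g \<alpha>" "v \<noteq> 0"
  shows "\<exists>c. u = scale c v"
proof -
  obtain x y where tr: "sl2_triple \<alpha> x y" using assms(1) by (rule root_sl2_triple)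
  obtain c d where "u = scale c x" "v = scale d x"
    using sl2_one_dim[OF tr] assms(2,3) by blast
  moreover from this assms(4) have "d \<noteq> 0" by auto
  ultimately show ?thesis by (intro exI[of _ "c / d"]) simp
qed

text \<open>
  If \<open>[u, v] = 0\<close>, then \<open>v\<close> is the top of its string. A string that starts at or above \<open>\<alpha> + \<beta>\<close> also
  passes through \<open>g\<^sub>\<beta>\<close>, which is spanned by \<open>v\<close>, and raising its member there gives a nonzero
  vector.
\<close>

lemma root_bracket_nonzero:
  assumes a: "\<alpha> \<in> roots h" and b: "\<beta> \<in> roots h" and ab: "(\<lambda>s. \<alpha> s + \<beta> s) \<in> roots h"
    and u: "u \<in> g \<alpha>" "u \<noteq> 0" and v: "v \<in> g \<beta>" "v \<noteq> 0"
  shows "br u v \<noteq> 0"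
proof
  assume uv: "br u v = 0"
  obtain x y where tr: "sl2_triple \<alpha> x y" using a by (rule root_sl2_triple)
  note t = sl2_tripleD[OF tr]
  obtain c where "x = scale c u" using root_space_one_dim[OF a t(2) u] by blast
  with uv have xv: "br x v = 0" by (simp add: br_scale_left)
  obtain n where n: "2 * \<beta> (br x y) = of_nat n * \<alpha> (br x y)"
    using highest_weight[OF t(1-3) root_in_dual[OF b] v xv] by blast
  obtain w' where w': "w' \<in> g (\<lambda>s. \<alpha> s + \<beta> s)" "w' \<noteq> 0"
    using weight_vectorE[OF root_weight[OF ab]] by blast
  obtain k w N where "sl2_string \<alpha> x y (\<lambda>s. \<alpha> s + \<beta> s) k N w"
    by (rule sl2_highest_weight[OF tr root_in_dual[OF ab] w'])
  note w = sl2_stringD[OF this]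
  have "of_nat (n + 2 * k + 2) = (of_nat N :: complex)" using w(2) n by (simp add: t(4) add.assoc)
  then have N: "n + 2 * k + 2 = N" by (simp only: of_nat_eq_iff)
  \<comment> \<open>\<open>k + 1\<close> steps below \<open>\<alpha> + \<beta> + k \<alpha>\<close> lies \<open>\<beta>\<close>\<close>
  have "(br y ^^ Suc k) w \<in> g (\<lambda>s. ((\<alpha> s + \<beta> s) + of_nat k * \<alpha> s) - of_nat (Suc k) * \<alpha> s)"
    by (rule ad_power_root_space_neg[OF t(3) w(1)])
  then have "(br y ^^ Suc k) w \<in> g \<beta>" by (simp add: algebra_simps)
  then obtain d where "(br y ^^ Suc k) w = scale d v" using root_space_one_dim[OF b _ v] by blast
  then have "br x ((br y ^^ Suc k) w) = 0" by (simp add: br_scale_right xv)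
  then have "scale (of_nat (Suc k) * (of_nat N - of_nat k)) ((br y ^^ k) w) = 0"
    using w(4) by simp
  moreover have "(br y ^^ k) w \<noteq> 0" by (rule w(3)) (use N in simp)
  moreover have "of_nat (Suc k) \<noteq> (0::complex)" by (simp only: of_nat_eq_0_iff)
  moreover have "of_nat N - of_nat k \<noteq> (0::complex)"
    using N by (simp only: right_minus_eq of_nat_eq_iff)
  ultimately show False by simp
qed

end

section \<open>Positive systems in coordinates\<close>

definition support_in :: "nat \<Rightarrow> (nat \<Rightarrow> int) set" where
  "support_in l = {c. \<forall>i. i \<notin> {1..l} \<longrightarrow> c i = 0}"

definition unit_coeff :: "nat \<Rightarrow> nat \<Rightarrow> int" where
  "unit_coeff m = (\<lambda>i. if i = m then 1 else 0)"

definition pairing :: "nat \<Rightarrow> (nat \<Rightarrow> nat \<Rightarrow> int) \<Rightarrow> (nat \<Rightarrow> int) \<Rightarrow> nat \<Rightarrow> int" where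
  "pairing l A c m = (\<Sum>i=1..l. c i * A i m)"

definition reflect :: "nat \<Rightarrow> (nat \<Rightarrow> nat \<Rightarrow> int) \<Rightarrow> nat \<Rightarrow> (nat \<Rightarrow> int) \<Rightarrow> nat \<Rightarrow> int" where
  "reflect l A m c = c(m := c m - pairing l A c m)"

text \<open>
  The properties that characterize the coordinate vectors of the positive roots: a reflection in
  a simple root \<open>\<alpha>\<^sub>m\<close> permutes the positive roots other than \<open>\<alpha>\<^sub>m\<close>.
\<close>

definition positive_system :: "nat \<Rightarrow> (nat \<Rightarrow> nat \<Rightarrow> int) \<Rightarrow> (nat \<Rightarrow> int) set \<Rightarrow> bool" where
  "positive_system l A Q \<longleftrightarrow> Q \<subseteq> support_in l \<and> (\<forall>c\<in>Q. (\<forall>i. c i \<ge> 0) \<and> c \<noteq> (\<lambda>_. 0)) \<and>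
     (\<forall>m\<in>{1..l}. unit_coeff m \<in> Q) \<and>
     (\<forall>m\<in>{1..l}. \<forall>c\<in>Q. c \<noteq> unit_coeff m \<longrightarrow> reflect l A m c \<in> Q)"

lemma pairing_update:
  assumes "m \<in> {1..l}"
  shows "pairing l A (c(m := c m + d)) j = pairing l A c j + d * A m j"
proof -
  have "pairing l A (c(m := c m + d)) j = (\<Sum>i=1..l. c i * A i j + (if i = m then d * A m j else 0))"
    unfolding pairing_def by (rule sum.cong) (auto simp: algebra_simps)
  then show ?thesis using assms by (simp add: pairing_def sum.distrib)
qed

lemma reflect_reflect:
  assumes "m \<in> {1..l}" "A m m = 2" shows "reflect l A m (reflect l A m c) = c"
  using pairing_update[OF assms(1), of A c "- pairing l A c m" m] assms(2)
  by (simp add: reflect_def fun_eq_iff)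

lemma pairing_unit: "m \<in> {1..l} \<Longrightarrow> pairing l A (unit_coeff m) j = A m j"
  by (simp add: pairing_def unit_coeff_def if_distrib[where f = "\<lambda>x. x * _"] cong: if_cong)

text \<open>
  Pairing \<open>c\<close> with \<open>w\<close> shows that some simple coroot is positive on \<open>c\<close>. The corresponding
  reflection lowers the height and stays in \<open>P\<close>, so it leads to an element of \<open>Q\<close> by induction, and
  reflecting back stays in \<open>Q\<close>. Applied in both directions, the lemma says that a Cartan matrix
  with such a vector \<open>w\<close> determines its positive system.
\<close>

lemma positive_system_subset:
  assumes P: "positive_system l A P" and Q: "positive_system l A Q"
    and diag: "\<And>m. m \<in> {1..l} \<Longrightarrow> A m m = 2"
    and w: "\<And>j. j \<in> {1..l} \<Longrightarrow> w j \<ge> (0::int)"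
      "\<And>i. i \<in> {1..l} \<Longrightarrow> (\<Sum>j=1..l. A i j * w j) > 0"
  shows "P \<subseteq> Q"
proof
  fix c assume "c \<in> P"
  then show "c \<in> Q"
  proof (induction "nat (\<Sum>i=1..l. c i)" arbitrary: c rule: less_induct)
    case less
    have c: "c \<in> support_in l" "\<And>i. c i \<ge> 0" "c \<noteq> (\<lambda>_. 0)"
      using less.prems P unfolding positive_system_def by blast+
    have "\<exists>m\<in>{1..l}. pairing l A c m > 0"
    proof (rule ccontr)
      assume n: "\<not> ?thesis"
      have "(\<Sum>i=1..l. c i * (\<Sum>j=1..l. A i j * w j)) = (\<Sum>j=1..l. \<Sum>i=1..l. c i * (A i j * w j))"
        unfolding sum_distrib_left by (rule sum.swap)
      also have "\<dots> = (\<Sum>j=1..l. pairing l A c j * w j)"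
        unfolding pairing_def sum_distrib_right by (simp add: mult.assoc)
      also have "\<dots> \<le> 0"
        using n w(1) by (intro sum_nonpos mult_nonpos_nonneg) (auto simp: not_less)
      finally have le: "(\<Sum>i=1..l. c i * (\<Sum>j=1..l. A i j * w j)) \<le> 0" .
      obtain i where i: "i \<in> {1..l}" "c i > 0"
        using c unfolding support_in_def by (metis (mono_tags, lifting) mem_Collect_eq ext order_le_less)
      have "(\<Sum>i=1..l. c i * (\<Sum>j=1..l. A i j * w j)) > 0"
        by (rule sum_pos2[OF _ i(1)]) (use i w(2) c(2) in \<open>auto simp: less_imp_le\<close>)
      with le show False by simp
    qed
    then obtain m where m: "m \<in> {1..l}" "pairing l A c m > 0" by blast
    show ?case
    proof (cases "c = unit_coeff m")
      case True
      then show ?thesis using Q m by (simp add: positive_system_def)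
    next
      case False
      let ?r = "reflect l A m c"
      have rP: "?r \<in> P" using P m(1) less.prems False by (simp add: positive_system_def)
      then have rpos: "\<And>i. ?r i \<ge> 0" using P by (auto simp: positive_system_def)
      have "(\<Sum>i=1..l. ?r i) = (\<Sum>i=1..l. c i + (if i = m then - pairing l A c m else 0))"
        by (rule sum.cong) (auto simp: reflect_def)
      also have "\<dots> = (\<Sum>i=1..l. c i) - pairing l A c m"
        using m(1) by (simp add: sum.distrib)
      finally have "nat (\<Sum>i=1..l. ?r i) < nat (\<Sum>i=1..l. c i)"
        using m(2) sum_nonneg[of "{1..l}" ?r] rpos by simp
      then have rQ: "?r \<in> Q" using rP by (rule less.hyps)
      have "?r \<noteq> unit_coeff m"
      proof
        assume e: "?r = unit_coeff m"
        then have "c m = unit_coeff m m - pairing l A (unit_coeff m) m"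
          using reflect_reflect[where A = A and m = m, OF m(1) diag[OF m(1)], of c] unfolding reflect_def
          by (metis fun_upd_same)
        then have "c m = - 1" using pairing_unit[OF m(1)] diag[OF m(1)]
          by (simp add: unit_coeff_def)
        with c(2)[of m] show False by simp
      qed
      then have "reflect l A m ?r \<in> Q" using Q m(1) rQ by (simp add: positive_system_def)
      then show ?thesis using reflect_reflect[where A = A and m = m, OF m(1) diag[OF m(1)]] by simp
    qed
  qed
qed

text \<open>
  Abelian ideals of \<open>p\<^sub>I\<close> in coordinates, where \<open>K\<close> consists of the indices of the simple roots in
  \<open>I\<close>. The summand \<open>d\<close> ranges over the positive roots and the negative roots of \<open>\<Delta>\<^sub>I\<close>, hence over all
  of \<open>\<Delta>\<^sub>I \<union> \<Delta>\<^sup>+\<close>.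
\<close>

definition coeff_ideals :: "(nat \<Rightarrow> int) set \<Rightarrow> nat set \<Rightarrow> (nat \<Rightarrow> int) set set" where
  "coeff_ideals Q K = {F. F \<subseteq> Q \<and> (\<forall>c\<in>F. \<exists>k. k \<notin> K \<and> c k \<noteq> 0) \<and>
     (\<forall>c\<in>F. \<forall>d. d \<in> Q \<or> (- d \<in> Q \<and> (\<forall>k. k \<notin> K \<longrightarrow> d k = 0)) \<longrightarrow> c + d \<in> Q \<longrightarrow> c + d \<in> F) \<and>
     (\<forall>c\<in>F. \<forall>d\<in>F. c + d \<notin> Q)}"

lemma coeff_idealsI:
  assumes "F \<subseteq> Q" "\<And>c. c \<in> F \<Longrightarrow> \<exists>k. k \<notin> K \<and> c k \<noteq> 0"
    "\<And>c d. c \<in> F \<Longrightarrow> d \<in> Q \<or> (- d \<in> Q \<and> (\<forall>k. k \<notin> K \<longrightarrow> d k = 0)) \<Longrightarrow> c + d \<in> Q \<Longrightarrow> c + d \<in> F"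
    "\<And>c d. c \<in> F \<Longrightarrow> d \<in> F \<Longrightarrow> c + d \<notin> Q"
  shows "F \<in> coeff_ideals Q K"
  using assms unfolding coeff_ideals_def mem_Collect_eq by (intro conjI ballI allI impI) blast+

lemma coeff_idealsD:
  assumes "F \<in> coeff_ideals Q K"
  shows "F \<subseteq> Q" "c \<in> F \<Longrightarrow> \<exists>k. k \<notin> K \<and> c k \<noteq> 0"
    "c \<in> F \<Longrightarrow> d \<in> Q \<or> (- d \<in> Q \<and> (\<forall>k. k \<notin> K \<longrightarrow> d k = 0)) \<Longrightarrow> c + d \<in> Q \<Longrightarrow> c + d \<in> F"
    "c \<in> F \<Longrightarrow> d \<in> F \<Longrightarrow> c + d \<notin> Q"
  using assms unfolding coeff_ideals_def mem_Collect_eq by blast+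

section \<open>Coordinates of roots\<close>

locale cartan_type = cartan_pair scale br h
  for scale :: "complex \<Rightarrow> 'a::ab_group_add \<Rightarrow> 'a" and br :: "'a \<Rightarrow> 'a \<Rightarrow> 'a" and h :: "'a set" +
  fixes \<Pi> :: "('a \<Rightarrow> complex) set" and l :: nat and A :: "nat \<Rightarrow> nat \<Rightarrow> int" and a :: "nat \<Rightarrow> 'a \<Rightarrow> complex"
  assumes simple: "simple_system h \<Pi>"
    and enum: "bij_betw a {1..l} \<Pi>"
    and entries: "\<And>i j. i \<in> {1..l} \<Longrightarrow> j \<in> {1..l} \<Longrightarrow> a i (coroot h (a j)) = of_int (A i j)"
begin

definition rt :: "(nat \<Rightarrow> int) \<Rightarrow> 'a \<Rightarrow> complex" where
  "rt c = (\<lambda>x. \<Sum>i=1..l. of_int (c i) * a i x)"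

lemma rt_add: "rt (c + d) = (\<lambda>s. rt c s + rt d s)"
  by (simp add: rt_def sum.distrib distrib_right)

lemma rt_uminus: "rt (- c) = (\<lambda>s. - rt c s)"
  by (simp add: rt_def sum_negf)

lemma a_in_\<Pi>: "i \<in> {1..l} \<Longrightarrow> a i \<in> \<Pi>"
  using enum bij_betwE by blast

lemma a_root: "i \<in> {1..l} \<Longrightarrow> a i \<in> roots h"
  using a_in_\<Pi> simple by (auto simp: simple_system_def)

lemma rt_unit: "i \<in> {1..l} \<Longrightarrow> rt (unit_coeff i) = a i"
  by (simp add: rt_def unit_coeff_def if_distrib[where f = of_int] if_distrib[where f = "\<lambda>x. x * _"]
      cong: if_cong)

lemma rt_zero_imp:
  assumes c: "c \<in> support_in l" and z: "rt c = (\<lambda>_. 0)" shows "c = (\<lambda>_. 0)"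
proof -
  let ?b = "inv_into {1..l} a"
  have b: "?b (a i) = i" if "i \<in> {1..l}" for i
    using enum that by (simp add: bij_betw_def)
  have "\<forall>\<alpha>\<in>\<Pi>. complex_of_int (c (?b \<alpha>)) = 0"
  proof -
    have "(\<Sum>\<alpha>\<in>\<Pi>. of_int (c (?b \<alpha>)) * \<alpha> x) = rt c x" for x
      unfolding rt_def sum.reindex_bij_betw[OF enum, symmetric]
      by (rule sum.cong) (use b in auto)
    then have "\<forall>x\<in>h. (\<Sum>\<alpha>\<in>\<Pi>. of_int (c (?b \<alpha>)) * \<alpha> x) = 0" using z by simp
    moreover have "(\<forall>x\<in>h. (\<Sum>\<alpha>\<in>\<Pi>. e \<alpha> * \<alpha> x) = 0) \<longrightarrow> (\<forall>\<alpha>\<in>\<Pi>. e \<alpha> = 0)" for e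
      using simple by (simp add: simple_system_def)
    ultimately show ?thesis by (elim mp[rotated])
  qed
  then have "c i = 0" if "i \<in> {1..l}" for i using a_in_\<Pi>[OF that] b[OF that] by fastforce
  then show ?thesis using c by (auto simp: support_in_def)
qed

lemma rt_inj: "inj_on rt (support_in l)"
proof (rule inj_onI)
  fix c d assume cd: "c \<in> support_in l" "d \<in> support_in l" "rt c = rt d"
  have "rt (c + - d) = (\<lambda>_. 0)" unfolding rt_add rt_uminus using cd by simp
  then have "c + - d = (\<lambda>_. 0)" using cd by (intro rt_zero_imp) (auto simp: support_in_def)
  then show "c = d" by (auto simp: fun_eq_iff)
qed

lemma int_comb_rt:
  assumes "J \<subseteq> \<Pi>"
  shows "int_comb k J = rt (\<lambda>i. if i \<in> {1..l} \<and> a i \<in> J then k (a i) else 0)"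
proof
  fix x
  have fin: "finite \<Pi>" using simple by (simp add: simple_system_def)
  have "int_comb k J x = (\<Sum>\<alpha>\<in>\<Pi>. if \<alpha> \<in> J then of_int (k \<alpha>) * \<alpha> x else 0)"
    unfolding int_comb_def using assms fin by (intro sum.mono_neutral_cong_left) auto
  also have "\<dots> = (\<Sum>i=1..l. if a i \<in> J then of_int (k (a i)) * a i x else 0)"
    by (rule sum.reindex_bij_betw[OF enum, symmetric])
  also have "\<dots> = rt (\<lambda>i. if i \<in> {1..l} \<and> a i \<in> J then k (a i) else 0) x"
    unfolding rt_def by (rule sum.cong) auto
  finally show "int_comb k J x = rt (\<lambda>i. if i \<in> {1..l} \<and> a i \<in> J then k (a i) else 0) x" .
qed

lemma rt_int_comb:
  assumes J: "J \<subseteq> \<Pi>" and c: "c \<in> support_in l" "\<And>i. i \<in> {1..l} \<Longrightarrow> a i \<notin> J \<Longrightarrow> c i = 0"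
  shows "rt c = int_comb (\<lambda>\<alpha>. c (inv_into {1..l} a \<alpha>)) J"
  unfolding int_comb_rt[OF J] 
proof (rule arg_cong[where f = rt], rule ext)
  fix i
  have "inv_into {1..l} a (a i) = i" if "i \<in> {1..l}"
    using enum that by (simp add: bij_betw_def)
  then show "c i = (if i \<in> {1..l} \<and> a i \<in> J then c (inv_into {1..l} a (a i)) else 0)"
    using c by (auto simp: support_in_def)
qed

lemma root_coeffs:
  assumes "\<beta> \<in> roots h"
  obtains c where "c \<in> support_in l" "\<beta> = rt c" "(\<forall>i. c i \<ge> 0) \<or> (\<forall>i. c i \<le> 0)"
proof -
  obtain k where k: "\<beta> = int_comb k \<Pi>" "(\<forall>\<alpha>\<in>\<Pi>. k \<alpha> \<ge> 0) \<or> (\<forall>\<alpha>\<in>\<Pi>. k \<alpha> \<le> 0)"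
    using assms simple unfolding simple_system_def by blast
  show ?thesis
    by (rule that[of "\<lambda>i. if i \<in> {1..l} \<and> a i \<in> \<Pi> then k (a i) else 0"])
      (use k int_comb_rt[OF order_refl, of k] in \<open>auto simp: support_in_def\<close>)
qed

definition pos_coeffs :: "(nat \<Rightarrow> int) set" where
  "pos_coeffs = {c \<in> support_in l. (\<forall>i. c i \<ge> 0) \<and> rt c \<in> roots h}"

lemma pos_roots_rt: "pos_roots h \<Pi> = rt ` pos_coeffs"
proof
  show "pos_roots h \<Pi> \<subseteq> rt ` pos_coeffs"
  proof
    fix \<beta> assume "\<beta> \<in> pos_roots h \<Pi>"
    then obtain k where k: "\<beta> \<in> roots h" "\<beta> = int_comb k \<Pi>" "\<forall>\<alpha>\<in>\<Pi>. k \<alpha> \<ge> 0"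
      by (auto simp: pos_roots_def)
    let ?c = "\<lambda>i. if i \<in> {1..l} \<and> a i \<in> \<Pi> then k (a i) else 0"
    have e: "\<beta> = rt ?c" using k(2) int_comb_rt[OF order_refl, of k] by simp
    then have "?c \<in> pos_coeffs" using k by (auto simp: pos_coeffs_def support_in_def)
    with e show "\<beta> \<in> rt ` pos_coeffs" by blast
  qed
  show "rt ` pos_coeffs \<subseteq> pos_roots h \<Pi>"
  proof
    fix \<beta> assume "\<beta> \<in> rt ` pos_coeffs"
    then obtain c where c: "c \<in> support_in l" "\<forall>i. c i \<ge> 0" "rt c \<in> roots h" "\<beta> = rt c"
      by (auto simp: pos_coeffs_def)
    have "rt c = int_comb (\<lambda>\<alpha>. c (inv_into {1..l} a \<alpha>)) \<Pi>"
      using c a_in_\<Pi> by (intro rt_int_comb) auto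
    with c show "\<beta> \<in> pos_roots h \<Pi>" unfolding pos_roots_def by blast
  qed
qed

lemma root_subsystem_rt:
  assumes J: "J \<subseteq> \<Pi>" and c: "c \<in> support_in l"
  shows "rt c \<in> root_subsystem h J \<longleftrightarrow> rt c \<in> roots h \<and> (\<forall>k. k \<notin> {i\<in>{1..l}. a i \<in> J} \<longrightarrow> c k = 0)"
proof
  assume "rt c \<in> root_subsystem h J"
  then obtain k where k: "rt c \<in> roots h" "rt c = int_comb k J" by (auto simp: root_subsystem_def)
  let ?d = "\<lambda>i. if i \<in> {1..l} \<and> a i \<in> J then k (a i) else 0"
  have "rt c = rt ?d" using k int_comb_rt[OF J] by simp
  moreover have "?d \<in> support_in l" by (auto simp: support_in_def)
  ultimately have "c = ?d" using rt_inj c by (auto dest: inj_onD)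
  with k(1) show "rt c \<in> roots h \<and> (\<forall>k. k \<notin> {i\<in>{1..l}. a i \<in> J} \<longrightarrow> c k = 0)" by auto
next
  assume r: "rt c \<in> roots h \<and> (\<forall>k. k \<notin> {i\<in>{1..l}. a i \<in> J} \<longrightarrow> c k = 0)"
  then have "rt c = int_comb (\<lambda>\<alpha>. c (inv_into {1..l} a \<alpha>)) J"
    using c by (intro rt_int_comb[OF J]) auto
  with r show "rt c \<in> root_subsystem h J" unfolding root_subsystem_def by blast
qed

lemma rt_pairing:
  assumes "m \<in> {1..l}" shows "rt c (coroot h (a m)) = of_int (pairing l A c m)"
  unfolding rt_def pairing_def of_int_sum
  by (rule sum.cong) (use entries assms in auto)

lemma rt_reflect:
  assumes m: "m \<in> {1..l}"
  shows "rt (reflect l A m c) = (\<lambda>s. rt c s - rt c (coroot h (a m)) * a m s)"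
proof
  fix s
  have "rt (reflect l A m c) s
    = (\<Sum>i=1..l. of_int (c i) * a i s - (if i = m then of_int (pairing l A c m) * a m s else 0))"
    unfolding rt_def by (rule sum.cong) (auto simp: reflect_def algebra_simps)
  then show "rt (reflect l A m c) s = rt c s - rt c (coroot h (a m)) * a m s"
    unfolding rt_pairing[OF m] using m by (simp add: sum_subtractf rt_def)
qed

lemma cartan_diag: "m \<in> {1..l} \<Longrightarrow> A m m = 2"
  using root_at_coroot[OF a_root] entries[of m m] by (metis of_int_eq_iff of_int_numeral)

text \<open>
  All coordinates of a root have the same sign, so a single positive one decides.
\<close>

lemma root_of_mixed_sign:
  assumes "c \<in> support_in l" "rt c \<in> roots h" "c j > 0" shows "c \<in> pos_coeffs"
proof -
  obtain d where d: "d \<in> support_in l" "rt c = rt d" "(\<forall>i. d i \<ge> 0) \<or> (\<forall>i. d i \<le> 0)"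
    by (rule root_coeffs[OF assms(2)])
  then have "c = d" using rt_inj assms(1) by (auto dest: inj_onD)
  with d(3) assms(3) have "\<forall>i. c i \<ge> 0" by (metis not_le)
  with assms show ?thesis by (simp add: pos_coeffs_def)
qed

lemma pos_coeffs_nonzero: "c \<in> pos_coeffs \<Longrightarrow> c \<noteq> (\<lambda>_. 0)"
  using root_nonzero[of "rt c"] by (auto simp: pos_coeffs_def rt_def)

text \<open>
  A positive root other than \<open>\<alpha>\<^sub>m\<close> is not a multiple of \<open>\<alpha>\<^sub>m\<close>, so it has another positive
  coordinate, which the reflection in \<open>\<alpha>\<^sub>m\<close> leaves unchanged.
\<close>

lemma positive_system_pos_coeffs: "positive_system l A pos_coeffs"
  unfolding positive_system_def
proof (intro conjI ballI impI)
  show "pos_coeffs \<subseteq> support_in l" by (auto simp: pos_coeffs_def)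
  show "unit_coeff m \<in> pos_coeffs" if "m \<in> {1..l}" for m
    using that a_root rt_unit by (auto simp: pos_coeffs_def support_in_def unit_coeff_def)
  show "c \<noteq> (\<lambda>_. 0)" if "c \<in> pos_coeffs" for c using that by (rule pos_coeffs_nonzero)
  show "\<forall>i. c i \<ge> 0" if "c \<in> pos_coeffs" for c using that by (simp add: pos_coeffs_def)
  fix m c assume m: "m \<in> {1..l}" and c: "c \<in> pos_coeffs" and ne: "c \<noteq> unit_coeff m"
  have c': "c \<in> support_in l" "\<forall>i. c i \<ge> 0" "rt c \<in> roots h" using c by (auto simp: pos_coeffs_def)
  have "\<exists>j. j \<noteq> m \<and> c j \<noteq> 0"
  proof (rule ccontr)
    assume n: "\<not> ?thesis"
    have cm: "c i = c m * unit_coeff m i" for i using n by (auto simp: unit_coeff_def)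
    have "rt c s = of_int (c m) * rt (unit_coeff m) s" for s
    proof -
      have "rt c s = (\<Sum>i=1..l. of_int (c m) * (of_int (unit_coeff m i) * a i s))"
        unfolding rt_def by (rule sum.cong) (metis cm of_int_mult mult.assoc)+
      then show ?thesis by (simp add: rt_def sum_distrib_left)
    qed
    then have "rt c = (\<lambda>s. of_int (c m) * rt (unit_coeff m) s)" by (rule ext)
    then have "c m = 1 \<or> c m = - 1"
      using root_no_int_multiple[OF a_root[OF m]] c'(3) rt_unit[OF m] by simp
    then have "c m = 1" using c'(2) by (metis neg_0_le_iff_le not_one_le_zero)
    with n have "c = unit_coeff m" by (intro ext) (auto simp: unit_coeff_def)
    with ne show False ..
  qed
  then obtain j where j: "j \<noteq> m" "c j > 0" using c'(2) by (metis order_le_less)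
  show "reflect l A m c \<in> pos_coeffs"
  proof (rule root_of_mixed_sign)
    show "reflect l A m c \<in> support_in l"
      using c'(1) m by (auto simp: support_in_def reflect_def)
    show "rt (reflect l A m c) \<in> roots h"
      unfolding rt_reflect[OF m] by (rule root_reflection[OF a_root[OF m] c'(3)])
    show "reflect l A m c j > 0" using j by (simp add: reflect_def)
  qed
qed

end

section \<open>Abelian ideals in coordinates\<close>

context cartan_type
begin

text \<open>
  Applied to brackets of root vectors: a sum of two roots with a positive coordinate has a
  nonzero root space only if it is a positive root.
\<close>

lemma root_space_sum_zero:
  assumes c: "c \<in> support_in l" "c j > 0" "c \<notin> pos_coeffs" and x: "x \<in> g (rt c)"
  shows "x = 0"
proof (rule ccontr)
  assume "x \<noteq> 0"
  have "rt c \<noteq> (\<lambda>_. 0)" using rt_zero_imp[OF c(1)] c(2) by auto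
  moreover have "rt c \<in> dual h"
  proof -
    have "(\<lambda>s. \<Sum>i\<in>B. of_int (c i) * a i s) \<in> dual h" if "finite B" "B \<subseteq> {1..l}" for B
      using that
    proof (induction rule: finite_induct)
      case (insert i B)
      then show ?case
        using dual_comb[of "a i" h "\<lambda>s. \<Sum>i\<in>B. of_int (c i) * a i s" "of_int (c i)" 1]
          root_in_dual[OF a_root[of i]] by simp
    qed simp
    then show ?thesis unfolding rt_def by blast
  qed
  ultimately have "rt c \<in> roots h" using rootsI x \<open>x \<noteq> 0\<close> by blast
  then show False using root_of_mixed_sign[OF c(1) _ c(2)] c(3) by blast
qed

text \<open>
  The root set of a sum of root spaces can be read off from the sum by independence of the root
  spaces. An ideal has a root set that is closed under addition because brackets of root spaces
  do not vanish; the converse needs only that the bracket of two root spaces lies in the root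
  space of the sum, which is zero unless that sum is a root. The sum of a root in \<open>\<Phi>\<close> and a root
  in \<open>\<Delta>\<^sub>I \<union> \<Delta>\<^sup>+\<close> has a positive coordinate outside \<open>I\<close>, which rules out a sum that is zero or negative.
\<close>

lemma bij_coeff_ideals:
  assumes J: "J \<subseteq> \<Pi>"
  defines "K \<equiv> {i\<in>{1..l}. a i \<in> J}"
  shows "bij_betw (\<lambda>F. root_sum h (rt ` F)) (coeff_ideals pos_coeffs K) (abelian_ideals h \<Pi> J)"
  unfolding bij_betw_def
proof
  let ?S = "\<lambda>F. root_sum h (rt ` F)"
  have pc: "c \<in> support_in l" "\<And>i. c i \<ge> 0" "rt c \<in> roots h" "rt c \<in> dual h" "c \<noteq> (\<lambda>_. 0)"
    if "c \<in> pos_coeffs" for c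
    using that pos_coeffs_nonzero[OF that] root_in_dual by (auto simp: pos_coeffs_def)
  have span_S: "c \<in> F" if "F \<subseteq> pos_coeffs" "c \<in> pos_coeffs" "x \<in> g (rt c)" "x \<noteq> 0" "x \<in> ?S F" for F c x
  proof -
    have "rt c \<in> rt ` F"
      by (rule root_vector_in_span[OF _ _ that(3,4)]) (use that pc in \<open>auto simp: root_sum_def\<close>)
    then obtain d where "d \<in> F" "rt c = rt d" by blast
    then show ?thesis using inj_onD[OF rt_inj] pc(1) that(1,2) by blast
  qed
  have vec: "\<exists>x. x \<in> g \<beta> \<and> x \<noteq> 0" if "\<beta> \<in> roots h" for \<beta>
    using weight_vectorE[OF root_weight[OF that]] by blast
  have in_S: "x \<in> ?S F" if "c \<in> F" "x \<in> g (rt c)" for c F x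
    unfolding root_sum_def using that by (blast intro: span_base)
  have base_sub: "\<exists>k. k \<notin> K \<and> c k \<noteq> 0" if "c \<in> pos_coeffs" "rt c \<notin> root_subsystem h J" for c
    using root_subsystem_rt[OF J pc(1)[OF that(1)]] that pc(3)[OF that(1)] unfolding K_def by blast
  show "inj_on ?S (coeff_ideals pos_coeffs K)"
  proof (rule inj_onI)
    fix F G assume FG: "F \<in> coeff_ideals pos_coeffs K" "G \<in> coeff_ideals pos_coeffs K" "?S F = ?S G"
    then have sub: "F \<subseteq> pos_coeffs" "G \<subseteq> pos_coeffs" by (auto simp: coeff_ideals_def)
    have "F \<subseteq> G" if "F \<subseteq> pos_coeffs" "G \<subseteq> pos_coeffs" "?S F = ?S G" for F G
    proof
      fix c assume c: "c \<in> F"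
      then have cp: "c \<in> pos_coeffs" using that by blast
      from vec[OF pc(3)[OF this]] obtain x where x: "x \<in> g (rt c)" "x \<noteq> 0" by blast
      have "x \<in> ?S G" using in_S[OF c x(1)] that(3) by simp
      then show "c \<in> G" by (rule span_S[OF that(2) cp x])
    qed
    then show "F = G" using sub FG(3) by blast
  qed
  show "?S ` coeff_ideals pos_coeffs K = abelian_ideals h \<Pi> J"
  proof (intro subset_antisym subsetI)
    fix V assume "V \<in> ?S ` coeff_ideals pos_coeffs K"
    then obtain F where V: "V = ?S F" and "F \<in> coeff_ideals pos_coeffs K" by blast
    note F = coeff_idealsD[OF this(2)]
    have Fpos: "\<exists>k. k \<notin> K \<and> c k > 0" if "c \<in> F" for c
      using F(1,2) that pc(2) by (metis order_le_less subsetD)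
    have sub: "rt ` F \<subseteq> pos_roots h \<Pi> - root_subsystem h J"
    proof
      fix \<beta> assume "\<beta> \<in> rt ` F"
      then obtain c where c: "c \<in> F" "\<beta> = rt c" by blast
      with F(2)[OF c(1)] root_subsystem_rt[OF J, of c] pc(1)[of c] F(1)
      have "\<beta> \<notin> root_subsystem h J" unfolding K_def by blast
      with c F(1) show "\<beta> \<in> pos_roots h \<Pi> - root_subsystem h J" unfolding pos_roots_rt by blast
    qed
    have sum_supp: "c + d \<in> support_in l" if "c \<in> support_in l" "d \<in> support_in l" for c d
      using that by (simp add: support_in_def)
    have "ideal_of V (parabolic h \<Pi> J)"
      unfolding ideal_of_def
    proof (intro conjI ballI)
      show "subspace V" unfolding V root_sum_def by (rule subspace_span)
      show "V \<subseteq> parabolic h \<Pi> J"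
        unfolding V root_sum_def parabolic_def using sub by (intro span_mono) blast
      fix x y assume x: "x \<in> parabolic h \<Pi> J" and y: "y \<in> V"
      from y[unfolded V root_sum_def] show "br x y \<in> V"
      proof (induction rule: span_induct_alt)
        case base
        show ?case unfolding V root_sum_def by (simp add: span_zero)
      next
        case (step s v y)
        then obtain c where c: "c \<in> F" "v \<in> g (rt c)" by blast
        have cp: "c \<in> pos_coeffs" using c F(1) by blast
        from x[unfolded parabolic_def] have "br x v \<in> V"
        proof (induction rule: span_induct_alt)
          case base
          show ?case unfolding V root_sum_def by (simp add: span_zero)
        next
          case (step r u w)
          from step(1) have "br u v \<in> V"
          proof
            assume "u \<in> h"
            then have "br u v = scale (rt c u) v" using c(2) by (simp add: root_space_def)
            then show ?thesis using in_S[OF c] unfolding V root_sum_def by (simp add: span_scale)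
          next
            assume "u \<in> (\<Union>\<alpha>\<in>root_subsystem h J \<union> pos_roots h \<Pi>. g \<alpha>)"
            then obtain \<beta> where b: "\<beta> \<in> root_subsystem h J \<union> pos_roots h \<Pi>" "u \<in> g \<beta>" by blast
            then have "\<beta> \<in> roots h" by (auto simp: root_subsystem_def pos_roots_def)
            then obtain d where d: "d \<in> support_in l" "\<beta> = rt d" "(\<forall>i. d i \<ge> 0) \<or> (\<forall>i. d i \<le> 0)"
              by (rule root_coeffs)
            have dd: "d \<in> pos_coeffs \<or> (- d \<in> pos_coeffs \<and> (\<forall>k. k \<notin> K \<longrightarrow> d k = 0))"
            proof (cases "\<forall>i. d i \<ge> 0")
              case True
              then show ?thesis using d \<open>\<beta> \<in> roots h\<close> by (simp add: pos_coeffs_def)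
            next
              case False
              have "\<beta> \<notin> pos_roots h \<Pi>"
              proof
                assume "\<beta> \<in> pos_roots h \<Pi>"
                then obtain e where "e \<in> pos_coeffs" "rt d = rt e"
                  unfolding pos_roots_rt d(2) by (elim imageE)
                then have "d = e" using inj_onD[OF rt_inj _ d(1) pc(1)] by blast
                with False pc(2)[OF \<open>e \<in> pos_coeffs\<close>] show False by simp
              qed
              then have "\<beta> \<in> root_subsystem h J" using b by blast
              then have "\<forall>k. k \<notin> K \<longrightarrow> d k = 0"
                using root_subsystem_rt[OF J d(1)] d(2) unfolding K_def by blast
              moreover have "- d \<in> pos_coeffs"
                using False d root_opposite[OF \<open>\<beta> \<in> roots h\<close>]
                by (auto simp: pos_coeffs_def support_in_def rt_uminus)
              ultimately show ?thesis by blast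
            qed
            have ds: "br u v \<in> g (rt (c + d))"
            proof -
              have "rt (c + d) = (\<lambda>t. \<beta> t + rt c t)" unfolding d(2) rt_add by (rule ext, rule add.commute)
              with br_root_space[OF b(2) c(2)] show ?thesis by metis
            qed
            obtain k where k: "k \<notin> K" "c k > 0" using Fpos[OF c(1)] by blast
            from dd have "d k \<ge> 0"
            proof
              assume "d \<in> pos_coeffs"
              then show ?thesis by (rule pc(2))
            qed (use k(1) in simp)
            then have "(c + d) k > 0" using k by simp
            then have "br u v = 0 \<or> c + d \<in> pos_coeffs"
              using root_space_sum_zero[OF sum_supp[OF pc(1)[OF cp] d(1)] _ _ ds] by blast
            then show ?thesis
            proof
              assume "br u v = 0"
              then show ?thesis unfolding V root_sum_def by (simp add: span_zero)
            next
              assume "c + d \<in> pos_coeffs"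
              then have "c + d \<in> F" using F(3)[OF c(1) dd] by blast
              then show ?thesis unfolding V using ds by (rule in_S)
            qed
          qed
          with step(2) show ?case unfolding V root_sum_def
            by (simp add: br_add_left br_scale_left span_add span_scale)
        qed
        with step(2) show ?case unfolding V root_sum_def
          by (simp add: br_add_right br_scale_right span_add span_scale)
      qed
    qed
    moreover have "abelian V"
      unfolding abelian_def
    proof (intro ballI)
      fix x y assume x: "x \<in> V" and y: "y \<in> V"
      from y[unfolded V root_sum_def] show "br x y = 0"
      proof (induction rule: span_induct_alt)
        case (step s v y)
        then obtain c where c: "c \<in> F" "v \<in> g (rt c)" by blast
        from x[unfolded V root_sum_def] have "br x v = 0"
        proof (induction rule: span_induct_alt)
          case (step r u w)
          then obtain d where d: "d \<in> F" "u \<in> g (rt d)" by blast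
          have ds: "br u v \<in> g (rt (d + c))"
            using br_root_space[OF d(2) c(2)] by (simp add: rt_add)
          obtain k where k: "d k > 0" using Fpos[OF d(1)] by blast
          have "c k \<ge> 0" using c F(1) pc(2) by blast
          then have "(d + c) k > 0" using k by simp
          moreover have "d + c \<in> support_in l" using sum_supp pc(1) F(1) c(1) d(1) by blast
          ultimately have "br u v = 0"
            using root_space_sum_zero[OF _ _ F(4)[OF d(1) c(1)] ds] by blast
          with step(2) show ?case by (simp add: br_add_left br_scale_left)
        qed simp
        with step(2) show ?case by (simp add: br_add_right br_scale_right)
      qed simp
    qed
    ultimately show "V \<in> abelian_ideals h \<Pi> J"
      using sub V unfolding abelian_ideals_def by blast
  next
    fix V assume "V \<in> abelian_ideals h \<Pi> J"
    then obtain \<Phi> where P: "\<Phi> \<subseteq> pos_roots h \<Pi> - root_subsystem h J" "V = root_sum h \<Phi>"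
      and ideal: "ideal_of V (parabolic h \<Pi> J)" and ab: "abelian V"
      unfolding abelian_ideals_def by blast
    define F where "F = {c \<in> pos_coeffs. rt c \<in> \<Phi>}"
    have "rt ` F = \<Phi>" using P(1) unfolding F_def pos_roots_rt by blast
    then have V: "V = ?S F" using P(2) by simp
    have Fsub: "F \<subseteq> pos_coeffs" by (auto simp: F_def)
    have "F \<in> coeff_ideals pos_coeffs K"
      unfolding coeff_ideals_def
    proof (intro CollectI conjI ballI allI impI)
      show "F \<subseteq> pos_coeffs" by (rule Fsub)
      show "\<exists>k. k \<notin> K \<and> c k \<noteq> 0" if "c \<in> F" for c
        using that P(1) by (intro base_sub) (auto simp: F_def)
    next
      fix c d assume c: "c \<in> F"
        and d: "d \<in> pos_coeffs \<or> (- d \<in> pos_coeffs \<and> (\<forall>k. k \<notin> K \<longrightarrow> d k = 0))"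
        and cd: "c + d \<in> pos_coeffs"
      have cp: "c \<in> pos_coeffs" using c Fsub by blast
      have rd: "rt d \<in> roots h \<and> rt d \<in> root_subsystem h J \<union> pos_roots h \<Pi>"
        using d
      proof
        assume "d \<in> pos_coeffs"
        then show ?thesis using pc(3) unfolding pos_roots_rt by blast
      next
        assume d: "- d \<in> pos_coeffs \<and> (\<forall>k. k \<notin> K \<longrightarrow> d k = 0)"
        then have "rt d \<in> roots h" using root_opposite[OF pc(3)[of "- d"]] by (simp add: rt_uminus)
        moreover have "d \<in> support_in l" using pc(1)[of "- d"] d by (simp add: support_in_def)
        ultimately show ?thesis using d root_subsystem_rt[OF J] unfolding K_def by blast
      qed
      obtain x where x: "x \<in> g (rt c)" "x \<noteq> 0" using vec[OF pc(3)[OF cp]] by blast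
      obtain y where y: "y \<in> g (rt d)" "y \<noteq> 0" using vec[of "rt d"] rd by blast
      have "rt (d + c) \<in> roots h" using pc(3)[OF cd] by (simp add: add.commute)
      then have "br y x \<noteq> 0"
        using root_bracket_nonzero[of "rt d" "rt c" y x] rd pc(3)[OF cp] x y by (simp add: rt_add)
      moreover have "br y x \<in> g (rt (c + d))"
        using br_root_space[OF y(1) x(1)] by (simp add: rt_add add.commute)
      moreover have "y \<in> parabolic h \<Pi> J"
        unfolding parabolic_def using rd y(1) by (blast intro: span_base)
      then have "br y x \<in> V" using ideal in_S[OF c x(1)] V unfolding ideal_of_def by blast
      ultimately show "c + d \<in> F" using span_S[OF Fsub cd] V by simp
    next
      fix c d assume c: "c \<in> F" and d: "d \<in> F"
      show "c + d \<notin> pos_coeffs"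
      proof
        assume cd: "c + d \<in> pos_coeffs"
        have cp: "c \<in> pos_coeffs" "d \<in> pos_coeffs" using c d Fsub by auto
        obtain x where x: "x \<in> g (rt c)" "x \<noteq> 0" using vec[OF pc(3)[OF cp(1)]] by blast
        obtain y where y: "y \<in> g (rt d)" "y \<noteq> 0" using vec[OF pc(3)[OF cp(2)]] by blast
        have "br x y \<noteq> 0"
          using root_bracket_nonzero[OF pc(3)[OF cp(1)] pc(3)[OF cp(2)] _ x y] pc(3)[OF cd]
          by (simp add: rt_add)
        moreover have "br x y = 0"
          using ab in_S[OF c x(1)] in_S[OF d y(1)] V unfolding abelian_def by blast
        ultimately show False by blast
      qed
    qed
    with V show "V \<in> ?S ` coeff_ideals pos_coeffs K" by blast
  qed
qed

lemma card_abelian_ideals: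
  assumes "positive_system l A Q" and w: "\<And>j. j \<in> {1..l} \<Longrightarrow> w j \<ge> (0::int)"
      "\<And>i. i \<in> {1..l} \<Longrightarrow> (\<Sum>j=1..l. A i j * w j) > 0"
    and J: "J \<subseteq> \<Pi>"
  shows "card (abelian_ideals h \<Pi> J) = card (coeff_ideals Q {i\<in>{1..l}. a i \<in> J})"
proof -
  have "pos_coeffs = Q"
    using positive_system_subset[OF positive_system_pos_coeffs assms(1) cartan_diag w]
      positive_system_subset[OF assms(1) positive_system_pos_coeffs cartan_diag w] by blast
  then show ?thesis using bij_betw_same_card[OF bij_coeff_ideals[OF J]] by simp
qed

lemma card_enum:
  assumes "J \<subseteq> \<Pi>" shows "card {i\<in>{1..l}. a i \<in> J} = card J"
proof (rule bij_betw_same_card)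
  have "a ` {i\<in>{1..l}. a i \<in> J} = J" using enum assms by (auto simp: bij_betw_def)
  moreover have "inj_on a {i\<in>{1..l}. a i \<in> J}"
    using enum by (auto simp: bij_betw_def intro: inj_on_subset)
  ultimately show "bij_betw a {i\<in>{1..l}. a i \<in> J} J" by (simp add: bij_betw_def)
qed

end

section \<open>Counting diagrams\<close>

text \<open>
  Young diagrams, as sets of boxes (row, column) counted from 0; the second condition, applied
  to the last box of the first column and the last box of the first row, bounds the sum of their
  lengths by \<open>m + 1\<close>.
\<close>

definition corner_diagrams :: "nat \<Rightarrow> (nat \<times> nat) set set" where
  "corner_diagrams m = {D. (\<forall>x v x' v'. (x, v) \<in> D \<longrightarrow> x' \<le> x \<longrightarrow> v' \<le> v \<longrightarrow> (x', v') \<in> D) \<and>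
     (\<forall>x v x' v'. (x, v) \<in> D \<longrightarrow> (x', v') \<in> D \<longrightarrow> x + v' < m)}"

text \<open>
  The new first row is as long as the bound of \<open>corner_diagrams (Suc m)\<close> allows.
\<close>

definition prepend_row :: "nat \<Rightarrow> (nat \<times> nat) set \<Rightarrow> (nat \<times> nat) set" where
  "prepend_row m D = {(0, v) |v. v \<le> m \<and> (\<forall>x. (x, 0) \<in> D \<longrightarrow> x + v < m)} \<union>
     {(Suc x, v) |x v. (x, v) \<in> D}"

lemma prepend_row_iff [simp]:
  "(0, v) \<in> prepend_row m D \<longleftrightarrow> v \<le> m \<and> (\<forall>x. (x, 0) \<in> D \<longrightarrow> x + v < m)"
  "(Suc x, v) \<in> prepend_row m D \<longleftrightarrow> (x, v) \<in> D"
  by (auto simp: prepend_row_def)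

lemma corner_diagramsD:
  assumes "D \<in> corner_diagrams m"
  shows "(x, v) \<in> D \<Longrightarrow> x' \<le> x \<Longrightarrow> v' \<le> v \<Longrightarrow> (x', v') \<in> D"
    "(x, v) \<in> D \<Longrightarrow> (x', v') \<in> D \<Longrightarrow> x + v' < m"
  using assms unfolding corner_diagrams_def mem_Collect_eq by blast+

lemma corner_diagramsI:
  assumes "\<And>x v x' v'. (x, v) \<in> D \<Longrightarrow> x' \<le> x \<Longrightarrow> v' \<le> v \<Longrightarrow> (x', v') \<in> D"
    "\<And>x v x' v'. (x, v) \<in> D \<Longrightarrow> (x', v') \<in> D \<Longrightarrow> x + v' < m"
  shows "D \<in> corner_diagrams m"
  using assms unfolding corner_diagrams_def mem_Collect_eq by blast

lemma prepend_row_corner: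
  assumes D: "D \<in> corner_diagrams m" shows "prepend_row m D \<in> corner_diagrams (Suc m)"
proof (rule corner_diagramsI)
  fix x v x' v' assume xv: "(x, v) \<in> prepend_row m D" and le: "x' \<le> x" "v' \<le> v"
  show "(x', v') \<in> prepend_row m D"
  proof (cases x')
    case 0
    show ?thesis
    proof (cases x)
      case 0
      with xv le \<open>x' = 0\<close> show ?thesis by (auto intro: le_less_trans[OF add_left_mono])
    next
      case (Suc y)
      then have y: "(y, v) \<in> D" using xv by simp
      have "v < m" using corner_diagramsD(2)[OF D y y] by simp
      moreover have "z + v < m" if "(z, 0) \<in> D" for z by (rule corner_diagramsD(2)[OF D that y])
      ultimately show ?thesis using 0 le by (auto intro: le_less_trans[OF add_left_mono])
    qed
  next
    case (Suc y')
    then obtain y where y: "x = Suc y" using le(1) by (cases x) auto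
    then show ?thesis using Suc xv le corner_diagramsD(1)[OF D, of y v y' v'] by simp
  qed
next
  fix x v x' v' assume a: "(x, v) \<in> prepend_row m D" "(x', v') \<in> prepend_row m D"
  show "x + v' < Suc m"
  proof (cases x)
    case 0
    show ?thesis
    proof (cases x')
      case (Suc y')
      then have "(y', v') \<in> D" using a by simp
      from corner_diagramsD(2)[OF D this this] show ?thesis using 0 by simp
    qed (use a 0 in simp)
  next
    case (Suc y)
    then have y: "(y, v) \<in> D" using a by simp
    show ?thesis
    proof (cases x')
      case 0
      have "(y, 0) \<in> D" by (rule corner_diagramsD(1)[OF D y]) simp_all
      then show ?thesis using Suc 0 a(2) by auto
    next
      case (Suc y')
      then have "(y', v') \<in> D" using a by simp
      from corner_diagramsD(2)[OF D y this] show ?thesis using \<open>x = Suc y\<close> by simp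
    qed
  qed
qed

text \<open>
  The end of the new first row and the end of the first column attain the bound for \<open>m + 1\<close>.
\<close>

lemma prepend_row_not_smaller:
  assumes D: "D \<in> corner_diagrams m" shows "prepend_row m D \<notin> corner_diagrams m"
proof
  assume E: "prepend_row m D \<in> corner_diagrams m"
  let ?X = "{x. (x, 0) \<in> D}"
  have fin: "finite ?X" by (rule finite_subset[of _ "{..<m}"]) (use corner_diagramsD(2)[OF D] in fastforce)+
  show False
  proof (cases "?X = {}")
    case True
    then have "(0, m) \<in> prepend_row m D" by auto
    from corner_diagramsD(2)[OF E this this] show False by simp
  next
    case False
    define x where "x = Max ?X"
    have x: "(x, 0) \<in> D" using Max_in[OF fin False] by (simp add: x_def)
    have mx: "y \<le> x" if "(y, 0) \<in> D" for y using Max_ge[OF fin] that by (simp add: x_def)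
    have xm: "x < m" using corner_diagramsD(2)[OF D x x] by simp
    have "y + (m - Suc x) < m" if "(y, 0) \<in> D" for y using mx[OF that] xm by linarith
    then have "(0, m - Suc x) \<in> prepend_row m D" by simp
    moreover have "(Suc x, 0) \<in> prepend_row m D" using x by simp
    ultimately have "Suc x + (m - Suc x) < m" using corner_diagramsD(2)[OF E] by blast
    with xm show False by simp
  qed
qed

text \<open>
  A diagram that satisfies the bound for \<open>m + 1\<close> but not for \<open>m\<close> attains it, so its first row is
  determined by the remaining rows. These form a diagram with one row less, which satisfies
  the bound for \<open>m\<close>; conversely every such diagram can be extended.
\<close>

lemma corner_diagrams_Suc:
  "corner_diagrams (Suc m) = corner_diagrams m \<union> prepend_row m ` corner_diagrams m"
proof (intro subset_antisym subsetI)
  fix D assume "D \<in> corner_diagrams m \<union> prepend_row m ` corner_diagrams m"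
  then consider "D \<in> corner_diagrams m" | "D \<in> prepend_row m ` corner_diagrams m" by blast
  then show "D \<in> corner_diagrams (Suc m)"
  proof cases
    case 1
    show ?thesis
    proof (rule corner_diagramsI)
      fix x v x' v' assume "(x, v) \<in> D" "(x', v') \<in> D"
      from corner_diagramsD(2)[OF 1 this] show "x + v' < Suc m" by simp
    qed (rule corner_diagramsD(1)[OF 1])
  qed (use prepend_row_corner in blast)
next
  fix D assume D: "D \<in> corner_diagrams (Suc m)"
  show "D \<in> corner_diagrams m \<union> prepend_row m ` corner_diagrams m"
  proof (cases "D \<in> corner_diagrams m")
    case False
    have "\<exists>x v x' v'. (x, v) \<in> D \<and> (x', v') \<in> D \<and> \<not> x + v' < m"
      using False corner_diagramsI[of D m] corner_diagramsD(1)[OF D] by blast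
    then obtain x v x' v' where xv: "(x, v) \<in> D" "(x', v') \<in> D" "\<not> x + v' < m" by blast
    then have full: "x + v' = m" using corner_diagramsD(2)[OF D xv(1,2)] by simp
    have x0: "(x, 0) \<in> D" and v0: "(0, v') \<in> D"
      using corner_diagramsD(1)[OF D xv(1), of x 0] corner_diagramsD(1)[OF D xv(2), of 0 v'] by auto
    define E where "E = {(x, v). (Suc x, v) \<in> D}"
    have "E \<in> corner_diagrams m"
    proof (rule corner_diagramsI)
      fix x v x' v' assume "(x, v) \<in> E" "(x', v') \<in> E"
      then show "x + v' < m" using corner_diagramsD(2)[OF D, of "Suc x" v "Suc x'" v'] by (simp add: E_def)
    next
      fix x v x' v' assume "(x, v) \<in> E" "x' \<le> x" "v' \<le> v"
      then show "(x', v') \<in> E" using corner_diagramsD(1)[OF D, of "Suc x" v "Suc x'" v'] by (simp add: E_def)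
    qed
    moreover have "D = prepend_row m E"
    proof (intro set_eqI)
      fix yw show "yw \<in> D \<longleftrightarrow> yw \<in> prepend_row m E"
      proof (cases yw)
        case (Pair y w)
        show ?thesis
        proof (cases y)
          case (Suc z) with Pair show ?thesis by (simp add: E_def)
        next
          case 0
          have "(0, w) \<in> D \<longleftrightarrow> w \<le> m \<and> (\<forall>x. (x, 0) \<in> E \<longrightarrow> x + w < m)"
          proof
            assume w: "(0, w) \<in> D"
            have "w \<le> m" using corner_diagramsD(2)[OF D w w] by simp
            moreover have "z + w < m" if "(z, 0) \<in> E" for z
              using corner_diagramsD(2)[OF D _ w, of "Suc z" 0] that by (simp add: E_def)
            ultimately show "w \<le> m \<and> (\<forall>x. (x, 0) \<in> E \<longrightarrow> x + w < m)" by blast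
          next
            assume w: "w \<le> m \<and> (\<forall>x. (x, 0) \<in> E \<longrightarrow> x + w < m)"
            have "w \<le> v'"
            proof (cases x)
              case 0 with full w show ?thesis by simp
            next
              case (Suc z)
              then have "z + w < m" using w x0 by (simp add: E_def)
              with full Suc show ?thesis by simp
            qed
            then show "(0, w) \<in> D" using corner_diagramsD(1)[OF D v0] by blast
          qed
          with Pair 0 show ?thesis by simp
        qed
      qed
    qed
    ultimately show ?thesis by blast
  qed simp
qed

lemma inj_prepend_row: "inj (prepend_row m)"
proof (rule injI)
  fix D E assume e: "prepend_row m D = prepend_row m E"
  have "(x, v) \<in> D \<longleftrightarrow> (x, v) \<in> E" for x v
    using e prepend_row_iff(2)[of x v m D] prepend_row_iff(2)[of x v m E] by simp
  then show "D = E" by auto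
qed

lemma card_corner_diagrams: "finite (corner_diagrams m) \<and> card (corner_diagrams m) = 2 ^ m"
proof (induction m)
  case 0
  have "corner_diagrams 0 = {{}}" by (auto simp: corner_diagrams_def)
  then show ?case by simp
next
  case (Suc m)
  have "corner_diagrams m \<inter> prepend_row m ` corner_diagrams m = {}"
    using prepend_row_not_smaller by blast
  with Suc show ?case
    by (simp add: corner_diagrams_Suc card_Un_disjoint card_image[OF inj_on_subset[OF inj_prepend_row]])
qed

text \<open>
  Shifted Young diagrams inside the staircase of size \<open>m\<close>: row \<open>x\<close> starts on the diagonal.
\<close>

definition shifted_diagrams :: "nat \<Rightarrow> (nat \<times> nat) set set" where
  "shifted_diagrams m = {D. (\<forall>x y. (x, y) \<in> D \<longrightarrow> x \<le> y \<and> y < m) \<and>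
     (\<forall>x y x' y'. (x, y) \<in> D \<longrightarrow> x' \<le> x \<longrightarrow> y' \<le> y \<longrightarrow> x' \<le> y' \<longrightarrow> (x', y') \<in> D)}"

definition prepend_full_row :: "nat \<Rightarrow> (nat \<times> nat) set \<Rightarrow> (nat \<times> nat) set" where
  "prepend_full_row m D = {(0, y) |y. y \<le> m} \<union> {(Suc x, Suc y) |x y. (x, y) \<in> D}"

lemma prepend_full_row_iff [simp]:
  "(0, y) \<in> prepend_full_row m D \<longleftrightarrow> y \<le> m" "(Suc x, 0) \<notin> prepend_full_row m D"
  "(Suc x, Suc y) \<in> prepend_full_row m D \<longleftrightarrow> (x, y) \<in> D"
  by (auto simp: prepend_full_row_def)

lemma shifted_diagramsD:
  assumes "D \<in> shifted_diagrams m"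
  shows "(x, y) \<in> D \<Longrightarrow> x \<le> y" "(x, y) \<in> D \<Longrightarrow> y < m"
    "(x, y) \<in> D \<Longrightarrow> x' \<le> x \<Longrightarrow> y' \<le> y \<Longrightarrow> x' \<le> y' \<Longrightarrow> (x', y') \<in> D"
  using assms unfolding shifted_diagrams_def mem_Collect_eq by blast+

lemma shifted_diagramsI:
  assumes "\<And>x y. (x, y) \<in> D \<Longrightarrow> x \<le> y" "\<And>x y. (x, y) \<in> D \<Longrightarrow> y < m"
    "\<And>x y x' y'. (x, y) \<in> D \<Longrightarrow> x' \<le> x \<Longrightarrow> y' \<le> y \<Longrightarrow> x' \<le> y' \<Longrightarrow> (x', y') \<in> D"
  shows "D \<in> shifted_diagrams m"
  using assms unfolding shifted_diagrams_def mem_Collect_eq by blast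

text \<open>
  The first row of a shifted diagram either has no box in column \<open>m\<close>, and then nor has any other
  row, or it is full, and then the other rows form an arbitrary diagram of size \<open>m\<close>.
\<close>

lemma shifted_diagrams_Suc:
  "shifted_diagrams (Suc m) = shifted_diagrams m \<union> prepend_full_row m ` shifted_diagrams m"
proof (intro subset_antisym subsetI)
  fix D assume "D \<in> shifted_diagrams m \<union> prepend_full_row m ` shifted_diagrams m"
  then consider "D \<in> shifted_diagrams m" | E where "E \<in> shifted_diagrams m" "D = prepend_full_row m E"
    by blast
  then show "D \<in> shifted_diagrams (Suc m)"
  proof cases
    case 1
    then show ?thesis
      using shifted_diagramsD[OF 1] by (intro shifted_diagramsI) (blast intro: less_SucI)+
  next
    case 2
    note E = shifted_diagramsD[OF 2(1)]
    show ?thesis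
      unfolding 2(2)
    proof (rule shifted_diagramsI)
      fix x y assume "(x, y) \<in> prepend_full_row m E"
      then show "x \<le> y" "y < Suc m"
        using E(1)[of "x - 1" "y - 1"] E(2)[of "x - 1" "y - 1"] by (cases x; cases y; simp)+
    next
      fix x y x' y' assume a: "(x, y) \<in> prepend_full_row m E" "x' \<le> x" "y' \<le> y" "x' \<le> y'"
      have ym: "y \<le> m" using a(1) E(2)[of "x - 1" "y - 1"] by (cases x; cases y; simp)
      show "(x', y') \<in> prepend_full_row m E"
        using a ym E(3)[of "x - 1" "y - 1" "x' - 1" "y' - 1"]
        by (cases x'; cases y'; cases x; cases y; simp)
    qed
  qed
next
  fix D assume D: "D \<in> shifted_diagrams (Suc m)"
  note d = shifted_diagramsD[OF D]
  show "D \<in> shifted_diagrams m \<union> prepend_full_row m ` shifted_diagrams m"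
  proof (cases "(0, m) \<in> D")
    case False
    have "y < m" if "(x, y) \<in> D" for x y
      using d(2)[OF that] d(3)[OF that, of 0 m] False by (metis less_Suc_eq order_refl zero_le)
    then have "D \<in> shifted_diagrams m" using d by (intro shifted_diagramsI) blast+
    then show ?thesis by blast
  next
    case True
    define E where "E = {(x, y). (Suc x, Suc y) \<in> D}"
    have "E \<in> shifted_diagrams m"
    proof (rule shifted_diagramsI)
      fix x y assume "(x, y) \<in> E"
      then show "x \<le> y" "y < m" using d(1,2)[of "Suc x" "Suc y"] by (simp_all add: E_def)
    next
      fix x y x' y' assume "(x, y) \<in> E" "x' \<le> x" "y' \<le> y" "x' \<le> y'"
      then show "(x', y') \<in> E" using d(3)[of "Suc x" "Suc y" "Suc x'" "Suc y'"] by (simp add: E_def)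
    qed
    moreover have "(x, y) \<in> D \<longleftrightarrow> (x, y) \<in> prepend_full_row m E" for x y
    proof (cases x)
      case 0
      then show ?thesis using d(2)[of 0 y] d(3)[OF True, of 0 y] by auto
    next
      case (Suc z)
      then show ?thesis using d(1)[of x y] by (cases y) (auto simp: E_def)
    qed
    then have "D = prepend_full_row m E" by auto
    ultimately show ?thesis by blast
  qed
qed

lemma inj_prepend_full_row: "inj (prepend_full_row m)"
proof (rule injI)
  fix D E assume e: "prepend_full_row m D = prepend_full_row m E"
  have "(x, y) \<in> D \<longleftrightarrow> (x, y) \<in> E" for x y
    using e prepend_full_row_iff(3)[of x y m D] prepend_full_row_iff(3)[of x y m E] by simp
  then show "D = E" by auto
qed

lemma card_shifted_diagrams: "finite (shifted_diagrams m) \<and> card (shifted_diagrams m) = 2 ^ m"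
proof (induction m)
  case 0
  have "shifted_diagrams 0 = {{}}" by (auto simp: shifted_diagrams_def)
  then show ?case by simp
next
  case (Suc m)
  have "(0, m) \<in> prepend_full_row m D" for D by simp
  then have "shifted_diagrams m \<inter> prepend_full_row m ` shifted_diagrams m = {}"
    using shifted_diagramsD(2)[of _ m 0 m] by blast
  with Suc show ?case
    by (simp add: shifted_diagrams_Suc card_Un_disjoint card_image[OF inj_on_subset[OF inj_prepend_full_row]])
qed

section \<open>Abelian ideals in type A\<close>

text \<open>
  The indices outside \<open>K\<close> separate the indices \<open>1, 2, \<dots>\<close> into blocks; the blocks are numbered
  from 0.
\<close>

definition block :: "nat set \<Rightarrow> nat \<Rightarrow> nat" where
  "block K i = card ({1..<i} - K)"

lemma block_mono: "i \<le> j \<Longrightarrow> block K i \<le> block K j"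
  unfolding block_def by (intro card_mono) auto

lemma block_Suc: "k \<ge> 1 \<Longrightarrow> block K (Suc k) = (if k \<in> K then block K k else Suc (block K k))"
proof -
  assume "k \<ge> 1"
  then have "{1..<Suc k} - K = (if k \<in> K then {1..<k} - K else insert k ({1..<k} - K))"
    by (auto simp: less_Suc_eq)
  then show ?thesis by (simp add: block_def)
qed

lemma block_one [simp]: "block K (Suc 0) = 0"
  by (simp add: block_def)

lemma block_strict: "1 \<le> i \<Longrightarrow> i \<le> k \<Longrightarrow> k < j \<Longrightarrow> k \<notin> K \<Longrightarrow> block K i < block K j"
  using block_Suc[of k K] block_mono[of i k K] block_mono[of "Suc k" j K] by simp

lemma block_less: "block K i < block K j \<Longrightarrow> i < j"
  using block_mono[of j i K] by (cases "i < j") auto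

lemma block_lessE:
  assumes "block K i < block K j" obtains k where "k \<notin> K" "i \<le> k" "k < j"
proof -
  have "\<not> {1..<j} - K \<subseteq> {1..<i} - K"
    using assms card_mono[of "{1..<i} - K" "{1..<j} - K"] by (auto simp: block_def)
  then obtain k where "k \<in> {1..<j} - K" "k \<notin> {1..<i} - K" by blast
  then show ?thesis by (intro that[of k]) auto
qed

lemma block_eqD: "block K i = block K j \<Longrightarrow> 1 \<le> i \<Longrightarrow> i \<le> k \<Longrightarrow> k < j \<Longrightarrow> k \<in> K"
  using block_strict[of i k j K] by auto

lemma block_surj: "x \<le> block K (Suc l) \<Longrightarrow> \<exists>i\<in>{1..Suc l}. block K i = x"
proof (induction l)
  case 0
  then show ?case by (intro bexI[of _ 1]) auto
next
  case (Suc l)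
  show ?case
  proof (cases "x \<le> block K (Suc l)")
    case True
    with Suc.IH show ?thesis by force
  next
    case False
    with Suc.prems have "x = block K (Suc (Suc l))"
      using block_Suc[of "Suc l" K] by (auto split: if_splits)
    then show ?thesis by (intro bexI[of _ "Suc (Suc l)"]) auto
  qed
qed

lemma block_total: "K \<subseteq> {1..l} \<Longrightarrow> block K (Suc l) = l - card K"
  unfolding block_def by (subst card_Diff_subset) (auto intro: finite_subset simp: atLeastLessThanSuc_atLeastAtMost)

text \<open>
  The coordinates of \<open>e\<^sub>i - e\<^sub>j = \<alpha>\<^sub>i + \<dots> + \<alpha>\<^sub>j\<^sub>-\<^sub>1\<close>.
\<close>

definition interval_coeff :: "nat \<Rightarrow> nat \<Rightarrow> nat \<Rightarrow> int" where
  "interval_coeff i j = (\<lambda>k. if i \<le> k \<and> k < j then 1 else 0)"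

lemma unit_coeff_interval: "unit_coeff m = interval_coeff m (Suc m)"
  by (auto simp: unit_coeff_def interval_coeff_def)

lemma interval_coeff_concat:
  "i \<le> j \<Longrightarrow> j \<le> k \<Longrightarrow> interval_coeff i j + interval_coeff j k = interval_coeff i k"
  by (auto simp: interval_coeff_def fun_eq_iff)

lemma interval_coeff_inj:
  assumes "interval_coeff i j = interval_coeff p q" "i < j" "p < q" shows "i = p \<and> j = q"
proof -
  have e: "i \<le> k \<and> k < j \<longleftrightarrow> p \<le> k \<and> k < q" for k
    using fun_cong[OF assms(1), of k] by (auto simp: interval_coeff_def split: if_splits)
  show ?thesis using e[of i] e[of p] e[of "j - 1"] e[of "q - 1"] assms(2,3) by linarith
qed

definition coeffs_A :: "nat \<Rightarrow> (nat \<Rightarrow> int) set" where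
  "coeffs_A l = {interval_coeff i j |i j. 1 \<le> i \<and> i < j \<and> j \<le> Suc l}"

lemma coeffs_AI: "1 \<le> i \<Longrightarrow> i < j \<Longrightarrow> j \<le> Suc l \<Longrightarrow> interval_coeff i j \<in> coeffs_A l"
  unfolding coeffs_A_def by blast

lemma coeffs_A_le_1: "c \<in> coeffs_A l \<Longrightarrow> c k \<le> 1"
  by (auto simp: coeffs_A_def interval_coeff_def)

text \<open>
  The Cartan matrix of type A is minus a discrete second derivative. At the right end the
  neighbour \<open>l + 1\<close> is missing; at the left end \<open>w 0 = 0\<close> plays the same role.
\<close>

lemma cartan_matrix_A_sum:
  assumes "w 0 = 0" "m \<in> {1..l}"
  shows "(\<Sum>i=1..l. w i * cartan_matrix_A i m) = 2 * w m - w (m - 1) - (if m < l then w (Suc m) else 0)"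
    and "(\<Sum>i=1..l. cartan_matrix_A m i * w i) = 2 * w m - w (m - 1) - (if m < l then w (Suc m) else 0)"
proof -
  have "(\<Sum>i=1..l. w i * cartan_matrix_A i m) = (\<Sum>i=1..l. 2 * (if i = m then w i else 0)
      - (if i = Suc m then w i else 0) - (if i = m - 1 then w i else 0))"
    using assms(2) by (intro sum.cong) (auto simp: cartan_matrix_A_def)
  also have "\<dots> = 2 * w m - (if m < l then w (Suc m) else 0) - w (m - 1)"
    using assms by (auto simp: sum_subtractf sum_distrib_left[symmetric])
  finally show 1: "(\<Sum>i=1..l. w i * cartan_matrix_A i m)
      = 2 * w m - w (m - 1) - (if m < l then w (Suc m) else 0)" by simp
  have "cartan_matrix_A m i = cartan_matrix_A i m" for i by (auto simp: cartan_matrix_A_def)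
  with 1 show "(\<Sum>i=1..l. cartan_matrix_A m i * w i)
      = 2 * w m - w (m - 1) - (if m < l then w (Suc m) else 0)" by (simp add: mult.commute)
qed

lemma pairing_A:
  assumes "c \<in> support_in l" "m \<in> {1..l}"
  shows "pairing l cartan_matrix_A c m = 2 * c m - c (m - 1) - c (Suc m)"
  using cartan_matrix_A_sum(1)[of c m l] assms by (auto simp: pairing_def support_in_def)

lemma coeffs_A_reflect:
  assumes ij: "1 \<le> i" "i < j" "j \<le> Suc l" and m: "m \<in> {1..l}"
    and ne: "interval_coeff i j \<noteq> unit_coeff m"
  shows "reflect l cartan_matrix_A m (interval_coeff i j) \<in> coeffs_A l"
proof -
  let ?c = "interval_coeff i j"
  have p: "pairing l cartan_matrix_A ?c m = 2 * ?c m - ?c (m - 1) - ?c (Suc m)"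
    using ij m by (intro pairing_A) (auto simp: support_in_def interval_coeff_def)
  have ne': "\<not> (m = i \<and> j = Suc i)"
    using ne unit_coeff_interval by auto
  consider "Suc m = i" | "m = i" "Suc i < j" | "m = j" | "Suc m = j" "i < m"
    | "m \<noteq> i" "m \<noteq> j" "Suc m \<noteq> i" "Suc m \<noteq> j" using ne' ij by linarith
  then show ?thesis
  proof cases
    case 1
    then have "reflect l cartan_matrix_A m ?c = interval_coeff m j"
      using ij m unfolding reflect_def p by (auto simp: interval_coeff_def fun_eq_iff)
    then show ?thesis using 1 ij m by (auto intro!: coeffs_AI)
  next
    case 2
    then have "reflect l cartan_matrix_A m ?c = interval_coeff (Suc i) j"
      using ij m unfolding reflect_def p by (auto simp: interval_coeff_def fun_eq_iff)
    then show ?thesis using 2 ij m by (auto intro!: coeffs_AI)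
  next
    case 3
    then have "reflect l cartan_matrix_A m ?c = interval_coeff i (Suc j)"
      using ij m unfolding reflect_def p by (auto simp: interval_coeff_def fun_eq_iff)
    then show ?thesis using 3 ij m by (auto intro!: coeffs_AI)
  next
    case 4
    then have "reflect l cartan_matrix_A m ?c = interval_coeff i m"
      using ij m unfolding reflect_def p by (auto simp: interval_coeff_def fun_eq_iff)
    then show ?thesis using 4 ij m by (auto intro!: coeffs_AI)
  next
    case 5
    then have "?c m = ?c (m - 1)" "?c m = ?c (Suc m)"
      using m by (auto simp: interval_coeff_def)
    then have "reflect l cartan_matrix_A m ?c = ?c"
      unfolding reflect_def p by (simp add: fun_eq_iff)
    then show ?thesis using ij by (auto intro!: coeffs_AI)
  qed
qed

lemma positive_system_A: "positive_system l cartan_matrix_A (coeffs_A l)"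
  unfolding positive_system_def
proof (intro conjI ballI impI)
  show "coeffs_A l \<subseteq> support_in l"
    by (auto simp: coeffs_A_def support_in_def interval_coeff_def)
  fix c assume "c \<in> coeffs_A l"
  then obtain i j where ij: "c = interval_coeff i j" "1 \<le> i" "i < j" "j \<le> Suc l"
    by (auto simp: coeffs_A_def)
  then show "\<forall>i. 0 \<le> c i" by (simp add: interval_coeff_def)
  have "c i = 1" using ij by (simp add: interval_coeff_def)
  then show "c \<noteq> (\<lambda>_. 0)" by auto
  show "reflect l cartan_matrix_A m c \<in> coeffs_A l" if "m \<in> {1..l}" "c \<noteq> unit_coeff m" for m
    using coeffs_A_reflect ij that by blast
next
  fix m assume "m \<in> {1..l}"
  then show "unit_coeff m \<in> coeffs_A l" by (auto simp: unit_coeff_interval intro!: coeffs_AI)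
qed

text \<open>
  The numbers \<open>j (l + 1 - j)\<close> are the coefficients of the sum of all positive coroots. They vanish
  at 0 and at \<open>l + 1\<close>, and their second difference is the constant \<open>-2\<close>.
\<close>

lemma positive_weight_A:
  assumes "i \<in> {1..l}"
  shows "(\<Sum>j=1..l. cartan_matrix_A i j * (int j * (int l + 1 - int j))) > 0"
proof -
  let ?w = "\<lambda>j. int j * (int l + 1 - int j)"
  obtain k where k: "i = Suc k" using assms by (cases i) auto
  have "(\<Sum>j=1..l. cartan_matrix_A i j * ?w j) = 2 * ?w i - ?w (i - 1) - (if i < l then ?w (Suc i) else 0)"
    by (rule cartan_matrix_A_sum(2)) (use assms in auto)
  also have "\<dots> = 2 * ?w (Suc k) - ?w k - ?w (Suc (Suc k))" using assms k by auto
  also have "\<dots> = 2" by (simp add: algebra_simps)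
  finally show ?thesis by simp
qed

text \<open>
  Columns are counted from the last block backwards, because ideals are closed under lowering \<open>i\<close>
  and raising \<open>j\<close> in \<open>e\<^sub>i - e\<^sub>j\<close>.
\<close>

definition ideal_of_diagram_A :: "nat \<Rightarrow> nat set \<Rightarrow> (nat \<times> nat) set \<Rightarrow> (nat \<Rightarrow> int) set" where
  "ideal_of_diagram_A l K D = {interval_coeff i j |i j. 1 \<le> i \<and> i < j \<and> j \<le> Suc l \<and>
     (block K i, block K (Suc l) - block K j) \<in> D}"

text \<open>
  Adding a positive root or a root of \<open>\<Delta>\<^sub>I\<close> to \<open>c\<close> does not lower the coordinates outside \<open>K\<close>, so
  the interval of the sum covers that of \<open>c\<close> up to a change inside the outermost blocks. Two roots of
  the ideal never add up to a root because their intervals overlap, which gives the coordinate 2.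
\<close>

lemma ideal_of_diagram_A_ideal:
  assumes D: "D \<in> corner_diagrams (block K (Suc l))"
  shows "ideal_of_diagram_A l K D \<in> coeff_ideals (coeffs_A l) K"
proof (rule coeff_idealsI)
  let ?b = "block K" and ?m = "block K (Suc l)" and ?F = "ideal_of_diagram_A l K D"
  have F: "\<exists>i j. c = interval_coeff i j \<and> 1 \<le> i \<and> i < j \<and> j \<le> Suc l \<and> ?b j \<le> ?m \<and>
      ?b i < ?b j \<and> (?b i, ?m - ?b j) \<in> D" if c: "c \<in> ?F" for c
  proof -
    obtain i j where ij: "c = interval_coeff i j" "1 \<le> i" "i < j" "j \<le> Suc l" "(?b i, ?m - ?b j) \<in> D"
      using c unfolding ideal_of_diagram_A_def by blast
    moreover have "?b j \<le> ?m" by (rule block_mono[OF ij(4)])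
    moreover have "?b i + (?m - ?b j) < ?m" by (rule corner_diagramsD(2)[OF D ij(5) ij(5)])
    ultimately show ?thesis by (intro exI[of _ i] exI[of _ j]) simp
  qed
  show "?F \<subseteq> coeffs_A l" unfolding ideal_of_diagram_A_def coeffs_A_def by blast
  {
    fix c assume "c \<in> ?F"
    then obtain i j where ij: "c = interval_coeff i j" "?b i < ?b j" using F by blast
    from ij(2) obtain k where "k \<notin> K" "i \<le> k" "k < j" by (rule block_lessE)
    then show "\<exists>k. k \<notin> K \<and> c k \<noteq> 0" using ij by (intro exI[of _ k]) (simp add: interval_coeff_def)
  next
    fix c d assume c: "c \<in> ?F"
      and d: "d \<in> coeffs_A l \<or> (- d \<in> coeffs_A l \<and> (\<forall>k. k \<notin> K \<longrightarrow> d k = 0))"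
      and cd: "c + d \<in> coeffs_A l"
    obtain i j where ij: "c = interval_coeff i j" "1 \<le> i" "i < j" "j \<le> Suc l" "?b j \<le> ?m"
      "?b i < ?b j" "(?b i, ?m - ?b j) \<in> D" using F[OF c] by blast
    obtain p q where pq: "c + d = interval_coeff p q" "1 \<le> p" "p < q" "q \<le> Suc l"
      using cd by (auto simp: coeffs_A_def)
    have ge: "c k \<le> (c + d) k" if "k \<notin> K" for k
      using d
    proof
      assume "d \<in> coeffs_A l"
      then show ?thesis by (auto simp: coeffs_A_def interval_coeff_def)
    qed (use that in simp)
    have inside: "p \<le> k \<and> k < q" if "k \<notin> K" "i \<le> k" "k < j" for k
      using ge[OF that(1)] that(2,3) unfolding pq(1) unfolding ij(1)
      by (auto simp: interval_coeff_def split: if_splits)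
    have "?b p \<le> ?b i"
    proof (rule ccontr)
      assume "\<not> ?b p \<le> ?b i"
      then have "?b i < ?b (min p j)" using ij(6) by (simp add: min_def)
      then obtain k where "k \<notin> K" "i \<le> k" "k < min p j" by (rule block_lessE)
      with inside[of k] show False by simp
    qed
    moreover have "?b j \<le> ?b q"
    proof (rule ccontr)
      assume "\<not> ?b j \<le> ?b q"
      then have "?b (max q i) < ?b j" using ij(6) by (simp add: max_def)
      then obtain k where "k \<notin> K" "max q i \<le> k" "k < j" by (rule block_lessE)
      with inside[of k] show False by simp
    qed
    ultimately have "(?b p, ?m - ?b q) \<in> D"
      using corner_diagramsD(1)[OF D ij(7)] by simp
    then show "c + d \<in> ?F" unfolding pq(1) ideal_of_diagram_A_def using pq(2-4) by blast
  next
    fix c d assume c: "c \<in> ?F" and d: "d \<in> ?F"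
    obtain i j where ij: "c = interval_coeff i j" "?b j \<le> ?m" "?b i < ?b j" "(?b i, ?m - ?b j) \<in> D"
      using F[OF c] by blast
    obtain p q where pq: "d = interval_coeff p q" "?b q \<le> ?m" "?b p < ?b q" "(?b p, ?m - ?b q) \<in> D"
      using F[OF d] by blast
    have "?b i < ?b q" "?b p < ?b j"
      using corner_diagramsD(2)[OF D ij(4) pq(4)] corner_diagramsD(2)[OF D pq(4) ij(4)] ij(2) pq(2)
      by linarith+
    then have "i < q" "p < j" "i < j" "p < q" using ij(3) pq(3) block_less by blast+
    \<comment> \<open>both intervals contain the larger of their left endpoints\<close>
    then have "(c + d) (max i p) = 2" by (simp add: ij(1) pq(1) interval_coeff_def)
    then show "c + d \<notin> coeffs_A l" using coeffs_A_le_1[of "c + d" l "max i p"] by force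
  }
qed

text \<open>
  The endpoints are moved one after the other: outwards by adding a positive root, inwards (then
  within a block) by subtracting a root of \<open>\<Delta>\<^sub>I\<close>.
\<close>

lemma coeff_ideal_A_closed:
  assumes F: "F \<in> coeff_ideals (coeffs_A l) K" and ij: "interval_coeff i j \<in> F" "1 \<le> i" "i < j" "j \<le> Suc l"
    and p: "1 \<le> p" "block K p \<le> block K i" and q: "q \<le> Suc l" "block K j \<le> block K q"
  shows "p < q \<and> interval_coeff p q \<in> F"
proof -
  note f = coeff_idealsD[OF F]
  obtain k where "k \<notin> K" "interval_coeff i j k \<noteq> 0" using f(2)[OF ij(1)] by blast
  then have "block K i < block K j"
    using ij(2) by (intro block_strict[of i k]) (auto simp: interval_coeff_def split: if_splits)
  then have pj: "p < j" and pq: "p < q" using p q block_less[of K p j] block_less[of K p q] by linarith+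
  have pF: "interval_coeff p j \<in> F"
  proof (cases "p < i")
    case True
    have e: "interval_coeff i j + interval_coeff p i = interval_coeff p j"
      using interval_coeff_concat[of p i j] True ij(3) by (simp add: add.commute)
    have "interval_coeff i j + interval_coeff p i \<in> F"
      by (rule f(3)[OF ij(1)]) (use e p True ij pj in \<open>auto intro: coeffs_AI\<close>)
    with e show ?thesis by simp
  next
    case False
    show ?thesis
    proof (cases "p = i")
      case True
      with ij show ?thesis by simp
    next
      case ne: False
      with False have ip: "i < p" by simp
      then have bl: "block K i = block K p" using p block_mono[of i p K] by simp
      have e: "interval_coeff i j + - interval_coeff i p = interval_coeff p j"
        using interval_coeff_concat[of i p j] ip pj by (metis add_diff_cancel_left' uminus_add_conv_diff add.commute less_imp_le)
      have "interval_coeff i j + - interval_coeff i p \<in> F"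
      proof (rule f(3)[OF ij(1) disjI2])
        have "interval_coeff i p \<in> coeffs_A l" using ij ip pj by (intro coeffs_AI) auto
        moreover have "interval_coeff i p k = 0" if "k \<notin> K" for k
          using block_eqD[OF bl ij(2)] that by (auto simp: interval_coeff_def)
        ultimately show "- (- interval_coeff i p) \<in> coeffs_A l \<and> (\<forall>k. k \<notin> K \<longrightarrow> (- interval_coeff i p) k = 0)"
          by simp
        show "interval_coeff i j + - interval_coeff i p \<in> coeffs_A l"
          unfolding e using p pj ij by (intro coeffs_AI) auto
      qed
      with e show ?thesis by simp
    qed
  qed
  have "interval_coeff p q \<in> F"
  proof (cases "j < q")
    case True
    have e: "interval_coeff p j + interval_coeff j q = interval_coeff p q"
      using interval_coeff_concat[of p j q] True pj by simp
    have "interval_coeff p j + interval_coeff j q \<in> F"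
      by (rule f(3)[OF pF]) (use e p q True ij pq in \<open>auto intro: coeffs_AI\<close>)
    with e show ?thesis by simp
  next
    case False
    show ?thesis
    proof (cases "j = q")
      case True
      with pF show ?thesis by simp
    next
      case ne: False
      with False have qj: "q < j" by simp
      then have bl: "block K q = block K j" using q block_mono[of q j K] by simp
      have e: "interval_coeff p j + - interval_coeff q j = interval_coeff p q"
        using interval_coeff_concat[of p q j] qj pq by (metis add_diff_cancel_right' uminus_add_conv_diff add.commute less_imp_le)
      have "interval_coeff p j + - interval_coeff q j \<in> F"
      proof (rule f(3)[OF pF disjI2])
        have "interval_coeff q j \<in> coeffs_A l" using ij qj pq p by (intro coeffs_AI) auto
        moreover have "interval_coeff q j k = 0" if "k \<notin> K" for k
          using block_eqD[OF bl] p pq that by (auto simp: interval_coeff_def)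
        ultimately show "- (- interval_coeff q j) \<in> coeffs_A l \<and> (\<forall>k. k \<notin> K \<longrightarrow> (- interval_coeff q j) k = 0)"
          by simp
        show "interval_coeff p j + - interval_coeff q j \<in> coeffs_A l"
          unfolding e using p pq q by (intro coeffs_AI) auto
      qed
      with e show ?thesis by simp
    qed
  qed
  with pq show ?thesis by blast
qed

text \<open>
  The bound on the diagram expresses commutativity: if the block of \<open>q\<close> did not lie strictly
  after that of \<open>i\<close>, then \<open>e\<^sub>p - e\<^sub>q\<close> in the ideal would force \<open>e\<^sub>p - e\<^sub>i\<close> in the ideal, which can be added to
  \<open>e\<^sub>i - e\<^sub>j\<close>.
\<close>

lemma coeff_ideal_A_from_diagram:
  assumes F: "F \<in> coeff_ideals (coeffs_A l) K"
  shows "F \<in> ideal_of_diagram_A l K ` corner_diagrams (block K (Suc l))"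
proof -
  let ?b = "block K" and ?m = "block K (Suc l)"
  note f = coeff_idealsD[OF F] and cl = coeff_ideal_A_closed[OF F]
  define D where "D = {(x, v). \<exists>i j. 1 \<le> i \<and> i < j \<and> j \<le> Suc l \<and> interval_coeff i j \<in> F \<and>
    x = ?b i \<and> v = ?m - ?b j}"
  have DI: "(?b i, ?m - ?b j) \<in> D" if "1 \<le> i" "i < j" "j \<le> Suc l" "interval_coeff i j \<in> F" for i j
    unfolding D_def using that by blast
  have DE: "\<exists>i j. 1 \<le> i \<and> i < j \<and> j \<le> Suc l \<and> interval_coeff i j \<in> F \<and> x = ?b i \<and> v = ?m - ?b j"
    if "(x, v) \<in> D" for x v using that unfolding D_def by blast
  have "D \<in> corner_diagrams ?m"
  proof (rule corner_diagramsI)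
    fix x v x' v' assume xv: "(x, v) \<in> D" and le: "x' \<le> x" "v' \<le> v"
    obtain i j where ij: "1 \<le> i" "i < j" "j \<le> Suc l" "interval_coeff i j \<in> F" "x = ?b i" "v = ?m - ?b j"
      using DE[OF xv] by blast
    have "x' \<le> ?m" using le ij block_mono[of i "Suc l" K] by simp
    then obtain p where p: "p \<in> {1..Suc l}" "?b p = x'" using block_surj by blast
    obtain q where q: "q \<in> {1..Suc l}" "?b q = ?m - v'" using block_surj[of "?m - v'"] by force
    have bj: "?b j \<le> ?m" by (rule block_mono[OF ij(3)])
    have pq: "p < q \<and> interval_coeff p q \<in> F"
      by (rule cl[OF ij(4,1,2,3)]) (use p q le ij bj in auto)
    have "v' = ?m - ?b q" using q le ij by simp
    then show "(x', v') \<in> D" using DI[of p q] p q pq by simp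
  next
    fix x v x' v' assume "(x, v) \<in> D" "(x', v') \<in> D"
    then obtain i j p q where ij: "1 \<le> i" "i < j" "j \<le> Suc l" "interval_coeff i j \<in> F" "x = ?b i"
      and pq: "1 \<le> p" "p < q" "q \<le> Suc l" "interval_coeff p q \<in> F" "v' = ?m - ?b q"
      using DE by meson
    have "?b i < ?b q"
    proof (rule ccontr)
      assume "\<not> ?b i < ?b q"
      then have "p < i \<and> interval_coeff p i \<in> F"
        using pq ij by (intro cl[OF pq(4,1-3)]) auto
      then have pi: "p < i" "interval_coeff p i \<in> F" by auto
      then have "interval_coeff p i + interval_coeff i j = interval_coeff p j"
        using ij by (intro interval_coeff_concat) auto
      then have "interval_coeff p i + interval_coeff i j \<in> coeffs_A l"
        using pi ij pq by (auto intro: coeffs_AI)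
      with f(4)[OF pi(2) ij(4)] show False by blast
    qed
    then show "x + v' < ?m" using ij pq block_mono[of q "Suc l" K] by simp
  qed
  moreover have "F = ideal_of_diagram_A l K D"
  proof (intro subset_antisym subsetI)
    fix c assume c: "c \<in> F"
    then obtain i j where ij: "c = interval_coeff i j" "1 \<le> i" "i < j" "j \<le> Suc l"
      using f(1) by (auto simp: coeffs_A_def)
    with c DI[of i j] show "c \<in> ideal_of_diagram_A l K D" unfolding ideal_of_diagram_A_def by blast
  next
    fix c assume "c \<in> ideal_of_diagram_A l K D"
    then obtain i j where ij: "c = interval_coeff i j" "1 \<le> i" "i < j" "j \<le> Suc l" "(?b i, ?m - ?b j) \<in> D"
      unfolding ideal_of_diagram_A_def by blast
    obtain p q where pq: "1 \<le> p" "p < q" "q \<le> Suc l" "interval_coeff p q \<in> F" "?b i = ?b p"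
      "?m - ?b j = ?m - ?b q" using DE[OF ij(5)] by blast
    have "?b j \<le> ?m" "?b q \<le> ?m" using block_mono ij(4) pq(3) by blast+
    then have "?b q = ?b j" using pq(6) by linarith
    then show "c \<in> F" using cl[OF pq(4,1-3), of i j] ij pq(5) by simp
  qed
  ultimately show ?thesis by blast
qed

lemma ideal_of_diagram_A_inj:
  "inj_on (ideal_of_diagram_A l K) (corner_diagrams (block K (Suc l)))"
proof -
  let ?b = "block K" and ?m = "block K (Suc l)"
  have "D \<subseteq> E" if D: "D \<in> corner_diagrams ?m"
    and e: "ideal_of_diagram_A l K D \<subseteq> ideal_of_diagram_A l K E" for D E
  proof
    fix xv assume "xv \<in> D"
    moreover obtain x v where xv: "xv = (x, v)" by fastforce
    ultimately have d: "(x, v) \<in> D" by simp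
    have lt: "x + v < ?m" by (rule corner_diagramsD(2)[OF D d d])
    obtain i where i: "i \<in> {1..Suc l}" "?b i = x" using block_surj[of x K l] lt by auto
    obtain j where j: "j \<in> {1..Suc l}" "?b j = ?m - v" using block_surj[of "?m - v" K l] by auto
    have ij: "i < j" using block_less[of K i j] i j lt by simp
    have vj: "v = ?m - ?b j" using j lt by simp
    then have "interval_coeff i j \<in> ideal_of_diagram_A l K D"
      using d[folded i(2), unfolded vj] i(1) ij j(1) unfolding ideal_of_diagram_A_def atLeastAtMost_iff by blast
    then have "interval_coeff i j \<in> ideal_of_diagram_A l K E" using e by blast
    then obtain p q where pq: "interval_coeff i j = interval_coeff p q" "p < q" "(?b p, ?m - ?b q) \<in> E"
      unfolding ideal_of_diagram_A_def by blast
    have "i = p \<and> j = q" by (rule interval_coeff_inj[OF pq(1) ij pq(2)])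
    with pq(3) have "(?b i, ?m - ?b j) \<in> E" by simp
    then show "xv \<in> E" using i(2) vj xv by (simp only:)
  qed
  then show ?thesis by (intro inj_onI subset_antisym) auto
qed

lemma card_coeff_ideals_A:
  assumes "K \<subseteq> {1..l}" shows "card (coeff_ideals (coeffs_A l) K) = 2 ^ (l - card K)"
proof -
  have "coeff_ideals (coeffs_A l) K = ideal_of_diagram_A l K ` corner_diagrams (block K (Suc l))"
    using ideal_of_diagram_A_ideal coeff_ideal_A_from_diagram by blast
  then show ?thesis
    using card_image[OF ideal_of_diagram_A_inj, of l K] card_corner_diagrams block_total[OF assms] by simp
qed

section \<open>Abelian ideals in type C\<close>

text \<open>
  The coordinates of \<open>e\<^sub>i + e\<^sub>j = (e\<^sub>i - e\<^sub>l) + (e\<^sub>j - e\<^sub>l) + \<alpha>\<^sub>l\<close> for \<open>i, j \<le> l\<close>, with \<open>\<alpha>\<^sub>l = 2 e\<^sub>l\<close>. The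
  first interval includes \<open>\<alpha>\<^sub>l\<close>.
\<close>

definition sum_coeff :: "nat \<Rightarrow> nat \<Rightarrow> nat \<Rightarrow> nat \<Rightarrow> int" where
  "sum_coeff l i j = interval_coeff i (Suc l) + interval_coeff j l"

definition coeffs_C :: "nat \<Rightarrow> (nat \<Rightarrow> int) set" where
  "coeffs_C l = {interval_coeff i j |i j. 1 \<le> i \<and> i < j \<and> j \<le> l} \<union>
     {sum_coeff l i j |i j. 1 \<le> i \<and> i \<le> j \<and> j \<le> l}"

lemma sum_coeff_commute: "i \<le> l \<Longrightarrow> j \<le> l \<Longrightarrow> sum_coeff l i j = sum_coeff l j i"
  by (auto simp: sum_coeff_def interval_coeff_def fun_eq_iff)

lemma coeffs_C_diff: "1 \<le> i \<Longrightarrow> i < j \<Longrightarrow> j \<le> l \<Longrightarrow> interval_coeff i j \<in> coeffs_C l"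
  unfolding coeffs_C_def by blast

lemma coeffs_C_sum:
  assumes "1 \<le> i" "i \<le> l" "1 \<le> j" "j \<le> l" shows "sum_coeff l i j \<in> coeffs_C l"
proof (cases "i \<le> j")
  case True
  with assms show ?thesis unfolding coeffs_C_def by blast
next
  case False
  then have "j \<le> i" by simp
  with assms have "sum_coeff l j i \<in> coeffs_C l" unfolding coeffs_C_def by blast
  then show ?thesis using sum_coeff_commute[of i l j] assms by simp
qed

lemma coeffs_C_cases:
  assumes "c \<in> coeffs_C l"
  obtains (diff) i j where "c = interval_coeff i j" "1 \<le> i" "i < j" "j \<le> l"
    | (sum) i j where "c = sum_coeff l i j" "1 \<le> i" "i \<le> j" "j \<le> l"
  using assms unfolding coeffs_C_def by blast

lemma sum_coeff_apply:
  "sum_coeff l i j k = (if i \<le> k \<and> k \<le> l then 1 else 0) + (if j \<le> k \<and> k < l then 1 else 0)"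
  by (simp add: sum_coeff_def interval_coeff_def less_Suc_eq_le)

lemma cartan_matrix_C_eq:
  "cartan_matrix_C l i j = cartan_matrix_A i j - (if i = l \<and> l = Suc j then 1 else 0)"
  by (auto simp: cartan_matrix_C_def cartan_matrix_A_def)

lemma pairing_C:
  assumes "c \<in> support_in l" "m \<in> {1..l}"
  shows "pairing l (cartan_matrix_C l) c m
    = 2 * c m - c (m - 1) - c (Suc m) - (if l = Suc m then c l else 0)"
proof -
  have "pairing l (cartan_matrix_C l) c m
    = (\<Sum>i=1..l. c i * cartan_matrix_A i m - (if i = l then (if l = Suc m then c l else 0) else 0))"
    unfolding pairing_def by (rule sum.cong) (auto simp: cartan_matrix_C_eq algebra_simps)
  also have "\<dots> = pairing l cartan_matrix_A c m - (if l = Suc m then c l else 0)"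
    using assms(2) by (simp add: sum_subtractf pairing_def)
  finally show ?thesis using pairing_A[OF assms] by simp
qed

lemma coeffs_C_reflect_diff:
  assumes ij: "1 \<le> i" "i < j" "j \<le> l" and m: "m \<in> {1..l}"
    and ne: "interval_coeff i j \<noteq> unit_coeff m"
  shows "reflect l (cartan_matrix_C l) m (interval_coeff i j) \<in> coeffs_C l"
proof -
  let ?c = "interval_coeff i j" and ?A = "cartan_matrix_C l"
  have "?c l = 0" using ij by (simp add: interval_coeff_def)
  moreover have "pairing l ?A ?c m = 2 * ?c m - ?c (m - 1) - ?c (Suc m) - (if l = Suc m then ?c l else 0)"
    using ij m by (intro pairing_C) (auto simp: support_in_def interval_coeff_def)
  ultimately have p: "pairing l ?A ?c m = 2 * ?c m - ?c (m - 1) - ?c (Suc m)"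
    by (cases "l = Suc m") simp_all
  have ne': "\<not> (m = i \<and> j = Suc i)"
    using ne unit_coeff_interval by auto
  consider "Suc m = i" | "m = i" "Suc i < j" | "m = j" "j < l" | "m = j" "j = l" | "Suc m = j" "i < m"
    | "m \<noteq> i" "m \<noteq> j" "Suc m \<noteq> i" "Suc m \<noteq> j" using ne' ij by linarith
  then show ?thesis
  proof cases
    case 1
    then have "reflect l ?A m ?c = interval_coeff m j"
      using ij m unfolding reflect_def p by (auto simp: interval_coeff_def fun_eq_iff)
    then show ?thesis using 1 ij m by (auto intro!: coeffs_C_diff)
  next
    case 2
    then have "reflect l ?A m ?c = interval_coeff (Suc i) j"
      using ij m unfolding reflect_def p by (auto simp: interval_coeff_def fun_eq_iff)
    then show ?thesis using 2 ij m by (auto intro!: coeffs_C_diff)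
  next
    case 3
    then have "reflect l ?A m ?c = interval_coeff i (Suc j)"
      using ij m unfolding reflect_def p by (auto simp: interval_coeff_def fun_eq_iff)
    then show ?thesis using 3 ij m by (auto intro!: coeffs_C_diff)
  next
    case 4
    then have "reflect l ?A m ?c = sum_coeff l i l"
      using ij m unfolding reflect_def p by (auto simp: interval_coeff_def sum_coeff_apply fun_eq_iff)
    then show ?thesis using 4 ij m by (auto intro!: coeffs_C_sum)
  next
    case 5
    then have "reflect l ?A m ?c = interval_coeff i m"
      using ij m unfolding reflect_def p by (auto simp: interval_coeff_def fun_eq_iff)
    then show ?thesis using 5 ij m by (auto intro!: coeffs_C_diff)
  next
    case 6
    then have "?c m = ?c (m - 1)" "?c m = ?c (Suc m)"
      using m by (auto simp: interval_coeff_def)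
    then have "reflect l ?A m ?c = ?c"
      unfolding reflect_def p by (simp add: fun_eq_iff)
    then show ?thesis using ij by (auto intro!: coeffs_C_diff)
  qed
qed

text \<open>
  For \<open>m < l\<close> the reflection exchanges \<open>e\<^sub>m\<close> and \<open>e\<^sub>m\<^sub>+\<^sub>1\<close>, for \<open>m = l\<close> it changes the sign of \<open>e\<^sub>l\<close>.
\<close>

lemma coeffs_C_reflect_sum:
  assumes ij: "1 \<le> i" "i \<le> j" "j \<le> l" and m: "m \<in> {1..l}"
    and ne: "sum_coeff l i j \<noteq> unit_coeff m"
  shows "reflect l (cartan_matrix_C l) m (sum_coeff l i j) \<in> coeffs_C l"
proof -
  let ?c = "sum_coeff l i j" and ?A = "cartan_matrix_C l"
  have p: "pairing l ?A ?c m = 2 * ?c m - ?c (m - 1) - ?c (Suc m) - (if l = Suc m then ?c l else 0)"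
    using ij m by (intro pairing_C) (auto simp: support_in_def sum_coeff_apply)
  show ?thesis
  proof (cases "m = l")
    case True
    have "sum_coeff l l l = unit_coeff l" by (auto simp: sum_coeff_apply unit_coeff_def fun_eq_iff)
    then have il: "i < l" using ij ne True by (cases "i = l") auto
    show ?thesis
    proof (cases "j = l")
      case True
      then have "reflect l ?A m ?c = interval_coeff i l"
        using ij m il \<open>m = l\<close> unfolding reflect_def p
        by (auto simp: interval_coeff_def sum_coeff_apply fun_eq_iff)
      then show ?thesis using ij il by (auto intro!: coeffs_C_diff)
    next
      case False
      then have "reflect l ?A m ?c = ?c"
        using ij m il \<open>m = l\<close> unfolding reflect_def p by (auto simp: sum_coeff_apply fun_eq_iff)
      then show ?thesis using ij by (auto intro!: coeffs_C_sum)
    qed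
  next
    case False
    then have ml: "m < l" using m by simp
    \<comment> \<open>the transposition of \<open>m\<close> and \<open>m + 1\<close>, acting on the indices of the \<open>e\<^sub>i\<close>\<close>
    let ?s = "\<lambda>k. if k = m then Suc m else if k = Suc m then m else k"
    have val: "?c m - pairing l ?A ?c m = sum_coeff l (?s i) (?s j) m"
      using ij m ml unfolding p by (auto simp: sum_coeff_apply)
    have "reflect l ?A m ?c = sum_coeff l (?s i) (?s j)"
    proof
      fix k
      show "reflect l ?A m ?c k = sum_coeff l (?s i) (?s j) k"
      proof (cases "k = m")
        case True
        then show ?thesis using val by (simp add: reflect_def)
      next
        case False
        then show ?thesis by (auto simp: reflect_def sum_coeff_apply)
      qed
    qed
    then show ?thesis using ij m ml by (auto intro!: coeffs_C_sum)
  qed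
qed

lemma positive_system_C: "positive_system l (cartan_matrix_C l) (coeffs_C l)"
  unfolding positive_system_def
proof (intro conjI ballI impI)
  show "coeffs_C l \<subseteq> support_in l"
    by (auto simp: coeffs_C_def support_in_def interval_coeff_def sum_coeff_apply)
  fix c assume c: "c \<in> coeffs_C l"
  then show "\<forall>i. 0 \<le> c i"
    by (cases rule: coeffs_C_cases) (simp_all add: interval_coeff_def sum_coeff_apply)
  show "c \<noteq> (\<lambda>_. 0)"
    using c
  proof (cases rule: coeffs_C_cases)
    case (diff i j)
    then have "c i = 1" by (simp add: interval_coeff_def)
    then show ?thesis by auto
  next
    case (sum i j)
    then have "c l = 1" by (simp add: sum_coeff_apply)
    then show ?thesis by auto
  qed
  show "reflect l (cartan_matrix_C l) m c \<in> coeffs_C l" if "m \<in> {1..l}" "c \<noteq> unit_coeff m" for m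
    using c
  proof (cases rule: coeffs_C_cases)
    case (diff i j)
    with that coeffs_C_reflect_diff[of i j l m] show ?thesis by simp
  next
    case (sum i j)
    with that coeffs_C_reflect_sum[of i j l m] show ?thesis by simp
  qed
next
  fix m assume m: "m \<in> {1..l}"
  show "unit_coeff m \<in> coeffs_C l"
  proof (cases "m = l")
    case True
    then have "unit_coeff m = sum_coeff l l l" by (auto simp: sum_coeff_apply unit_coeff_def fun_eq_iff)
    then show ?thesis using m True by (auto intro!: coeffs_C_sum)
  next
    case False
    then show ?thesis using m by (auto simp: unit_coeff_interval intro!: coeffs_C_diff)
  qed
qed

text \<open>
  Outside the last row the sum is a second difference as in type A. In the last row it is
  \<open>2 (w\<^sub>l - w\<^sub>l\<^sub>-\<^sub>1)\<close>, which is positive because \<open>w\<^sub>j = j (2 l + 1 - j)\<close> increases up to \<open>j = l\<close>.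
\<close>

lemma positive_weight_C:
  assumes "i \<in> {1..l}" "l \<ge> 2"
  shows "(\<Sum>j=1..l. cartan_matrix_C l i j * (int j * (2 * int l + 1 - int j))) > 0"
proof -
  let ?w = "\<lambda>j. int j * (2 * int l + 1 - int j)"
  obtain k where k: "i = Suc k" using assms by (cases i) auto
  have "(\<Sum>j=1..l. cartan_matrix_C l i j * w j)
      = (\<Sum>j=1..l. cartan_matrix_A i j * w j) - (if i = l then w (l - 1) else 0)" for w :: "nat \<Rightarrow> int"
  proof -
    have "(\<Sum>j=1..l. cartan_matrix_C l i j * w j) = (\<Sum>j=1..l. cartan_matrix_A i j * w j
        - (if j = l - 1 then (if i = l then w (l - 1) else 0) else 0))"
      by (rule sum.cong) (auto simp: cartan_matrix_C_eq left_diff_distrib)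
    then show ?thesis using assms(2) by (auto simp: sum_subtractf)
  qed
  then have "(\<Sum>j=1..l. cartan_matrix_C l i j * ?w j)
      = (\<Sum>j=1..l. cartan_matrix_A i j * ?w j) - (if i = l then ?w (l - 1) else 0)" .
  also have "(\<Sum>j=1..l. cartan_matrix_A i j * ?w j) = 2 * ?w i - ?w (i - 1) - (if i < l then ?w (Suc i) else 0)"
    by (rule cartan_matrix_A_sum(2)) (use assms in auto)
  also have "\<dots> - (if i = l then ?w (l - 1) else 0) = (if i = l then 4 else 2)"
  proof (cases "i = l")
    case True
    then have "l = Suc k" using k by simp
    then show ?thesis unfolding True by (simp add: algebra_simps)
  next
    case False
    then show ?thesis using assms k by (auto simp: algebra_simps)
  qed
  finally show ?thesis by (simp split: if_splits)
qed

definition ideal_of_diagram_C :: "nat \<Rightarrow> nat set \<Rightarrow> (nat \<times> nat) set \<Rightarrow> (nat \<Rightarrow> int) set" where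
  "ideal_of_diagram_C l K D = {sum_coeff l i j |i j. 1 \<le> i \<and> i \<le> j \<and> j \<le> l \<and>
     (block K i, block K j) \<in> D}"

lemma coeffs_C_at_l: "c \<in> coeffs_C l \<Longrightarrow> c l \<le> 1"
  by (auto elim!: coeffs_C_cases simp: interval_coeff_def sum_coeff_apply)

lemma coeffs_C_nonneg: "c \<in> coeffs_C l \<Longrightarrow> 0 \<le> c k"
  using positive_system_C[of l] unfolding positive_system_def by blast

text \<open>
  A root of the ideal has a positive coordinate outside \<open>K\<close> at or after \<open>j\<close>, where it equals 2 or
  belongs to \<open>\<alpha>\<^sub>l\<close>. This persists in every sum \<open>c + d\<close> that is a root, so the sum is again of the form
  \<open>e\<^sub>p + e\<^sub>q\<close>. Commutativity is seen on the coordinate of \<open>\<alpha>\<^sub>l\<close>, which is 1 on the ideal and at most 1 on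
  all roots.
\<close>

lemma ideal_of_diagram_C_ideal:
  assumes D: "D \<in> shifted_diagrams (block K (Suc l))"
  shows "ideal_of_diagram_C l K D \<in> coeff_ideals (coeffs_C l) K"
proof (rule coeff_idealsI)
  let ?b = "block K" and ?F = "ideal_of_diagram_C l K D"
  have F: "\<exists>i j. c = sum_coeff l i j \<and> 1 \<le> i \<and> i \<le> j \<and> j \<le> l \<and> ?b j < ?b (Suc l) \<and>
      (?b i, ?b j) \<in> D" if c: "c \<in> ?F" for c
  proof -
    obtain i j where ij: "c = sum_coeff l i j" "1 \<le> i" "i \<le> j" "j \<le> l" "(?b i, ?b j) \<in> D"
      using c unfolding ideal_of_diagram_C_def by blast
    moreover have "?b j < ?b (Suc l)" by (rule shifted_diagramsD(2)[OF D ij(5)])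
    ultimately show ?thesis by blast
  qed
  show "?F \<subseteq> coeffs_C l" unfolding ideal_of_diagram_C_def coeffs_C_def by blast
  {
    fix c assume "c \<in> ?F"
    then obtain i j where ij: "c = sum_coeff l i j" "1 \<le> i" "i \<le> j" "j \<le> l" "?b j < ?b (Suc l)"
      using F by blast
    from ij(5) obtain k where "k \<notin> K" "j \<le> k" "k < Suc l" by (rule block_lessE)
    then show "\<exists>k. k \<notin> K \<and> c k \<noteq> 0" using ij by (intro exI[of _ k]) (simp add: sum_coeff_apply)
  next
    fix c d assume c: "c \<in> ?F"
      and d: "d \<in> coeffs_C l \<or> (- d \<in> coeffs_C l \<and> (\<forall>k. k \<notin> K \<longrightarrow> d k = 0))"
      and cd: "c + d \<in> coeffs_C l"
    obtain i j where ij: "c = sum_coeff l i j" "1 \<le> i" "i \<le> j" "j \<le> l" "?b j < ?b (Suc l)"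
      "(?b i, ?b j) \<in> D" using F[OF c] by blast
    define e where "e = c + d"
    have eC: "e \<in> coeffs_C l" using cd by (simp add: e_def)
    have ge: "sum_coeff l i j k \<le> e k" if "k \<notin> K" for k
    proof -
      have "0 \<le> d k" using d coeffs_C_nonneg that by auto
      then show ?thesis by (simp add: e_def ij(1))
    qed
    obtain k where k: "k \<notin> K" "j \<le> k" "k < Suc l" using ij(5) by (rule block_lessE)
    have "e \<in> ?F"
      using eC
    proof (cases rule: coeffs_C_cases)
      case (diff p q)
      then have False using ge[OF k(1)] k(2,3) ij
        by (auto simp: sum_coeff_apply interval_coeff_def split: if_splits)
      then show ?thesis ..
    next
      case (sum p q)
      note ge' = ge[unfolded sum(1)]
      have "?b p \<le> ?b i"
      proof (rule ccontr)
        assume "\<not> ?b p \<le> ?b i"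
        then have "?b i < ?b p" by simp
        then obtain k where "k \<notin> K" "i \<le> k" "k < p" by (rule block_lessE)
        with ge'[of k] sum show False by (auto simp: sum_coeff_apply split: if_splits)
      qed
      moreover have "?b q \<le> ?b j"
      proof (rule ccontr)
        assume "\<not> ?b q \<le> ?b j"
        then have "?b j < ?b q" by simp
        then obtain k where "k \<notin> K" "j \<le> k" "k < q" by (rule block_lessE)
        with ge'[of k] sum ij(3) show False by (auto simp: sum_coeff_apply split: if_splits)
      qed
      moreover have "?b p \<le> ?b q" by (rule block_mono[OF sum(3)])
      ultimately have "(?b p, ?b q) \<in> D" using shifted_diagramsD(3)[OF D ij(6)] by blast
      with sum show ?thesis unfolding ideal_of_diagram_C_def by blast
    qed
    then show "c + d \<in> ?F" by (simp add: e_def)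
  next
    fix c d assume c: "c \<in> ?F" and d: "d \<in> ?F"
    have "c l = 1" "d l = 1" using F[OF c] F[OF d] by (auto simp: sum_coeff_apply)
    then have "(c + d) l = 2" by simp
    then show "c + d \<notin> coeffs_C l" using coeffs_C_at_l[of "c + d" l] by force
  }
qed

text \<open>
  From \<open>e\<^sub>i - e\<^sub>j\<close> in the ideal follows \<open>e\<^sub>i + e\<^sub>j\<close>, by adding \<open>2 e\<^sub>j\<close>. These two add up to the root \<open>2 e\<^sub>i\<close>.
\<close>

lemma coeff_ideal_C_no_difference:
  assumes F: "F \<in> coeff_ideals (coeffs_C l) K" and ij: "1 \<le> i" "i < j" "j \<le> l"
  shows "interval_coeff i j \<notin> F"
proof
  note f = coeff_idealsD[OF F]
  assume m: "interval_coeff i j \<in> F"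
  have e: "interval_coeff i j + sum_coeff l j j = sum_coeff l i j"
    using ij by (auto simp: sum_coeff_apply interval_coeff_def fun_eq_iff)
  have "interval_coeff i j + sum_coeff l j j \<in> F"
    by (rule f(3)[OF m]) (use ij e in \<open>auto intro: coeffs_C_sum\<close>)
  then have s: "sum_coeff l i j \<in> F" by (simp add: e)
  have "interval_coeff i j + sum_coeff l i j = sum_coeff l i i"
    using ij by (auto simp: sum_coeff_apply interval_coeff_def fun_eq_iff)
  then have "interval_coeff i j + sum_coeff l i j \<in> coeffs_C l"
    using ij by (auto intro: coeffs_C_sum)
  with f(4)[OF m s] show False by blast
qed

text \<open>
  The last block has number \<open>block K (Suc l)\<close> exactly if \<open>\<alpha>\<^sub>l\<close> belongs to \<open>I\<close>. In that case \<open>2 e\<^sub>j\<close> is a root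
  of \<open>\<Delta>\<^sub>I\<close> for each \<open>j\<close> in the last block, and subtracting it from \<open>e\<^sub>i + e\<^sub>j\<close> leads to the excluded root
  \<open>e\<^sub>i - e\<^sub>j\<close>.
\<close>

lemma coeff_ideal_C_sum:
  assumes F: "F \<in> coeff_ideals (coeffs_C l) K" and c: "c \<in> F"
  obtains i j where "c = sum_coeff l i j" "1 \<le> i" "i \<le> j" "j \<le> l" "block K j < block K (Suc l)"
proof -
  note f = coeff_idealsD[OF F]
  have "c \<in> coeffs_C l" using f(1) c by blast
  then show ?thesis
  proof (cases rule: coeffs_C_cases)
    case (diff i j)
    then show ?thesis using coeff_ideal_C_no_difference[OF F] c by blast
  next
    case (sum i j)
    have "block K j < block K (Suc l)"
    proof (rule ccontr)
      assume "\<not> block K j < block K (Suc l)"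
      then have bl: "block K j = block K (Suc l)" using block_mono[of j "Suc l" K] sum by simp
      have inK: "k \<in> K" if "j \<le> k" "k \<le> l" for k
        using block_eqD[OF bl, of k] that sum by simp
      have supp: "sum_coeff l j j k = 0" if "k \<notin> K" for k
        using inK[of k] that by (auto simp: sum_coeff_apply)
      show False
      proof (cases "i = j")
        case True
        then show False using f(2)[OF c] supp sum(1) by blast
      next
        case False
        with sum have ij: "i < j" by simp
        have e: "c + - sum_coeff l j j = interval_coeff i j"
          unfolding sum(1) using sum ij by (auto simp: sum_coeff_apply interval_coeff_def fun_eq_iff)
        have "c + - sum_coeff l j j \<in> F"
        proof (rule f(3)[OF c disjI2])
          show "- (- sum_coeff l j j) \<in> coeffs_C l \<and> (\<forall>k. k \<notin> K \<longrightarrow> (- sum_coeff l j j) k = 0)"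
            using supp sum by (auto intro: coeffs_C_sum)
          show "c + - sum_coeff l j j \<in> coeffs_C l"
            unfolding e using sum ij by (auto intro: coeffs_C_diff)
        qed
        then show False using coeff_ideal_C_no_difference[OF F sum(2) ij sum(4)] e by simp
      qed
    qed
    with sum that show ?thesis by blast
  qed
qed

lemma coeff_ideal_C_closed_left:
  assumes F: "F \<in> coeff_ideals (coeffs_C l) K" and ij: "sum_coeff l i j \<in> F" "1 \<le> i" "i \<le> l" "1 \<le> j" "j \<le> l"
    and p: "1 \<le> p" "p \<le> l" "block K p \<le> block K i"
  shows "sum_coeff l p j \<in> F"
proof -
  note f = coeff_idealsD[OF F]
  consider "p < i" | "p = i" | "i < p" by linarith
  then show ?thesis
  proof cases
    case 1
    have e: "sum_coeff l i j + interval_coeff p i = sum_coeff l p j"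
      using 1 ij p by (auto simp: sum_coeff_apply interval_coeff_def fun_eq_iff)
    have "sum_coeff l i j + interval_coeff p i \<in> F"
    proof (rule f(3)[OF ij(1) disjI1])
      show "interval_coeff p i \<in> coeffs_C l" using 1 p ij by (intro coeffs_C_diff)
      show "sum_coeff l i j + interval_coeff p i \<in> coeffs_C l"
        unfolding e using p ij by (intro coeffs_C_sum)
    qed
    then show ?thesis by (simp only: e)
  next
    case 2
    then show ?thesis using ij by simp
  next
    case 3
    then have bl: "block K i = block K p" using p block_mono[of i p K] by simp
    have e: "sum_coeff l i j + - interval_coeff i p = sum_coeff l p j"
      using 3 ij p by (auto simp: sum_coeff_apply interval_coeff_def fun_eq_iff)
    have "sum_coeff l i j + - interval_coeff i p \<in> F"
    proof (rule f(3)[OF ij(1) disjI2])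
      have "interval_coeff i p \<in> coeffs_C l" using 3 p ij by (intro coeffs_C_diff)
      moreover have "interval_coeff i p k = 0" if "k \<notin> K" for k
        using block_eqD[OF bl ij(2)] that by (auto simp: interval_coeff_def)
      ultimately show "- (- interval_coeff i p) \<in> coeffs_C l \<and> (\<forall>k. k \<notin> K \<longrightarrow> (- interval_coeff i p) k = 0)"
        by simp
      show "sum_coeff l i j + - interval_coeff i p \<in> coeffs_C l"
        unfolding e using p ij by (intro coeffs_C_sum)
    qed
    then show ?thesis by (simp only: e)
  qed
qed

lemma coeff_ideal_C_closed:
  assumes F: "F \<in> coeff_ideals (coeffs_C l) K" and ij: "sum_coeff l i j \<in> F" "1 \<le> i" "i \<le> l" "1 \<le> j" "j \<le> l"
    and p: "1 \<le> p" "p \<le> l" "block K p \<le> block K i" and q: "1 \<le> q" "q \<le> l" "block K q \<le> block K j"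
  shows "sum_coeff l p q \<in> F"
proof -
  have "sum_coeff l p j \<in> F" by (rule coeff_ideal_C_closed_left[OF F ij p])
  then have "sum_coeff l j p \<in> F" using sum_coeff_commute[of p l j] ij p by simp
  then have "sum_coeff l q p \<in> F"
    by (rule coeff_ideal_C_closed_left[OF F _ ij(4,5) p(1,2) q])
  then show ?thesis using sum_coeff_commute[of p l q] p q by simp
qed

lemma block_surj_less:
  assumes "x < block K (Suc l)" shows "\<exists>i. 1 \<le> i \<and> i \<le> l \<and> block K i = x"
proof -
  obtain i where i: "i \<in> {1..Suc l}" "block K i = x" using block_surj[of x K l] assms by auto
  then have "i \<noteq> Suc l" using assms by auto
  with i show ?thesis by (intro exI[of _ i]) auto
qed

lemma coeff_ideal_C_from_diagram:
  assumes F: "F \<in> coeff_ideals (coeffs_C l) K"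
  shows "F \<in> ideal_of_diagram_C l K ` shifted_diagrams (block K (Suc l))"
proof -
  let ?b = "block K" and ?m = "block K (Suc l)"
  note cl = coeff_ideal_C_closed[OF F]
  define D where "D = {(x, y). \<exists>i j. 1 \<le> i \<and> i \<le> j \<and> j \<le> l \<and> sum_coeff l i j \<in> F \<and> ?b j < ?m \<and>
    x = ?b i \<and> y = ?b j}"
  have DI: "(?b i, ?b j) \<in> D" if "1 \<le> i" "i \<le> j" "j \<le> l" "sum_coeff l i j \<in> F" "?b j < ?m" for i j
    unfolding D_def using that by blast
  have DE: "\<exists>i j. 1 \<le> i \<and> i \<le> j \<and> j \<le> l \<and> sum_coeff l i j \<in> F \<and> ?b j < ?m \<and> x = ?b i \<and> y = ?b j"
    if "(x, y) \<in> D" for x y using that unfolding D_def by blast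
  have "D \<in> shifted_diagrams ?m"
  proof (rule shifted_diagramsI)
    fix x y assume xy: "(x, y) \<in> D"
    show "x \<le> y" "y < ?m" using DE[OF xy] block_mono by blast+
  next
    fix x y x' y' assume xy: "(x, y) \<in> D" and le: "x' \<le> x" "y' \<le> y" "x' \<le> y'"
    obtain i j where ij: "1 \<le> i" "i \<le> j" "j \<le> l" "sum_coeff l i j \<in> F" "?b j < ?m" "x = ?b i" "y = ?b j"
      using DE[OF xy] by blast
    have "y' < ?m" using le ij by simp
    then obtain q where q: "1 \<le> q" "q \<le> l" "?b q = y'" using block_surj_less by blast
    obtain p where p: "1 \<le> p" "p \<le> q" "?b p = x'"
    proof (cases "x' = y'")
      case True
      with q that[of q] show ?thesis by simp
    next
      case False
      have "x' < ?m" using le \<open>y' < ?m\<close> by simp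
      then obtain p where p: "1 \<le> p" "p \<le> l" "?b p = x'" using block_surj_less by blast
      have "p < q" by (rule block_less[of K]) (use p q False le in simp)
      with p that[of p] show ?thesis by simp
    qed
    have "sum_coeff l p q \<in> F"
      by (rule cl[of i j]) (use ij p q le in auto)
    then show "(x', y') \<in> D" using DI[of p q] p q le ij by simp
  qed
  moreover have "F = ideal_of_diagram_C l K D"
  proof (intro subset_antisym subsetI)
    fix c assume c: "c \<in> F"
    obtain i j where ij: "c = sum_coeff l i j" "1 \<le> i" "i \<le> j" "j \<le> l" "?b j < ?m"
      using coeff_ideal_C_sum[OF F c] by blast
    with c DI[of i j] show "c \<in> ideal_of_diagram_C l K D" unfolding ideal_of_diagram_C_def by blast
  next
    fix c assume "c \<in> ideal_of_diagram_C l K D"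
    then obtain i j where ij: "c = sum_coeff l i j" "1 \<le> i" "i \<le> j" "j \<le> l" "(?b i, ?b j) \<in> D"
      unfolding ideal_of_diagram_C_def by blast
    obtain p q where pq: "1 \<le> p" "p \<le> q" "q \<le> l" "sum_coeff l p q \<in> F" "?b i = ?b p" "?b j = ?b q"
      using DE[OF ij(5)] by blast
    show "c \<in> F" unfolding ij(1) by (rule cl[of p q]) (use ij pq in auto)
  qed
  ultimately show ?thesis by blast
qed

lemma sum_coeff_inj:
  assumes e: "sum_coeff l i j = sum_coeff l p q" and "i \<le> j" "j \<le> l" "p \<le> q" "q \<le> l"
  shows "i = p \<and> j = q"
proof -
  have v: "sum_coeff l i j k = sum_coeff l p q k" for k using e by simp
  have pos: "0 < sum_coeff l a b k \<longleftrightarrow> a \<le> k \<and> k \<le> l" if "a \<le> b" for a b k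
    using that by (auto simp: sum_coeff_apply)
  have ip: "i = p"
    using pos[of i j i] pos[of p q i] pos[of i j p] pos[of p q p] v[of i] v[of p] assms(2-5)
    by (auto intro: antisym)
  moreover have "j = q"
  proof (rule ccontr)
    assume "j \<noteq> q"
    then consider "j < q" | "q < j" by linarith
    then show False
      using v[of j] v[of q] assms ip by cases (auto simp: sum_coeff_apply split: if_splits)
  qed
  ultimately show ?thesis by blast
qed

lemma ideal_of_diagram_C_inj:
  "inj_on (ideal_of_diagram_C l K) (shifted_diagrams (block K (Suc l)))"
proof -
  let ?b = "block K" and ?m = "block K (Suc l)"
  have "D \<subseteq> E" if D: "D \<in> shifted_diagrams ?m"
    and e: "ideal_of_diagram_C l K D \<subseteq> ideal_of_diagram_C l K E" for D E
  proof
    fix xy assume "xy \<in> D"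
    moreover obtain x y where xy: "xy = (x, y)" by fastforce
    ultimately have d: "(x, y) \<in> D" by simp
    have le: "x \<le> y" "y < ?m" using shifted_diagramsD(1,2)[OF D d] by auto
    obtain j where j: "1 \<le> j" "j \<le> l" "?b j = y" using block_surj_less[OF le(2)] by blast
    obtain i where i: "1 \<le> i" "i \<le> j" "?b i = x"
    proof (cases "x = y")
      case True
      with j that[of j] show ?thesis by simp
    next
      case False
      have "x < ?m" using le by simp
      then obtain i where i: "1 \<le> i" "i \<le> l" "?b i = x" using block_surj_less by blast
      have "i < j" by (rule block_less[of K]) (use i j False le in simp)
      with i that[of i] show ?thesis by simp
    qed
    have dij: "(?b i, ?b j) \<in> D" using d i(3) j(3) by simp
    then have "sum_coeff l i j \<in> ideal_of_diagram_C l K D"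
      using i(1,2) j(2) unfolding ideal_of_diagram_C_def by blast
    then have "sum_coeff l i j \<in> ideal_of_diagram_C l K E" using e by blast
    then obtain p q where pq: "sum_coeff l i j = sum_coeff l p q" "p \<le> q" "q \<le> l" "(?b p, ?b q) \<in> E"
      unfolding ideal_of_diagram_C_def by blast
    have "i = p \<and> j = q" by (rule sum_coeff_inj[OF pq(1) i(2) j(2) pq(2,3)])
    with pq(4) have "(?b i, ?b j) \<in> E" by simp
    then show "xy \<in> E" using i(3) j(3) xy by (simp only:)
  qed
  then show ?thesis by (intro inj_onI subset_antisym) auto
qed

lemma card_coeff_ideals_C:
  assumes "K \<subseteq> {1..l}" shows "card (coeff_ideals (coeffs_C l) K) = 2 ^ (l - card K)"
proof -
  have "coeff_ideals (coeffs_C l) K = ideal_of_diagram_C l K ` shifted_diagrams (block K (Suc l))"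
    using ideal_of_diagram_C_ideal coeff_ideal_C_from_diagram by blast
  then show ?thesis
    using card_image[OF ideal_of_diagram_C_inj, of l K] card_shifted_diagrams block_total[OF assms] by simp
qed

section \<open>The number of abelian ideals\<close>

theorem theorem4p8:
  fixes scale :: "complex \<Rightarrow> 'a::ab_group_add \<Rightarrow> 'a"
    and br :: "'a \<Rightarrow> 'a \<Rightarrow> 'a"
    and h :: "'a set"
    and \<Pi> I :: "('a \<Rightarrow> complex) set"
    and l :: nat
  assumes "simple_lie_algebra scale br"
    and "lie_algebra.cartan_subalgebra scale br h"
    and "lie_algebra.simple_system scale br h \<Pi>"
    and "(l \<ge> 1 \<and> lie_algebra.has_cartan_matrix scale br h \<Pi> l cartan_matrix_A) \<or>
         (l \<ge> 2 \<and> lie_algebra.has_cartan_matrix scale br h \<Pi> l (cartan_matrix_C l))"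
    and "I \<subseteq> \<Pi>"
  shows "card (lie_algebra.abelian_ideals scale br h \<Pi> I) = 2 ^ (l - card I)"
proof -
  interpret simple_lie_algebra scale br by (rule assms(1))
  have pair: "cartan_pair scale br h" by unfold_locales (rule assms(2))
  have typed: "card (abelian_ideals h \<Pi> I) = 2 ^ (l - card I)"
    if m: "has_cartan_matrix h \<Pi> l A" and Q: "positive_system l A Q"
      and w: "\<And>j. j \<in> {1..l} \<Longrightarrow> w j \<ge> (0::int)" "\<And>i. i \<in> {1..l} \<Longrightarrow> (\<Sum>j=1..l. A i j * w j) > 0"
      and count: "\<And>K. K \<subseteq> {1..l} \<Longrightarrow> card (coeff_ideals Q K) = 2 ^ (l - card K)"
    for A Q w
  proof -
    obtain a where a: "bij_betw a {1..l} \<Pi>"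
      "\<forall>i\<in>{1..l}. \<forall>j\<in>{1..l}. a i (coroot h (a j)) = of_int (A i j)"
      using m unfolding has_cartan_matrix_def by blast
    interpret cartan_type scale br h \<Pi> l A a
      by (intro cartan_type.intro cartan_type_axioms.intro pair assms(3)) (use a in auto)
    have "card (abelian_ideals h \<Pi> I) = card (coeff_ideals Q {i\<in>{1..l}. a i \<in> I})"
      by (rule card_abelian_ideals[OF Q w assms(5)])
    also have "\<dots> = 2 ^ (l - card {i\<in>{1..l}. a i \<in> I})" by (rule count) auto
    also have "\<dots> = 2 ^ (l - card I)" unfolding card_enum[OF assms(5)] ..
    finally show ?thesis .
  qed
  from assms(4) show ?thesis
  proof
    assume "l \<ge> 1 \<and> has_cartan_matrix h \<Pi> l cartan_matrix_A"
    then show ?thesis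
      by (intro typed[OF _ positive_system_A _ positive_weight_A card_coeff_ideals_A]) auto
  next
    assume "l \<ge> 2 \<and> has_cartan_matrix h \<Pi> l (cartan_matrix_C l)"
    then show ?thesis
      by (intro typed[OF _ positive_system_C _ positive_weight_C card_coeff_ideals_C]) auto
  qed
qed

end
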